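(* Let $Q$ be a quiver, with dimension vector $\alpha=(1,\dots,1)$, and let $(v_1,v_2)$ be a connected pair in $Q$. Let $Q'$, with dimension vector $\alpha'=(1,\dots,1)$, be the local quiver of $Q$ obtained by gluing the vertices $v_1$ and $v_2$. Suppose that at least one of the following holds: (a) there are exactly two paths from $v_1$ to $v_2$ and exactly two paths from $v_2$ to $v_1$; (b) there is exactly one path from $v_1$ to $v_2$; (c) there is exactly one path from $v_2$ to $v_1$. Then $(Q,\alpha)$ is a complete intersection if and only if $(Q',\alpha')$ is a complete intersection.
   Context: $\mathbb{C}$ denotes an algebraically closed field of characteristic zero. A quiver $Q=(V,A,s,t)$ is a finite directed graph with vertex set $V$, arrow set $A$ and source and target maps $s,t:A\to V$; loops and multiple arrows are allowed. For the dimension vector $\alpha=(1,\dots,1)$ the representation space is $Rep_\alpha Q=\mathbb{C}^{A}$, on which $GL_\alpha=(\mathbb{C}^* )^{V}$ acts by $(g\cdot X)_\rho=g_{t(\rho)}X_\rho g_{s(\rho)}^{-1}$, and $iss_\alpha Q=Rep_\alpha Q//GL_\alpha$ is the affine quotient, with coordinate ring $\mathbb{C}[iss_\alpha Q]=\mathbb{C}[Rep_\alpha Q]^{GL_\alpha}$. A primitive cycle is a directed cycle (of length $\ge 1$, up to cyclic rotation) that does not run through any vertex more than once; a loop is a primitive cycle. If $c_1,\dots,c_n$ are the primitive cycles of $Q$ and $f_i$ is the product of the coordinates $X_\rho$ over the arrows $\rho$ of $c_i$, then $f_1,\dots,f_n$ generate $\mathbb{C}[iss_\alpha Q]$. Let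 $\varphi:\mathbb{C}[x_1,\dots,x_n]\to\mathbb{C}[iss_\alpha Q]$, $\varphi(x_i)=f_i$. $(Q,\alpha)$ is called a complete intersection (C.I.) if $iss_\alpha Q$ is a complete intersection, i.e. $\mathrm{Ker}(\varphi)$ can be generated by $n-\dim(iss_\alpha Q)$ elements. A connected pair is a pair of distinct vertices $(v_1,v_2)$ such that there is at least one arrow from $v_1$ to $v_2$ and at least one arrow from $v_2$ to $v_1$. A path is a directed path with no repeated vertex; paths using different arrows are different (so parallel arrows give different paths, and a single arrow from $v_1$ to $v_2$ is a path). Gluing: let $W\subseteq V$ be a set of vertices such that the full subquiver of $Q$ on $W$, with arrow set $A_W$, is strongly connected. The local quiver obtained by gluing the vertices of $W$ is the quiver in which $W$ is replaced by a single new vertex $w$, each arrow between $W$ and $V\setminus W$ has its endpoint in $W$ replaced by $w$, the arrows of $A_W$ are replaced by $1+|A_W|-|W|$ loops at $w$, and everything else is unchanged. *)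

theory Defs
  imports
    "Graph_Theory.Graph_Theory"
    "HOL-Algebra.Ideal"
    "HOL-Algebra.Algebraic_Closure_Type"
    "HOL-Library.Poly_Mapping"
    "HOL-Library.Extended_Nat"
begin

section \<open>Polynomials in an indexed set of variables\<close>

text \<open>A monomial is a finitely supported exponent vector, a polynomial a finitely supported
  family of coefficients indexed by monomials; \<^const>\<open>times\<close> on \<^typ>\<open>'a \<Rightarrow>\<^sub>0 'b\<close> is convolution.\<close>

type_synonym ('i, 'k) mpoly = "('i \<Rightarrow>\<^sub>0 nat) \<Rightarrow>\<^sub>0 'k"

definition mpoly_const :: "'k::zero \<Rightarrow> ('i, 'k) mpoly" where
  "mpoly_const a = Poly_Mapping.single 0 a"

definition mpoly_var :: "'i \<Rightarrow> ('i, 'k::zero_neq_one) mpoly" where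
  "mpoly_var i = Poly_Mapping.single (Poly_Mapping.single i 1) 1"

text \<open>The substitution of \<open>x i\<close> for the variable \<open>i\<close>, the coefficients being mapped by \<open>c\<close>.\<close>

definition mpoly_subst ::
  "('k::zero \<Rightarrow> 'r::comm_semiring_1) \<Rightarrow> ('i \<Rightarrow> 'r) \<Rightarrow> ('i, 'k) mpoly \<Rightarrow> 'r" where
  "mpoly_subst c x p =
     (\<Sum>m\<in>Poly_Mapping.keys p. c (Poly_Mapping.lookup p m) *
        (\<Prod>i\<in>Poly_Mapping.keys m. x i ^ Poly_Mapping.lookup m i))"

abbreviation mpoly_eval :: "('i \<Rightarrow> 'k) \<Rightarrow> ('i, 'k::comm_semiring_1) mpoly \<Rightarrow> 'k" where
  "mpoly_eval \<equiv> mpoly_subst (\<lambda>a. a)"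

definition mpoly_ring :: "'i set \<Rightarrow> ('i, 'k::comm_ring_1) mpoly ring" where
  "mpoly_ring I = ring_of_type_algebra
     \<lparr>carrier := {p. \<forall>m\<in>Poly_Mapping.keys p. Poly_Mapping.keys m \<subseteq> I}\<rparr>"


section \<open>Krull dimension\<close>

definition krull_dim :: "('a, 'b) ring_scheme \<Rightarrow> enat" where
  "krull_dim R = Sup {enat d | d. \<exists>P :: nat \<Rightarrow> 'a set.
     (\<forall>i\<le>d. primeideal (P i) R) \<and> (\<forall>i<d. P i \<subset> P (Suc i))}"


section \<open>The quotient variety of a quiver for the dimension vector \<open>(1,\<dots>,1)\<close>\<close>

text \<open>A quiver is a \<^const>\<open>fin_digraph\<close>, with source map \<^const>\<open>tail\<close> and target map \<^const>\<open>head\<close>.\<close>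

definition torus :: "('v, 'a) pre_digraph \<Rightarrow> ('v \<Rightarrow> 'k::field) set" where
  "torus Q = {g. \<forall>v\<in>verts Q. g v \<noteq> 0}"

definition rep_act :: "('v, 'a) pre_digraph \<Rightarrow> ('v \<Rightarrow> 'k::field) \<Rightarrow> ('a \<Rightarrow> 'k) \<Rightarrow> 'a \<Rightarrow> 'k" where
  "rep_act Q g x = (\<lambda>e. g (head Q e) * x e * inverse (g (tail Q e)))"

text \<open>A point of the representation space is the restriction of some \<open>x :: 'a \<Rightarrow> 'k\<close> to \<open>arcs Q\<close>;
  polynomials in \<open>mpoly_ring (arcs Q)\<close> do not see the values of \<open>x\<close> elsewhere.\<close>

definition iss_ring :: "('v, 'a) pre_digraph \<Rightarrow> ('a, 'k::field) mpoly ring" where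
  "iss_ring Q = (mpoly_ring (arcs Q))
     \<lparr>carrier := {f \<in> carrier (mpoly_ring (arcs Q)).
        \<forall>g\<in>torus Q. \<forall>x. mpoly_eval (rep_act Q g x) f = mpoly_eval x f}\<rparr>"

text \<open>\<^const>\<open>pre_digraph.cycle\<close> admits loops. A primitive cycle is the set of all rotations
  of such an arc list.\<close>

definition primitive_cycles :: "('v, 'a) pre_digraph \<Rightarrow> 'a list set set" where
  "primitive_cycles Q = {{rotate n p | n. True} | p. pre_digraph.cycle Q p}"

definition cycle_poly :: "'a list set \<Rightarrow> ('a, 'k::comm_ring_1) mpoly" where
  "cycle_poly c = (\<Prod>e\<in>\<Union>(set ` c). mpoly_var e)"

definition cycle_hom :: "('a list set, 'k::comm_ring_1) mpoly \<Rightarrow> ('a, 'k) mpoly" where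
  "cycle_hom = mpoly_subst mpoly_const cycle_poly"

text \<open>The equation for the length reads \<open>length gs = n - dim\<close> without truncated subtraction;
  \<open>gs\<close> may contain repetitions.\<close>

definition complete_intersection :: "'k::field itself \<Rightarrow> ('v, 'a) pre_digraph \<Rightarrow> bool" where
  "complete_intersection _ Q \<longleftrightarrow>
     (let R = mpoly_ring (primitive_cycles Q) :: ('a list set, 'k) mpoly ring;
          S = iss_ring Q :: ('a, 'k) mpoly ring
      in \<exists>gs. set gs \<subseteq> carrier R \<and>
           enat (length gs) + krull_dim S = enat (card (primitive_cycles Q)) \<and>
           a_kernel R S cycle_hom = Idl\<^bsub>R\<^esub> (set gs))"


section \<open>Connected pairs and gluing\<close>

definition connected_pair :: "('v, 'a) pre_digraph \<Rightarrow> 'v \<Rightarrow> 'v \<Rightarrow> bool" where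
  "connected_pair Q v w \<longleftrightarrow>
     v \<in> verts Q \<and> w \<in> verts Q \<and> v \<noteq> w \<and> v \<rightarrow>\<^bsub>Q\<^esub> w \<and> w \<rightarrow>\<^bsub>Q\<^esub> v"

text \<open>Gluing is meant for \<open>W \<subseteq> verts Q\<close> with \<open>Q \<restriction> W\<close> strongly connected, so that the subtraction
  below is not truncated. The new vertex is \<^const>\<open>None\<close>, the new loops are the arcs \<open>Inr i\<close>.\<close>

definition glue_vertex :: "'v set \<Rightarrow> 'v \<Rightarrow> 'v option" where
  "glue_vertex W v = (if v \<in> W then None else Some v)"

definition glue :: "('v, 'a) pre_digraph \<Rightarrow> 'v set \<Rightarrow> ('v option, 'a + nat) pre_digraph" where
  "glue Q W = \<lparr>
     verts = insert None (Some ` (verts Q - W)),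
     arcs = Inl ` (arcs Q - arcs (Q \<restriction> W)) \<union>
            Inr ` {..<1 + card (arcs (Q \<restriction> W)) - card W},
     tail = case_sum (\<lambda>e. glue_vertex W (tail Q e)) (\<lambda>_. None),
     head = case_sum (\<lambda>e. glue_vertex W (head Q e)) (\<lambda>_. None)\<rparr>"

end

theory Submission
  imports Defs "HOL-Computational_Algebra.Polynomial"
begin

text \<open>
  Up to the names of its arcs, the glued quiver \<open>Q'\<close> is obtained from \<open>Q\<close> by contracting an arc
  \<open>E\<close> from \<open>v\<^sub>1\<close> to \<open>v\<^sub>2\<close>. The invariant ring of a quiver is spanned by its circulations, and its
  Krull dimension is the exponent with which the number of circulations of size at most \<open>n\<close>
  grows: algebraic dependence bounds it from above, a saturated chain of faces from below. The
  circulations of \<open>Q\<close> and \<open>Q'\<close> grow alike, because one lifts from \<open>Q'\<close> to \<open>Q\<close> after adding a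
  multiple of the 2-cycle \<open>E F\<close>. Hence the dimensions agree and only numbers of generators have
  to be compared.

  By conservation at \<open>v\<^sub>1\<close> the exponent of \<open>E\<close> is redundant, so both kernels are toric ideals of
  families of subsets of \<open>A - {E}\<close>. If \<open>E\<close> is the only path from \<open>v\<^sub>1\<close> to \<open>v\<^sub>2\<close>, the two families
  coincide. If the paths are \<open>E, p\<close> and \<open>F, q\<close>, let \<open>\<O>\<close> be the set of cycles not through both
  vertices. The families are \<open>{F}, q, p \<union> {F}, \<O>\<close> (and \<open>p \<union> q\<close>, if this is a cycle) for \<open>Q\<close> and
  \<open>{F}, q, p, \<O>\<close> for \<open>Q'\<close>. Let \<open>\<I>\<close> be \<open>\<O>\<close>, with \<open>p \<union> q\<close> added if it is a cycle, and let \<open>x\<^sup>t\<close> be a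
  monomial in the variables from \<open>\<I>\<close> representing the closed walk \<open>p q\<close>. The ideal for \<open>Q\<close> is
  generated by that of \<open>\<I>\<close> and the single binomial between \<open>x\<^sub>F x\<^sup>t\<close> and \<open>x\<^sub>q x\<^sub>p\<^sub>F\<close>. If \<open>p q\<close> is not
  a cycle, the ideal for \<open>Q'\<close> is generated by that of \<open>\<I>\<close> and the binomial between \<open>x\<^sub>q x\<^sub>p\<close> and
  \<open>x\<^sup>t\<close>; otherwise it arises from that of \<open>\<I>\<close> by substituting \<open>x\<^sub>p x\<^sub>q\<close> for the variable of \<open>p \<union> q\<close>.
  By the graded Nakayama lemma each of these binomials costs exactly one generator.
\<close>

section \<open>Monomials and substitution\<close>

text \<open>\<open>complete_intersection\<close> allows arbitrary generators, homogeneous or not.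
  The obstacle is therefore the lower bound: dropping a binomial \<open>r\<close> has to save a
  generator, whichever generators were chosen. This requires that \<open>r\<close> lies outside
  \<mm> J, for the maximal ideal \<mm> of the origin, and that some substitution kills
  \<open>r\<close> while fixing the smaller ideal. The first is read off from one coefficient. In
  the grading by the flow from \<open>v1\<close> to \<open>v2\<close> the variable
  \<open>x\<^sub>R\<close> has degree -1, \<open>x\<^sub>T\<close> has degree 1 and all others have
  degree 0. Hence neither is congruent to another monomial, and \<open>x\<^sub>R x\<^sub>T\<close>
  has coefficient 0 in all elements of \<mm> J, but coefficient -1 in \<open>r\<close>. The
  substitution depends on the case. If the closed walk is not a cycle, swapping the ends of the two
  paths at a common vertex splits it into two closed walks; these provide values for
  \<open>x\<^sub>R\<close> and \<open>x\<^sub>T\<close> without constant term. Sets of arcs serve as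
  names of the variables, so that the ideals of both quivers lie in one polynomial ring and can be
  compared there.\<close>

abbreviation keys where "keys \<equiv> Poly_Mapping.keys"
abbreviation lookup where "lookup \<equiv> Poly_Mapping.lookup"
abbreviation single where "single \<equiv> Poly_Mapping.single"

abbreviation monomial :: "('i \<Rightarrow>\<^sub>0 nat) \<Rightarrow> ('i, 'k::zero_neq_one) mpoly" where
  "monomial m \<equiv> single m 1"

lemma sum_single_lookup: "(\<Sum>m\<in>keys f. single m (lookup f m)) = f"
  by (rule poly_mapping_eqI) (simp add: lookup_sum lookup_single when_def in_keys_iff)

definition power_prod :: "('i \<Rightarrow> 'r::comm_monoid_mult) \<Rightarrow> ('i \<Rightarrow>\<^sub>0 nat) \<Rightarrow> 'r" where
  "power_prod x m = (\<Prod>i\<in>keys m. x i ^ lookup m i)"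

lemma power_prod_superset:
  assumes "finite S" "keys m \<subseteq> S"
  shows "power_prod x m = (\<Prod>i\<in>S. x i ^ lookup m i)"
  unfolding power_prod_def using assms
  by (intro prod.mono_neutral_left) (auto simp: in_keys_iff)

lemma power_prod_zero [simp]: "power_prod x 0 = 1"
  by (simp add: power_prod_def)

lemma power_prod_add: "power_prod x (m + n) = power_prod x m * power_prod x n"
proof -
  have "finite (keys m \<union> keys n)" by simp
  moreover have "keys (m + n) \<subseteq> keys m \<union> keys n" by (rule keys_add)
  ultimately show ?thesis
    by (simp add: power_prod_superset[of "keys m \<union> keys n"] lookup_add power_add prod.distrib)
qed

lemma power_prod_single: "power_prod x (single i k) = x i ^ k"
  by (cases "k = 0") (simp_all add: power_prod_def)

lemma power_prod_cong:
  assumes "\<And>i. i \<in> keys m \<Longrightarrow> x i = y i"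
  shows "power_prod x m = power_prod y m"
  using assms by (simp add: power_prod_def)

lemma monom_mult: "monomial m * monomial n = (monomial (m + n) :: ('i, 'k::comm_semiring_1) mpoly)"
  by (simp add: mult_single)

lemma lookup_monom_mult_add:
  "lookup (monomial m * f) (m + n) = lookup (f :: ('i, 'k::comm_semiring_1) mpoly) n"
  and lookup_monom_mult_eq_0:
  "(\<And>n. k \<noteq> m + n) \<Longrightarrow> lookup (monomial m * f) k = (0::'k)"
proof -
  have *: "lookup (monomial m * f) k = (\<Sum>n\<in>keys f. lookup f n when k = m + n)" for k
  proof -
    have "monomial m * f = monomial m * (\<Sum>n\<in>keys f. single n (lookup f n))"
      by (simp add: sum_single_lookup)
    also have "\<dots> = (\<Sum>n\<in>keys f. single (m + n) (lookup f n))"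
      by (simp add: sum_distrib_left mult_single)
    finally show ?thesis by (simp add: lookup_sum lookup_single eq_commute)
  qed
  show "lookup (monomial m * f) (m + n) = lookup f n"
  proof (cases "n \<in> keys f")
    case True
    then show ?thesis by (simp add: * when_def)
  next
    case False
    then show ?thesis by (simp add: * when_def not_in_keys_iff_lookup_eq_zero)
  qed
  show "lookup (monomial m * f) k = 0" if "\<And>n. k \<noteq> m + n"
    using that by (simp add: *)
qed

lemma mpoly_const_0 [simp]: "mpoly_const 0 = 0"
  and mpoly_const_1 [simp]: "mpoly_const 1 = 1"
  and mpoly_const_add: "mpoly_const (a + b) = mpoly_const a + mpoly_const b"
  and mpoly_const_mult: "mpoly_const (a * b) = mpoly_const a * mpoly_const b"
  for a b :: "'k::comm_semiring_1"
  by (simp_all add: mpoly_const_def single_add mult_single)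

lemma lookup_mpoly_const_mult:
  "lookup (mpoly_const c * f) m = c * lookup (f :: ('i, 'k::comm_semiring_1) mpoly) m"
proof -
  have "mpoly_const c * f = Poly_Mapping.map ((*) c) f"
    by (simp add: mpoly_const_def mult_map_scale_conv_mult)
  then show ?thesis by (simp add: map.rep_eq when_def)
qed

lemma mpoly_expand:
  fixes f :: "('i, 'k::comm_semiring_1) mpoly"
  assumes "finite S" "keys f \<subseteq> S"
  shows "f = (\<Sum>m\<in>S. mpoly_const (lookup f m) * monomial m)"
proof -
  have "f = (\<Sum>m\<in>keys f. single m (lookup f m))"
    by (simp add: sum_single_lookup)
  also have "\<dots> = (\<Sum>m\<in>S. single m (lookup f m))"
    using assms by (intro sum.mono_neutral_left) (auto simp: in_keys_iff)
  finally show ?thesis by (simp add: mpoly_const_def mult_single)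
qed

text \<open>Reduces claims about arbitrary coefficients of an ideal combination to coefficients that
  are single terms; this is how ideals are compared with linear spans.\<close>

lemma mpoly_linear_induct [case_names zero add]:
  fixes f :: "('i, 'k::comm_semiring_1) mpoly"
  assumes "P 0"
    and "\<And>m c g. m \<in> keys f \<Longrightarrow> P g \<Longrightarrow> P (mpoly_const c * monomial m + g)"
  shows "P f"
proof -
  have "P (\<Sum>m\<in>S. mpoly_const (lookup f m) * monomial m)" if "finite S" "S \<subseteq> keys f" for S
    using that by (induction S rule: finite_induct) (auto intro: assms)
  from this[of "keys f"] show ?thesis using mpoly_expand[of "keys f" f] by simp
qed

text \<open>Evaluation at a point is the case of the identity on coefficients, a homomorphism
  between polynomial rings the case \<open>c = mpoly_const\<close>; both occur below.\<close>

locale coeff_hom =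
  fixes c :: "'k::comm_semiring_1 \<Rightarrow> 'r::comm_semiring_1"
  assumes hom_0: "c 0 = 0" and hom_1: "c 1 = 1"
    and hom_add: "c (a + b) = c a + c b" and hom_mult: "c (a * b) = c a * c b"
begin

lemma subst_superset:
  assumes "finite S" "keys p \<subseteq> S"
  shows "mpoly_subst c x p = (\<Sum>m\<in>S. c (lookup p m) * power_prod x m)"
  unfolding mpoly_subst_def power_prod_def[symmetric] using assms
  by (intro sum.mono_neutral_left) (auto simp: in_keys_iff hom_0)

lemma subst_0 [simp]: "mpoly_subst c x 0 = 0"
  by (simp add: mpoly_subst_def)

lemma subst_single: "mpoly_subst c x (single m a) = c a * power_prod x m"
  by (cases "a = 0") (simp_all add: mpoly_subst_def power_prod_def hom_0)

lemma subst_monom [simp]: "mpoly_subst c x (monomial m) = power_prod x m"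
  by (simp add: subst_single hom_1)

lemma subst_1 [simp]: "mpoly_subst c x 1 = 1"
  using subst_monom[of x 0] by simp

lemma subst_const [simp]: "mpoly_subst c x (mpoly_const a) = c a"
  by (simp add: mpoly_const_def subst_single)

lemma subst_add: "mpoly_subst c x (p + q) = mpoly_subst c x p + mpoly_subst c x q"
proof -
  have "finite (keys p \<union> keys q)" by simp
  moreover have "keys (p + q) \<subseteq> keys p \<union> keys q" by (rule keys_add)
  ultimately show ?thesis
    by (simp add: subst_superset[of "keys p \<union> keys q"] lookup_add hom_add
        distrib_right sum.distrib)
qed

lemma subst_sum: "mpoly_subst c x (sum f A) = (\<Sum>a\<in>A. mpoly_subst c x (f a))"
  by (induction A rule: infinite_finite_induct) (simp_all add: subst_add)

lemma subst_mult: "mpoly_subst c x (p * q) = mpoly_subst c x p * mpoly_subst c x q"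
proof -
  have expand: "f = (\<Sum>m\<in>keys f. single m (lookup f m))" for f :: "('i, 'k) mpoly"
    by (simp add: sum_single_lookup)
  have "p * q = (\<Sum>m\<in>keys p. \<Sum>n\<in>keys q. single (m + n) (lookup p m * lookup q n))"
    by (subst expand[of p], subst expand[of q]) (simp add: sum_product mult_single)
  then have "mpoly_subst c x (p * q) = (\<Sum>m\<in>keys p. \<Sum>n\<in>keys q.
      (c (lookup p m) * power_prod x m) * (c (lookup q n) * power_prod x n))"
    by (simp add: subst_sum subst_single hom_mult power_prod_add algebra_simps)
  also have "\<dots> = mpoly_subst c x p * mpoly_subst c x q"
    by (simp add: subst_superset[of "keys p" p] subst_superset[of "keys q" q] sum_product)
  finally show ?thesis .
qed

end

interpretation const_hom: coeff_hom "mpoly_const :: 'k::comm_semiring_1 \<Rightarrow> ('i, 'k) mpoly"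
  by standard (simp_all add: mpoly_const_add mpoly_const_mult)

interpretation id_hom: coeff_hom "\<lambda>a :: 'k::comm_semiring_1. a"
  by standard simp_all

lemma const_subst_minus:
  "mpoly_subst mpoly_const x (p - q) =
     mpoly_subst mpoly_const x p - (mpoly_subst mpoly_const x q :: ('j, 'k::comm_ring_1) mpoly)"
  using const_hom.subst_add[of x "p - q" q] by simp

section \<open>Numbers of generators of ideals\<close>

abbreviation ideal_span :: "'r::comm_ring_1 set \<Rightarrow> 'r set" where
  "ideal_span \<equiv> module.span (*)"

interpretation ideal: Modules.module "(*) :: 'r::comm_ring_1 \<Rightarrow> 'r \<Rightarrow> 'r"
  by standard (simp_all add: algebra_simps)

text \<open>As a rewrite rule this undoes \<open>mult.assoc\<close>.\<close>

declare ideal.scale_scale [simp del]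

abbreviation const_scale :: "'k::field \<Rightarrow> ('i, 'k) mpoly \<Rightarrow> ('i, 'k) mpoly" where
  "const_scale c f \<equiv> mpoly_const c * f"

abbreviation linear_span :: "('i, 'k::field) mpoly set \<Rightarrow> ('i, 'k) mpoly set" where
  "linear_span \<equiv> module.span const_scale"

interpretation mpoly_space: vector_space "const_scale :: 'k::field \<Rightarrow> ('i, 'k) mpoly \<Rightarrow> ('i, 'k) mpoly"
  by standard (simp_all add: distrib_left distrib_right mult.assoc mpoly_const_add mpoly_const_mult)

declare mpoly_space.scale_scale [simp del]

text \<open>An upper bound instead of an exact number, since \<open>complete_intersection\<close>
  counts the entries of a list that may contain repetitions.\<close>

definition gen_by :: "nat \<Rightarrow> 'r::comm_ring_1 set \<Rightarrow> bool" where
  "gen_by N J \<longleftrightarrow> (\<exists>G. finite G \<and> card G \<le> N \<and> ideal_span G = J)"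

lemma ideal_span_hom:
  fixes h :: "'r::comm_ring_1 \<Rightarrow> 's::comm_ring_1"
  assumes "h 0 = 0" "\<And>a b. h (a + b) = h a + h b" "\<And>a b. h (a * b) = h a * h b"
  shows "h ` ideal_span S \<subseteq> ideal_span (h ` S)"
proof
  fix y assume "y \<in> h ` ideal_span S"
  then obtain x where "x \<in> ideal_span S" "y = h x" by blast
  then show "y \<in> ideal_span (h ` S)"
  proof (induction x arbitrary: y rule: ideal.span_induct_alt)
    case base
    then show ?case by (simp add: assms ideal.span_zero)
  next
    case (step c x y')
    then show ?case
      by (simp add: assms ideal.span_add ideal.span_scale ideal.span_base)
  qed
qed

lemma ideal_span_image_span:
  fixes h :: "'r::comm_ring_1 \<Rightarrow> 's::comm_ring_1"
  assumes "h 0 = 0" "\<And>a b. h (a + b) = h a + h b" "\<And>a b. h (a * b) = h a * h b"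
  shows "ideal_span (h ` ideal_span S) = ideal_span (h ` S)"
proof
  show "ideal_span (h ` ideal_span S) \<subseteq> ideal_span (h ` S)"
    using ideal_span_hom[OF assms] by (intro ideal.span_minimal) auto
  show "ideal_span (h ` S) \<subseteq> ideal_span (h ` ideal_span S)"
    by (intro ideal.span_mono image_mono ideal.span_superset)
qed

text \<open>\<open>h\<close> need not be surjective, so the image of an ideal is in general no ideal
  and has to be spanned anew.\<close>

lemma gen_by_image:
  fixes h :: "'r::comm_ring_1 \<Rightarrow> 's::comm_ring_1"
  assumes "h 0 = 0" "\<And>a b. h (a + b) = h a + h b" "\<And>a b. h (a * b) = h a * h b"
    and "gen_by N J"
  shows "gen_by N (ideal_span (h ` J))"
proof -
  obtain G where G: "finite G" "card G \<le> N" "ideal_span G = J"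
    using assms(4) by (auto simp: gen_by_def)
  have "card (h ` G) \<le> N" using card_image_le[OF G(1)] G(2) le_trans by blast
  then show ?thesis
    unfolding gen_by_def using ideal_span_image_span[OF assms(1-3), of G] G by blast
qed

lemma gen_by_insert:
  assumes "gen_by N (ideal_span B)"
  shows "gen_by (Suc N) (ideal_span (insert r B))"
proof -
  obtain G where G: "finite G" "card G \<le> N" "ideal_span G = ideal_span B"
    using assms by (auto simp: gen_by_def)
  have "ideal_span (insert r G) = ideal_span (insert r B)"
    using G(3) by (simp add: ideal.span_insert)
  moreover have "card (insert r G) \<le> Suc N"
    using G by (simp add: card_insert_if)
  ultimately show ?thesis unfolding gen_by_def using G(1) by blast
qed

section \<open>Exchange of generators in vector spaces\<close>

context vector_space
begin

lemma span_exchange: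
  assumes "finite A" "J \<subseteq> span (A \<union> B)" "H \<subseteq> J" "J \<subseteq> span H"
  shows "\<exists>D. finite D \<and> card D \<le> card A \<and> D \<subseteq> H \<and> J \<subseteq> span (D \<union> B)"
  using assms(1,2)
proof (induction A arbitrary: B rule: finite_induct)
  case empty
  then show ?case by (intro exI[of _ "{}"]) auto
next
  case (insert a A)
  show ?case
  proof (cases "H \<subseteq> span (A \<union> B)")
    case True
    then have "J \<subseteq> span (A \<union> B)"
      using assms(4) span_minimal[OF True subspace_span] by blast
    from insert.IH[OF this] show ?thesis using insert.hyps by (auto simp: le_SucI)
  next
    case False
    then obtain e where e: "e \<in> H" "e \<notin> span (A \<union> B)" by blast
    have "e \<in> span (insert a (A \<union> B))" using e(1) assms(3) insert.prems by auto
    then have a: "a \<in> span (insert e (A \<union> B))" using e(2) by (rule in_span_insert)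
    have "insert a A \<union> B \<subseteq> span (A \<union> insert e B)"
      using a by (auto intro: span_base)
    then have "J \<subseteq> span (A \<union> insert e B)"
      using insert.prems span_minimal[OF _ subspace_span] by blast
    from insert.IH[OF this] obtain D where D: "finite D" "card D \<le> card A" "D \<subseteq> H"
      "J \<subseteq> span (D \<union> insert e B)" by blast
    have "card (insert e D) \<le> card (insert a A)"
      using D insert.hyps by (simp add: card_insert_if)
    then show ?thesis using D e(1) by (intro exI[of _ "insert e D"]) auto
  qed
qed

text \<open>When the elements of \<open>A\<close> are removed one at a time, \<open>r\<close> leaves
  the span at some moment; the element removed at that moment can be exchanged for
  \<open>r\<close>.\<close>

lemma span_exchange_one:
  assumes "finite A" "r \<in> span (A \<union> B)" "r \<notin> span B"
  shows "\<exists>a\<in>A. a \<in> span (insert r (A - {a} \<union> B))"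
  using assms(1,2)
proof (induction A rule: finite_induct)
  case empty
  then show ?case using assms(3) by simp
next
  case (insert a A)
  show ?case
  proof (cases "r \<in> span (A \<union> B)")
    case True
    then obtain a' where a': "a' \<in> A" "a' \<in> span (insert r (A - {a'} \<union> B))"
      using insert.IH by blast
    have "insert r (A - {a'} \<union> B) \<subseteq> insert r (insert a A - {a'} \<union> B)" by blast
    from subsetD[OF span_mono[OF this] a'(2)]
    have "a' \<in> span (insert r (insert a A - {a'} \<union> B))" .
    then show ?thesis using a'(1) by (intro bexI[of _ a']) auto
  next
    case False
    then have "a \<in> span (insert r (A \<union> B))"
      using insert.prems by (simp add: in_span_insert)
    moreover have "insert a A - {a} = A" using insert.hyps by auto
    ultimately show ?thesis by auto
  qed
qed

end


section \<open>Graded ideals\<close>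

text \<open>Positive weights leave only the monomial 1 in degree 0. Multiplication by any other
  monomial raises the degree, which turns Nakayama's lemma into an induction on the degree.\<close>

locale weighted =
  fixes w :: "'i \<Rightarrow> nat"
  assumes w_pos: "w i > 0"
begin

definition wdeg :: "('i \<Rightarrow>\<^sub>0 nat) \<Rightarrow> nat" where
  "wdeg m = (\<Sum>i\<in>keys m. lookup m i * w i)"

lemma wdeg_superset:
  assumes "finite S" "keys m \<subseteq> S"
  shows "wdeg m = (\<Sum>i\<in>S. lookup m i * w i)"
  unfolding wdeg_def using assms by (intro sum.mono_neutral_left) (auto simp: in_keys_iff)

lemma wdeg_add: "wdeg (m + n) = wdeg m + wdeg n"
proof -
  have "finite (keys m \<union> keys n)" by simp
  moreover have "keys (m + n) \<subseteq> keys m \<union> keys n" by (rule keys_add)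
  ultimately show ?thesis
    by (simp add: wdeg_superset[of "keys m \<union> keys n"] lookup_add sum.distrib distrib_right)
qed

lemma wdeg_eq_0_iff: "wdeg m = 0 \<longleftrightarrow> m = 0"
proof
  assume "wdeg m = 0"
  then have "\<forall>i\<in>keys m. w i = 0" by (simp add: wdeg_def in_keys_iff)
  then have "keys m = {}" using w_pos by (metis all_not_in_conv less_irrefl)
  then show "m = 0" by simp
qed (simp add: wdeg_def)

definition component :: "nat \<Rightarrow> ('i, 'k::comm_ring_1) mpoly \<Rightarrow> ('i, 'k) mpoly" where
  "component d f = (\<Sum>m\<in>{m\<in>keys f. wdeg m = d}. single m (lookup f m))"

lemma lookup_component: "lookup (component d f) m = (lookup f m when wdeg m = d)"
  by (auto simp: component_def lookup_sum lookup_single when_def in_keys_iff)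

lemma component_0 [simp]: "component d 0 = 0"
  by (simp add: component_def)

lemma component_add: "component d (f + g) = component d f + component d g"
  by (rule poly_mapping_eqI) (simp add: lookup_component lookup_add when_def)

lemma component_const: "component d (mpoly_const c * f) = mpoly_const c * component d f"
  by (rule poly_mapping_eqI) (simp add: lookup_component lookup_mpoly_const_mult when_def)

lemma component_monom_mult:
  "component d (monomial u * f) =
     (if wdeg u \<le> d then monomial u * component (d - wdeg u) f else 0)"
proof (rule poly_mapping_eqI)
  fix k
  show "lookup (component d (monomial u * f)) k =
      lookup (if wdeg u \<le> d then monomial u * component (d - wdeg u) f else 0) k"
  proof (cases "\<exists>n. k = u + n")
    case True
    then obtain n where k: "k = u + n" by blast
    show ?thesis
      by (auto simp: k lookup_component lookup_monom_mult_add wdeg_add when_def)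
  next
    case False
    then have "lookup (monomial u * g) k = 0" for g :: "('i, 'a) mpoly"
      by (auto intro: lookup_monom_mult_eq_0)
    then show ?thesis by (simp add: lookup_component when_def)
  qed
qed

lemma component_idem: "component d (component e f) = (if d = e then component e f else 0)"
  by (rule poly_mapping_eqI) (auto simp: lookup_component when_def)

lemma sum_components: "(\<Sum>d\<in>wdeg ` keys f. component d f) = f"
  by (rule poly_mapping_eqI)
    (auto simp: lookup_component lookup_sum when_def in_keys_iff intro!: sum.neutral)

text \<open>No degree is singled out, so that 0 is homogeneous.\<close>

definition homogeneous :: "('i, 'k::comm_ring_1) mpoly \<Rightarrow> bool" where
  "homogeneous f \<longleftrightarrow> (\<forall>d. component d f \<in> {f, 0})"

lemma homogeneous_component: "homogeneous (component d f)"
  by (simp add: homogeneous_def component_idem)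

text \<open>The coefficients may be taken to be single terms, and multiplication by a term merely
  shifts the degree.\<close>

lemma component_in_ideal_span:
  assumes B: "\<And>b. b \<in> B \<Longrightarrow> homogeneous b" and f: "f \<in> ideal_span B"
  shows "component d f \<in> ideal_span B"
  using f
proof (induction f rule: ideal.span_induct_alt)
  case base
  then show ?case by (simp add: ideal.span_zero)
next
  case (step c x y)
  have "component d (c * x) \<in> ideal_span B"
  proof (induction c rule: mpoly_linear_induct)
    case zero
    then show ?case by (simp add: ideal.span_zero)
  next
    case (add m a g)
    have "component (d - wdeg m) x \<in> ideal_span B"
      using B[OF step(1)] step(1) by (auto simp: homogeneous_def ideal.span_base ideal.span_zero
        dest!: spec[of _ "d - wdeg m"])
    then have "component d (mpoly_const a * (monomial m * x)) \<in> ideal_span B"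
      unfolding component_const component_monom_mult
      by (auto intro: ideal.span_scale ideal.span_zero)
    then show ?case using add.IH
      by (simp add: distrib_right component_add mult.assoc ideal.span_add)
  qed
  then show ?case using step(2) by (simp add: component_add ideal.span_add)
qed

end

text \<open>The products of an ideal with the maximal ideal of the origin are spanned by these.\<close>

definition shifts :: "('i, 'k::comm_semiring_1) mpoly set \<Rightarrow> ('i, 'k) mpoly set" where
  "shifts J = {monomial u * h | u h. u \<noteq> 0 \<and> h \<in> J}"

text \<open>The constant terms of the coefficients contribute to the linear span of
  \<open>G\<close>, all their other terms to the products with the maximal ideal. So generators of J
  span J / \<mm> J as a vector space.\<close>

lemma ideal_span_subset_linear_span:
  "ideal_span G \<subseteq> linear_span (G \<union> shifts (ideal_span G))"
proof
  fix f assume "f \<in> ideal_span G"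
  then show "f \<in> linear_span (G \<union> shifts (ideal_span G))"
  proof (induction f rule: ideal.span_induct_alt)
    case base
    then show ?case by (rule mpoly_space.span_zero)
  next
    case (step c x y)
    have "c * x \<in> linear_span (G \<union> shifts (ideal_span G))"
    proof (induction c rule: mpoly_linear_induct)
      case zero
      then show ?case by (simp add: mpoly_space.span_zero)
    next
      case (add m a g)
      have "monomial m * x \<in> G \<union> shifts (ideal_span G)"
        using step(1) by (cases "m = 0") (auto simp: shifts_def intro: ideal.span_base)
      then have "mpoly_const a * (monomial m * x) \<in> linear_span (G \<union> shifts (ideal_span G))"
        by (intro mpoly_space.span_scale mpoly_space.span_base)
      then show ?case using add.IH by (simp add: distrib_right mult.assoc mpoly_space.span_add)
    qed
    then show ?case using step(2) by (rule mpoly_space.span_add)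
  qed
qed

text \<open>The constant coefficient is the value at the origin, and evaluation is
  multiplicative.\<close>

lemma lookup_mult_0:
  "lookup (f * g) 0 = lookup f 0 * lookup (g :: ('i, 'k::comm_semiring_1) mpoly) 0"
proof -
  have "lookup f 0 = mpoly_eval (\<lambda>_. 0) f" for f :: "('i, 'k) mpoly"
  proof -
    have "power_prod (\<lambda>_::'i. 0::'k) m = (1 when m = 0)" for m
    proof (cases "m = 0")
      case False
      then obtain i where "i \<in> keys m"
          by (metis lookup_zero not_in_keys_iff_lookup_eq_zero poly_mapping_eqI)
      then have "power_prod (\<lambda>_::'i. 0::'k) m = 0"
        unfolding power_prod_def
        by (intro prod_zero bexI[of _ i]) (auto simp: in_keys_iff zero_power)
      then show ?thesis using False by simp
    qed simp
    then have "mpoly_eval (\<lambda>_. 0) f = (\<Sum>m\<in>insert 0 (keys f). lookup f m * (1 when m = 0))"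
      by (subst id_hom.subst_superset[of "insert 0 (keys f)"]) auto
    also have "\<dots> = lookup f 0" by (subst sum.insert_remove) (auto simp: when_def intro!: sum.neutral)
    finally show ?thesis by simp
  qed
  then show ?thesis by (simp add: id_hom.subst_mult)
qed

lemma lookup_power_prod_0:
  fixes y :: "'i \<Rightarrow> ('j, 'k::comm_semiring_1) mpoly"
  assumes "\<And>i. lookup (y i) 0 = 0" "u \<noteq> 0"
  shows "lookup (power_prod y u) 0 = 0"
proof -
  obtain i where i: "i \<in> keys u"
    using assms(2) by (metis lookup_zero not_in_keys_iff_lookup_eq_zero poly_mapping_eqI)
  then obtain n where n: "lookup u i = Suc n" by (cases "lookup u i") (auto simp: in_keys_iff)
  have "power_prod y u = y i ^ lookup u i * (\<Prod>i\<in>keys u - {i}. y i ^ lookup u i)"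
    unfolding power_prod_def using i by (simp add: prod.remove)
  then show ?thesis by (simp add: n lookup_mult_0 assms(1))
qed

lemma mult_in_linear_span_shifts:
  assumes "lookup c 0 = 0" "h \<in> J"
  shows "c * h \<in> linear_span (shifts J)"
proof -
  have c: "c = (\<Sum>m\<in>keys c. mpoly_const (lookup c m) * monomial m)"
    by (rule mpoly_expand) auto
  have "mpoly_const (lookup c m) * (monomial m * h) \<in> linear_span (shifts J)" if "m \<in> keys c" for m
  proof -
    have "m \<noteq> 0" using that assms(1) by (auto simp: in_keys_iff)
    then have "monomial m * h \<in> shifts J" using assms(2) by (auto simp: shifts_def)
    then show ?thesis by (intro mpoly_space.span_scale mpoly_space.span_base)
  qed
  then show ?thesis
    by (subst c) (simp add: sum_distrib_right mult.assoc mpoly_space.span_sum)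
qed

section \<open>Nakayama's lemma and numbers of generators\<close>

context weighted
begin

text \<open>In the induction on the degree, a component of an element of \<open>shifts J\<close> is
  a multiple of a component of strictly lower degree of an element of \<open>J\<close>, which is
  already known to lie in the span of \<open>D\<close>.\<close>

lemma graded_nakayama:
  assumes J: "\<And>f d. f \<in> J \<Longrightarrow> component d f \<in> J"
    and D: "\<And>x. x \<in> D \<Longrightarrow> homogeneous x"
    and le: "J \<subseteq> linear_span (D \<union> shifts J)"
  shows "J \<subseteq> ideal_span D"
proof -
  have comp: "component d f \<in> ideal_span D" if "f \<in> J" for d f
    using that
  proof (induction d arbitrary: f rule: less_induct)
    case (less d)
    have "f \<in> linear_span (D \<union> shifts J)" using less.prems le by blast
    then show ?case
    proof (induction f rule: mpoly_space.span_induct_alt)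
      case base
      then show ?case by (simp add: ideal.span_zero)
    next
      case (step c x y)
      have "component d x \<in> ideal_span D"
      proof (cases "x \<in> D")
        case True
        then show ?thesis using D[OF True]
          by (auto simp: homogeneous_def ideal.span_base ideal.span_zero dest!: spec[of _ d])
      next
        case False
        then obtain u h where x: "x = monomial u * h" "u \<noteq> 0" "h \<in> J"
          using step(1) by (auto simp: shifts_def)
        have "d - wdeg u < d" if "wdeg u \<le> d" using that x(2) wdeg_eq_0_iff[of u] by simp
        then show ?thesis using less.IH x(3)
          by (auto simp: x(1) component_monom_mult ideal.span_zero intro: ideal.span_scale)
      qed
      then show ?case using step(2)
        by (simp add: component_add component_const ideal.span_add ideal.span_scale)
    qed
  qed
  show ?thesis
  proof
    fix f assume "f \<in> J"
    then have "(\<Sum>d\<in>wdeg ` keys f. component d f) \<in> ideal_span D"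
      by (intro ideal.span_sum comp)
    then show "f \<in> ideal_span D" by (simp add: sum_components)
  qed
qed

text \<open>Nakayama's lemma asks for homogeneous elements, whereas \<open>A\<close> is arbitrary.
  The homogeneous elements of the ideal span it linearly, so the exchange lemma trades
  \<open>A\<close> for at most as many of them.\<close>

lemma gen_by_of_linear_span:
  fixes B :: "('i, 'k::field) mpoly set"
  assumes B: "\<And>b. b \<in> B \<Longrightarrow> homogeneous b"
    and A: "finite A" "card A \<le> N"
    and le: "ideal_span B \<subseteq> linear_span (A \<union> shifts (ideal_span B))"
  shows "gen_by N (ideal_span B)"
proof -
  define J where "J = ideal_span B"
  define H where "H = {f \<in> J. homogeneous f}"
  have J: "component d f \<in> J" if "f \<in> J" for d f
    using component_in_ideal_span[OF B] that by (auto simp: J_def)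
  have "J \<subseteq> linear_span H"
  proof
    fix f assume "f \<in> J"
    then have "component d f \<in> H" for d using J by (simp add: H_def homogeneous_component)
    then have "(\<Sum>d\<in>wdeg ` keys f. component d f) \<in> linear_span H"
      by (intro mpoly_space.span_sum mpoly_space.span_base)
    then show "f \<in> linear_span H" by (simp add: sum_components)
  qed
  moreover have "H \<subseteq> J" by (auto simp: H_def)
  ultimately obtain D where D: "finite D" "card D \<le> card A" "D \<subseteq> H"
      "J \<subseteq> linear_span (D \<union> shifts J)"
    using mpoly_space.span_exchange[OF A(1) le[folded J_def]] by blast
  have "J \<subseteq> ideal_span D"
    using D(3) by (intro graded_nakayama[OF J _ D(4)]) (auto simp: H_def)
  moreover have "ideal_span D \<subseteq> J"
    unfolding J_def using D(3) by (intro ideal.span_minimal) (auto simp: H_def J_def)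
  ultimately show ?thesis
    unfolding gen_by_def J_def[symmetric] using D A(2) by (intro exI[of _ D]) auto
qed

text \<open>A generator \<open>r\<close> outside \<open>\<mm> J\<close> can be traded for one of any other generating set, up to
  \<open>\<mm> J\<close>; the substitution then kills it and returns to the smaller ideal.\<close>

lemma gen_by_remove_generator:
  fixes B :: "('i, 'k::field) mpoly set" and y :: "'i \<Rightarrow> ('i, 'k) mpoly"
  assumes B: "\<And>b. b \<in> B \<Longrightarrow> homogeneous b"
    and y0: "\<And>i. lookup (y i) 0 = 0"
    and yB: "\<And>b. b \<in> B \<Longrightarrow> mpoly_subst mpoly_const y b = b"
    and yr: "mpoly_subst mpoly_const y r = 0"
    and r: "r \<notin> linear_span (shifts (ideal_span (insert r B)))"
    and gen: "gen_by N (ideal_span (insert r B))"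
  shows "N \<ge> 1 \<and> gen_by (N - 1) (ideal_span B)"
proof -
  define J where "J = ideal_span (insert r B)"
  define h where "h = (mpoly_subst mpoly_const y :: ('i, 'k) mpoly \<Rightarrow> ('i, 'k) mpoly)"
  have h: "h 0 = 0" "h (f + g) = h f + h g" "h (f * g) = h f * h g" for f g
    by (simp_all add: h_def const_hom.subst_add const_hom.subst_mult)
  have h_const: "h (mpoly_const c) = mpoly_const c" for c by (simp add: h_def)
  obtain G where G: "finite G" "card G \<le> N" "ideal_span G = J"
    using gen by (auto simp: gen_by_def J_def)
  have le: "J \<subseteq> linear_span (G \<union> shifts J)"
    using ideal_span_subset_linear_span[of G] by (simp add: G(3))
  have "r \<in> J" by (simp add: J_def ideal.span_base)
  with le have "r \<in> linear_span (G \<union> shifts J)" by blast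
  then obtain a where a: "a \<in> G" "a \<in> linear_span (insert r (G - {a} \<union> shifts J))"
    using mpoly_space.span_exchange_one[OF G(1)] r[folded J_def] by blast
  define A where "A = h ` (G - {a})"
  have hJ: "h f \<in> ideal_span B" if "f \<in> J" for f
  proof -
    have "h ` insert r B \<subseteq> ideal_span B"
      using yB yr by (auto simp: h_def ideal.span_zero ideal.span_base)
    then have "ideal_span (h ` insert r B) \<subseteq> ideal_span B"
      by (intro ideal.span_minimal) auto
    then show ?thesis
      using ideal_span_hom[of h "insert r B"] h that by (auto simp: J_def)
  qed
  have "G \<union> shifts J \<subseteq> linear_span (insert r (G - {a} \<union> shifts J))"
    using a(2) by (auto intro: mpoly_space.span_base)
  then have le': "J \<subseteq> linear_span (insert r (G - {a} \<union> shifts J))"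
    using le mpoly_space.span_minimal[OF _ mpoly_space.subspace_span] by blast
  \<comment> \<open>\<open>h\<close> sends \<open>r\<close> to 0 and \<open>G - {a}\<close> onto
    \<open>A\<close>. As the \<open>y i\<close> have no constant term, it sends
    \<open>shifts J\<close> into the linear span of the shifts of the smaller ideal.\<close>
  have hJ': "h f \<in> linear_span (A \<union> shifts (ideal_span B))" if "f \<in> J" for f
  proof -
    have "f \<in> linear_span (insert r (G - {a} \<union> shifts J))" using that le' by blast
    then show ?thesis
    proof (induction f rule: mpoly_space.span_induct_alt)
      case base
      then show ?case by (simp add: h mpoly_space.span_zero)
    next
      case (step c x z)
      have "h x \<in> linear_span (A \<union> shifts (ideal_span B))"
      proof (cases "x \<in> insert r (G - {a})")
        case True
        then have "h x = 0 \<or> h x \<in> A" using yr by (auto simp: h_def A_def)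
        then show ?thesis by (auto simp: mpoly_space.span_zero intro: mpoly_space.span_base)
      next
        case False
        then obtain u g where x: "x = monomial u * g" "u \<noteq> 0" "g \<in> J"
          using step(1) by (auto simp: shifts_def)
        have "h x = power_prod y u * h g" by (simp add: x(1) h(3)) (simp add: h_def)
        moreover have "lookup (power_prod y u) 0 = 0"
          using lookup_power_prod_0[OF y0 x(2)] .
        ultimately have "h x \<in> linear_span (shifts (ideal_span B))"
          using hJ[OF x(3)] by (simp add: mult_in_linear_span_shifts)
        then show ?thesis using mpoly_space.span_mono[of "shifts (ideal_span B)"] by blast
      qed
      then show ?case using step(2)
        by (simp add: h h_const mpoly_space.span_add mpoly_space.span_scale)
    qed
  qed
  have "B \<subseteq> linear_span (A \<union> shifts (ideal_span B))"
  proof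
    fix b assume "b \<in> B"
    then have "b \<in> J" "h b = b" by (auto simp: J_def h_def yB intro: ideal.span_base)
    then show "b \<in> linear_span (A \<union> shifts (ideal_span B))" using hJ' by metis
  qed
  then have "B \<union> shifts (ideal_span B) \<subseteq> linear_span (A \<union> shifts (ideal_span B))"
    by (auto intro: mpoly_space.span_base)
  then have "ideal_span B \<subseteq> linear_span (A \<union> shifts (ideal_span B))"
    using ideal_span_subset_linear_span[of B]
      mpoly_space.span_minimal[OF _ mpoly_space.subspace_span] by blast
  moreover have "card G \<ge> 1" using a(1) G(1) by (auto simp: Suc_le_eq card_gt_0_iff)
  moreover have "card A \<le> N - 1"
    using card_image_le[of "G - {a}" h] G(1,2) a(1) by (simp add: A_def card_Diff_singleton)
  ultimately show ?thesis
    using gen_by_of_linear_span[OF B, of B A "N - 1"] G by (simp add: A_def)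
qed

end

section \<open>Toric ideals of families of sets\<close>

text \<open>The exponent of \<open>e\<close> in the image of \<open>monomial u\<close> under the
  toric map. It is a plain function because infinite sets \<open>C\<close> are not excluded.\<close>

definition cover :: "('b set \<Rightarrow>\<^sub>0 nat) \<Rightarrow> 'b \<Rightarrow> nat" where
  "cover u e = (\<Sum>C\<in>keys u. if e \<in> C then lookup u C else 0)"

definition binomials :: "'b set set \<Rightarrow> ('b set, 'k::comm_ring_1) mpoly set" where
  "binomials \<C> = {monomial u - monomial v | u v. keys u \<subseteq> \<C> \<and> keys v \<subseteq> \<C> \<and> cover u = cover v}"

text \<open>The kernel of the map sending the variable \<open>C \<in> \<C>\<close> to the product of the variables in \<open>C\<close>,
  extended to the polynomial ring in all variables.\<close>

definition toric_ideal :: "'b set set \<Rightarrow> ('b set, 'k::comm_ring_1) mpoly set" where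
  "toric_ideal \<C> = ideal_span (binomials \<C>)"

lemma binomialsI:
  "keys u \<subseteq> \<C> \<Longrightarrow> keys v \<subseteq> \<C> \<Longrightarrow> cover u = cover v \<Longrightarrow> monomial u - monomial v \<in> binomials \<C>"
  unfolding binomials_def by blast

lemma binomialsE:
  assumes "b \<in> binomials \<C>"
  obtains u v where "b = monomial u - monomial v" "keys u \<subseteq> \<C>" "keys v \<subseteq> \<C>" "cover u = cover v"
  using assms unfolding binomials_def by blast

lemma cover_superset:
  assumes "finite S" "keys u \<subseteq> S"
  shows "cover u e = (\<Sum>C\<in>S. if e \<in> C then lookup u C else 0)"
  unfolding cover_def using assms by (intro sum.mono_neutral_left) (auto simp: in_keys_iff)

lemma cover_0 [simp]: "cover 0 e = 0"
  by (simp add: cover_def)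

lemma cover_add [simp]: "cover (u + v) e = cover u e + cover v e"
proof -
  have "finite (keys u \<union> keys v)" by simp
  moreover have "keys (u + v) \<subseteq> keys u \<union> keys v" by (rule keys_add)
  ultimately show ?thesis
    by (simp add: cover_superset[of "keys u \<union> keys v"] sum.distrib[symmetric])
      (auto intro!: sum.cong simp: lookup_add)
qed

lemma cover_single [simp]: "cover (single C n) e = (if e \<in> C then n else 0)"
  by (cases "n = 0") (simp_all add: cover_def)

lemma cover_eq_0:
  assumes "\<And>C. C \<in> keys u \<Longrightarrow> C \<noteq> {}" "\<And>e. cover u e = 0"
  shows "u = 0"
proof (rule ccontr)
  assume "u \<noteq> 0"
  then obtain C where C: "C \<in> keys u" by (metis all_not_in_conv keys_eq_empty)
  then obtain e where "e \<in> C" using assms(1) by blast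
  then have "lookup u C = 0" using assms(2)[of e] C by (auto simp: cover_def)
  then show False using C by (simp add: in_keys_iff)
qed

text \<open>For finite sets \<open>C\<close> this depends on \<open>cover u\<close> only
  (\<open>flow_eq_sum_cover\<close>), so each \<delta> provides a grading in which the binomials are
  homogeneous.\<close>

definition flow :: "('b \<Rightarrow> int) \<Rightarrow> ('b set \<Rightarrow>\<^sub>0 nat) \<Rightarrow> int" where
  "flow \<delta> u = (\<Sum>C\<in>keys u. int (lookup u C) * sum \<delta> C)"

lemma flow_superset:
  assumes "finite S" "keys u \<subseteq> S"
  shows "flow \<delta> u = (\<Sum>C\<in>S. int (lookup u C) * sum \<delta> C)"
  unfolding flow_def using assms by (intro sum.mono_neutral_left) (auto simp: in_keys_iff)

lemma flow_add [simp]: "flow \<delta> (u + v) = flow \<delta> u + flow \<delta> v"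
proof -
  have "finite (keys u \<union> keys v)" by simp
  moreover have "keys (u + v) \<subseteq> keys u \<union> keys v" by (rule keys_add)
  ultimately show ?thesis
    by (simp add: flow_superset[of "keys u \<union> keys v"] lookup_add sum.distrib distrib_right)
qed

lemma flow_single [simp]: "flow \<delta> (single C n) = int n * sum \<delta> C"
  by (cases "n = 0") (simp_all add: flow_def)

lemma flow_eq_0: "(\<And>C. C \<in> keys u \<Longrightarrow> sum \<delta> C = 0) \<Longrightarrow> flow \<delta> u = 0"
  by (simp add: flow_def)

lemma flow_eq_sum_cover:
  assumes "finite \<Omega>" "\<And>C. C \<in> keys u \<Longrightarrow> C \<subseteq> \<Omega>"
  shows "flow \<delta> u = (\<Sum>e\<in>\<Omega>. \<delta> e * int (cover u e))"
proof -
  have "sum \<delta> C = (\<Sum>e\<in>\<Omega>. if e \<in> C then \<delta> e else 0)" if "C \<in> keys u" for C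
    using assms that by (simp add: sum.If_cases Int_absorb1)
  then have "flow \<delta> u = (\<Sum>C\<in>keys u. \<Sum>e\<in>\<Omega>. int (lookup u C) * (if e \<in> C then \<delta> e else 0))"
    by (simp add: flow_def sum_distrib_left)
  also have "\<dots> = (\<Sum>e\<in>\<Omega>. \<Sum>C\<in>keys u. int (lookup u C) * (if e \<in> C then \<delta> e else 0))"
    by (rule sum.swap)
  also have "\<dots> = (\<Sum>e\<in>\<Omega>. \<delta> e * int (cover u e))"
    by (auto simp: cover_def sum_distrib_left intro!: sum.cong)
  finally show ?thesis .
qed

lemma flow_cong_cover:
  assumes "cover u = cover v" "\<And>C. C \<in> keys u \<union> keys v \<Longrightarrow> finite C"
  shows "flow \<delta> u = flow \<delta> v"
proof -
  have "finite (\<Union>(keys u \<union> keys v))" using assms(2) by (intro finite_Union) auto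
  then show ?thesis
    using assms(1) by (subst (1 2) flow_eq_sum_cover[of "\<Union>(keys u \<union> keys v)"]) auto
qed

section \<open>Induction on exponents, and substitution into binomials\<close>

lemma exponent_split:
  fixes u :: "'b \<Rightarrow>\<^sub>0 nat"
  assumes "keys u \<subseteq> insert a S"
  obtains i u' where "u = single a i + u'" "keys u' \<subseteq> S"
proof
  show "u = single a (lookup u a) + (u - single a (lookup u a))"
    by (rule poly_mapping_eqI) (simp add: lookup_add lookup_minus lookup_single when_def)
  show "keys (u - single a (lookup u a)) \<subseteq> S"
  proof
    fix x assume "x \<in> keys (u - single a (lookup u a))"
    then have "x \<in> keys u" "x \<noteq> a"
      by (auto simp: in_keys_iff lookup_minus lookup_single when_def split: if_splits)
    then show "x \<in> S" using assms by blast
  qed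
qed

lemma exponent_induct [case_names zero add]:
  fixes u :: "'b \<Rightarrow>\<^sub>0 nat"
  assumes "P 0" "\<And>i u. i \<in> keys (single i 1 + u) \<Longrightarrow> P u \<Longrightarrow> P (single i 1 + u)"
  shows "P u"
proof (induction "sum (lookup u) (keys u)" arbitrary: u)
  case 0
  then have "u = 0" by (intro poly_mapping_eqI) (auto simp: in_keys_iff)
  then show ?case using assms(1) by simp
next
  case (Suc n)
  then obtain i where i: "i \<in> keys u" by fastforce
  define v where "v = u - single i 1"
  have u: "u = single i 1 + v"
    using i by (intro poly_mapping_eqI)
      (auto simp: v_def lookup_add lookup_minus lookup_single when_def in_keys_iff)
  have "keys v \<subseteq> keys u" by (auto simp: v_def in_keys_iff lookup_minus)
  then have "sum (lookup v) (keys v) = sum (lookup v) (keys u)"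
    by (intro sum.mono_neutral_left) (auto simp: in_keys_iff)
  moreover have "sum (lookup u) (keys u) = 1 + sum (lookup v) (keys u)"
    using i by (subst u) (simp add: lookup_add sum.distrib lookup_single when_def)
  ultimately have "P v" using Suc by simp
  then show ?case using assms(2)[of i v] i u by metis
qed

lemma keys_single_add: "keys (single i 1 + u) = insert i (keys u)" for u :: "'b \<Rightarrow>\<^sub>0 nat"
  by (auto simp: in_keys_iff lookup_add lookup_single when_def split: if_splits)

lemma power_prod_var: "power_prod mpoly_var u = (monomial u :: ('i, 'k::comm_semiring_1) mpoly)"
  by (induction u rule: exponent_induct)
    (simp_all add: power_prod_add power_prod_single mpoly_var_def mult_single)

lemma subst_binomial_id:
  fixes b :: "('b set, 'k::comm_ring_1) mpoly"
  assumes "b \<in> binomials \<C>" "\<And>C. C \<in> \<C> \<Longrightarrow> y C = mpoly_var C"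
  shows "mpoly_subst mpoly_const y b = b"
proof -
  obtain u v where b: "b = monomial u - monomial v" "keys u \<subseteq> \<C>" "keys v \<subseteq> \<C>"
    using assms(1) by (rule binomialsE)
  have "power_prod y m = (monomial m :: ('b set, 'k) mpoly)" if "keys m \<subseteq> \<C>" for m
  proof -
    have "power_prod y m = power_prod mpoly_var m"
      using that assms(2) by (intro power_prod_cong) auto
    then show ?thesis by (simp add: power_prod_var)
  qed
  then show ?thesis using b by (simp add: const_subst_minus)
qed

lemma power_prod_monomial:
  fixes y :: "'b set \<Rightarrow> ('b set, 'k::comm_ring_1) mpoly"
  assumes "\<And>C. C \<in> keys u \<Longrightarrow> \<exists>g. y C = monomial g \<and> keys g \<subseteq> \<D> \<and> cover g = cover (single C 1)"
  shows "\<exists>u'. power_prod y u = monomial u' \<and> keys u' \<subseteq> \<D> \<and> cover u' = cover u"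
  using assms
proof (induction u rule: exponent_induct)
  case zero
  then show ?case by (intro exI[of _ 0]) simp
next
  case (add C u)
  obtain u' where u': "power_prod y u = monomial u'" "keys u' \<subseteq> \<D>" "cover u' = cover u"
    using add.IH add.prems keys_single_add[of C u] by blast
  obtain g where g: "y C = monomial g" "keys g \<subseteq> \<D>" "cover g = cover (single C 1)"
    using add.prems keys_single_add[of C u] by blast
  have "power_prod y (single C 1 + u) = monomial (g + u')"
    using g u' by (simp add: power_prod_add power_prod_single monom_mult)
  moreover have "keys (g + u') \<subseteq> \<D>" using keys_add[of g u'] g u' by blast
  moreover have "cover (g + u') = cover (single C 1 + u)" using g u' by (simp add: fun_eq_iff)
  ultimately show ?case by blast
qed

lemma subst_binomials:
  fixes y :: "'b set \<Rightarrow> ('b set, 'k::comm_ring_1) mpoly"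
  assumes "\<And>C. C \<in> \<C> \<Longrightarrow> \<exists>g. y C = monomial g \<and> keys g \<subseteq> \<D> \<and> cover g = cover (single C 1)"
    and "b \<in> binomials \<C>"
  shows "mpoly_subst mpoly_const y b \<in> binomials \<D>"
proof -
  obtain u v where b: "b = monomial u - monomial v" "keys u \<subseteq> \<C>" "keys v \<subseteq> \<C>" "cover u = cover v"
    using assms(2) by (rule binomialsE)
  obtain u' where u': "power_prod y u = monomial u'" "keys u' \<subseteq> \<D>" "cover u' = cover u"
    using power_prod_monomial[of u y \<D>] assms(1) b by blast
  obtain v' where v': "power_prod y v = monomial v'" "keys v' \<subseteq> \<D>" "cover v' = cover v"
    using power_prod_monomial[of v y \<D>] assms(1) b by blast
  show ?thesis using b u' v' by (auto simp: const_subst_minus intro: binomialsI)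
qed

lemma monom_diff_shift:
  "monomial (a + b) - monomial (a + c) =
      monomial a * (monomial b - monomial c :: ('i, 'k::comm_ring_1) mpoly)"
  by (simp add: right_diff_distrib mult_single)

lemma ideal_span_monom_trans:
  assumes "monomial a - monomial b \<in> ideal_span S" "monomial b - monomial c \<in> ideal_span S"
  shows "monomial a - monomial c \<in> (ideal_span S :: ('i, 'k::comm_ring_1) mpoly set)"
  using ideal.span_add[OF assms] by simp

context weighted
begin

lemma homogeneousI:
  assumes "\<And>m. m \<in> keys f \<Longrightarrow> wdeg m = e"
  shows "homogeneous f"
proof -
  have "component d f = (if d = e then f else 0)" for d
  proof (rule poly_mapping_eqI)
    fix m
    show "lookup (component d f) m = lookup (if d = e then f else 0) m"
      using assms[of m] by (cases "m \<in> keys f") (auto simp: lookup_component in_keys_iff)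
  qed
  then show ?thesis by (simp add: homogeneous_def)
qed

end

text \<open>The degree of the image of the variable \<open>C\<close> under the toric map. The value
  1 on the empty set and on infinite sets keeps the weight positive.\<close>

definition card_weight :: "'b set \<Rightarrow> nat" where
  "card_weight C = (if finite C \<and> C \<noteq> {} then card C else 1)"

interpretation card_weight: weighted card_weight
  by standard (auto simp: card_weight_def card_gt_0_iff)

text \<open>On such families the weighted degree is the flow along the constant function 1, which
  both monomials share.\<close>

lemma homogeneous_binomial:
  assumes "\<And>C. C \<in> \<C> \<Longrightarrow> finite C \<and> C \<noteq> {}" "b \<in> binomials \<C>"
  shows "card_weight.homogeneous (b :: ('b set, 'k::comm_ring_1) mpoly)"
proof -
  obtain u v where b: "b = monomial u - monomial v" "keys u \<subseteq> \<C>" "keys v \<subseteq> \<C>" "cover u = cover v"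
    using assms(2) by (rule binomialsE)
  have wdeg: "int (card_weight.wdeg m) = flow (\<lambda>_. 1) m" if "keys m \<subseteq> \<C>" for m
    unfolding card_weight.wdeg_def flow_def using assms(1) that
    by (auto simp: card_weight_def intro!: sum.cong)
  have "finite C" if "C \<in> keys u \<union> keys v" for C
    using that b(2,3) assms(1) by blast
  then have "flow (\<lambda>_. 1) u = flow (\<lambda>_. 1) v"
    using flow_cong_cover[OF b(4)] by blast
  then have "card_weight.wdeg u = card_weight.wdeg v" using wdeg b(2,3) by (metis of_nat_eq_iff)
  moreover have "m = u \<or> m = v" if "m \<in> keys b" for m
    using that by (auto simp: b(1) in_keys_iff lookup_minus lookup_single when_def split: if_splits)
  ultimately show ?thesis by (intro card_weight.homogeneousI[where e = "card_weight.wdeg u"]) auto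
qed

text \<open>The proper divisors of \<open>x\<^sub>A x\<^sub>B\<close> are 1,
  \<open>x\<^sub>A\<close> and \<open>x\<^sub>B\<close>, and none of them is congruent to another
  monomial. So if this monomial occurs in either term of a binomial multiplied by a nontrivial
  monomial, the binomial is 0.\<close>

lemma lookup_shifts_toric_ideal:
  fixes f :: "('b set, 'k::field) mpoly"
  assumes ne: "\<And>C. C \<in> \<C> \<Longrightarrow> C \<noteq> {}" and "A \<noteq> B"
    and A: "\<And>v. keys v \<subseteq> \<C> \<Longrightarrow> cover v = cover (single A 1) \<Longrightarrow> v = single A 1"
    and B: "\<And>v. keys v \<subseteq> \<C> \<Longrightarrow> cover v = cover (single B 1) \<Longrightarrow> v = single B 1"
    and f: "f \<in> linear_span (shifts (toric_ideal \<C>))"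
  shows "lookup f (single A 1 + single B 1) = 0"
proof -
  define s where "s = (single A 1 + single B 1 :: 'b set \<Rightarrow>\<^sub>0 nat)"
  have ls: "lookup s C = (if C = A \<or> C = B then 1 else 0)" for C
    using \<open>A \<noteq> B\<close> by (auto simp: s_def lookup_add lookup_single when_def)
  have alone: "v = u" if "n + u = s" "n \<noteq> 0" "keys v \<subseteq> \<C>" "cover v = cover u" for n u v
  proof -
    have sum: "lookup n C + lookup u C = (if C = A \<or> C = B then 1 else 0)" for C
      using that(1) ls[of C] by (simp flip: that(1) add: lookup_add)
    have le: "lookup u C = 0" if "C \<noteq> A" "C \<noteq> B" for C using sum[of C] that by simp
    have "lookup u A \<noteq> 1 \<or> lookup u B \<noteq> 1"
    proof (rule ccontr)
      assume "\<not> ?thesis"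
      then have "lookup n C = 0" for C using sum[of C] le[of C] by (auto split: if_splits)
      then show False using that(2) by (auto intro: poly_mapping_eqI)
    qed
    then consider "lookup u A = 0" "lookup u B = 0" | "lookup u A = 1" "lookup u B = 0"
      | "lookup u A = 0" "lookup u B = 1"
    proof -
      have "lookup n A + lookup u A = 1" "lookup n B + lookup u B = 1"
        using sum[of A] sum[of B] by simp_all
      then have "lookup u A = 0 \<or> lookup u A = 1" "lookup u B = 0 \<or> lookup u B = 1" by arith+
      then show thesis using \<open>lookup u A \<noteq> 1 \<or> lookup u B \<noteq> 1\<close> that by blast
    qed
    then show ?thesis
    proof cases
      case 1
      then have u: "u = 0" using le by (intro poly_mapping_eqI) (metis lookup_zero)
      have "v = 0" using that(3,4) ne by (intro cover_eq_0) (auto simp: u)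
      then show ?thesis using u by simp
    next
      case 2
      have "u = single A 1"
      proof (rule poly_mapping_eqI)
        show "lookup u C = lookup (single A 1) C" for C
          using le[of C] 2 \<open>A \<noteq> B\<close>
          by (cases "C = A"; cases "C = B") (simp_all add: lookup_single when_def)
      qed
      then show ?thesis using A that(3,4) by simp
    next
      case 3
      have "u = single B 1"
      proof (rule poly_mapping_eqI)
        show "lookup u C = lookup (single B 1) C" for C
          using le[of C] 3 \<open>A \<noteq> B\<close>
          by (cases "C = A"; cases "C = B") (simp_all add: lookup_single when_def)
      qed
      then show ?thesis using B that(3,4) by simp
    qed
  qed
  have binom: "lookup (monomial n * b) s = 0" if n: "n \<noteq> 0" and bin: "b \<in> binomials \<C>"
    for n and b :: "('b set, 'k) mpoly"
  proof -
    obtain u v where b: "b = monomial u - monomial v" "keys u \<subseteq> \<C>" "keys v \<subseteq> \<C>" "cover u = cover v"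
      using bin by (rule binomialsE)
    have "n + u = s \<longleftrightarrow> n + v = s" using alone[of n u v] alone[of n v u] b n by auto
    then show ?thesis
      by (simp add: b(1) right_diff_distrib mult_single lookup_minus lookup_single when_def)
  qed
  have ideal: "lookup (monomial n * h) s = 0"
      if "n \<noteq> 0" "h \<in> toric_ideal \<C>" for n and h :: "('b set, 'k) mpoly"
    using that(2) unfolding toric_ideal_def
  proof (induction h rule: ideal.span_induct_alt)
    case base
    then show ?case by simp
  next
    case (step c x y)
    have "lookup (monomial n * (c * x)) s = 0"
    proof (induction c rule: mpoly_linear_induct)
      case zero
      then show ?case by simp
    next
      case (add m a g)
      have "n + m \<noteq> 0"
        using that(1) by (metis lookup_add add_is_0 lookup_zero poly_mapping_eqI)
      from binom[OF this step(1)] have "lookup (monomial n * (monomial m * x)) s = 0"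
        by (simp add: mult.assoc[symmetric] monom_mult)
      moreover have "monomial n * ((mpoly_const a * monomial m + g) * x) =
          mpoly_const a * (monomial n * (monomial m * x)) + monomial n * (g * x)"
        by (simp add: algebra_simps)
      ultimately show ?case using add by (simp add: lookup_add lookup_mpoly_const_mult)
    qed
    then show ?case using step(2) by (simp add: distrib_left lookup_add)
  qed
  show ?thesis
    using f unfolding s_def[symmetric]
  proof (induction f rule: mpoly_space.span_induct_alt)
    case base
    then show ?case by simp
  next
    case (step c x y)
    then show ?case
      using ideal by (auto simp: shifts_def lookup_add lookup_mpoly_const_mult)
  qed
qed

text \<open>Rewriting \<open>x\<^sub>R x\<^sub>T\<close> to \<open>x\<^sub>F\<^sup>n x\<^sup>t\<close> leaves monomials that do not contain both \<open>x\<^sub>R\<close> and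
  \<open>x\<^sub>T\<close>; their exponents of \<open>x\<^sub>F\<close>, \<open>x\<^sub>R\<close> and \<open>x\<^sub>T\<close> are determined by the multiplicity of \<open>F\<close> and the
  flow along \<open>\<delta>\<close>. So modulo one binomial all relations come from \<open>\<I>\<close>.\<close>

locale toric_step =
  fixes \<I> :: "'b set set" and F :: 'b and R T :: "'b set" and \<delta> :: "'b \<Rightarrow> int"
    and n :: nat and t :: "'b set \<Rightarrow>\<^sub>0 nat"
  assumes fin: "C \<in> insert {F} (insert R (insert T \<I>)) \<Longrightarrow> finite C \<and> C \<noteq> {}"
    and F_\<I>: "C \<in> \<I> \<Longrightarrow> F \<notin> C" and F_R: "F \<notin> R"
    and \<delta>_F: "\<delta> F = 0" and \<delta>_R: "sum \<delta> R = - 1" and \<delta>_T: "sum \<delta> T = 1"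
    and \<delta>_\<I>: "C \<in> \<I> \<Longrightarrow> sum \<delta> C = 0"
    and t: "keys t \<subseteq> \<I>"
    and cover_t: "cover (single R 1 + single T 1) = cover (single {F} n + t)"
begin

definition \<C> where "\<C> = insert {F} (insert R (insert T \<I>))"

definition r :: "('b set, 'k::field) mpoly" where
  "r = monomial (single {F} n + t) - monomial (single R 1 + single T 1)"

definition exponent :: "nat \<Rightarrow> nat \<Rightarrow> nat \<Rightarrow> ('b set \<Rightarrow>\<^sub>0 nat) \<Rightarrow> 'b set \<Rightarrow>\<^sub>0 nat" where
  "exponent i j k w = single {F} i + single R j + single T k + w"

lemma keys_exponent: "keys w \<subseteq> \<I> \<Longrightarrow> keys (exponent i j k w) \<subseteq> \<C>"
  unfolding exponent_def \<C>_def
  using keys_add[of "single {F} i + single R j + single T k" w]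
    keys_add[of "single {F} i + single R j" "single T k"] keys_add[of "single {F} i" "single R j"]
  by (auto split: if_splits)

lemma exponent_cases:
  assumes "keys u \<subseteq> \<C>"
  obtains i j k w where "u = exponent i j k w" "keys w \<subseteq> \<I>"
proof -
  obtain i u1 where 1: "u = single {F} i + u1" "keys u1 \<subseteq> insert R (insert T \<I>)"
    using assms exponent_split unfolding \<C>_def by metis
  obtain j u2 where 2: "u1 = single R j + u2" "keys u2 \<subseteq> insert T \<I>"
    using 1(2) exponent_split by metis
  obtain k w where 3: "u2 = single T k + w" "keys w \<subseteq> \<I>"
    using 2(2) exponent_split by metis
  show ?thesis using that[of i j k w] 1(1) 2(1) 3 by (simp add: exponent_def add.assoc)
qed

lemma cover_F_zero: "keys w \<subseteq> \<I> \<Longrightarrow> cover w F = 0"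
  using F_\<I> by (auto simp: cover_def)

text \<open>Both sides of \<open>cover_t\<close> are compared at \<open>F\<close>. Hence
  \<open>n\<close> is 1 for the family of the uncontracted quiver and 0 for the contracted
  one.\<close>

lemma F_T: "(if F \<in> T then 1 else 0) = n"
  using fun_cong[OF cover_t, of F] F_R cover_F_zero[OF t] by (simp split: if_splits)

lemma cover_exponent_F: "keys w \<subseteq> \<I> \<Longrightarrow> cover (exponent i j k w) F = i + n * k"
  using F_T F_R by (auto simp: exponent_def cover_F_zero split: if_splits)

lemma flow_exponent: "keys w \<subseteq> \<I> \<Longrightarrow> flow \<delta> (exponent i j k w) = int k - int j"
  using flow_eq_0[of w \<delta>] \<delta>_\<I> by (auto simp: exponent_def \<delta>_F \<delta>_R \<delta>_T)

lemma cover_exponent_eqD: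
  assumes "cover (exponent i j k w) = cover (exponent i' j' k' w')" "keys w \<subseteq> \<I>" "keys w' \<subseteq> \<I>"
  shows "i + n * k = i' + n * k'" "int k - int j = int k' - int j'"
proof -
  show "i + n * k = i' + n * k'"
    using fun_cong[OF assms(1), of F] by (simp add: cover_exponent_F assms(2,3))
  have "finite C" if "C \<in> keys (exponent i j k w) \<union> keys (exponent i' j' k' w')" for C
    using that keys_exponent[OF assms(2)] keys_exponent[OF assms(3)] fin unfolding \<C>_def by blast
  then show "int k - int j = int k' - int j'"
    using flow_cong_cover[OF assms(1), of \<delta>] by (simp add: flow_exponent assms(2,3))
qed

lemma r_in_ideal: "monomial (single R 1 + single T 1) - monomial (single {F} n + t)
    \<in> (ideal_span (insert r B) :: ('b set, 'k::field) mpoly set)"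
  using ideal.span_neg[OF ideal.span_base[of r "insert r B"]] by (simp add: r_def)

text \<open>Each rewriting step lowers the exponent \<open>k\<close> of \<open>x\<^sub>T\<close>;
  since \<open>t\<close> involves variables from \<I> only, no new \<open>x\<^sub>R\<close> or
  \<open>x\<^sub>T\<close> appears.\<close>

lemma exponent_reduce:
  assumes "keys w \<subseteq> \<I>"
  shows "\<exists>i' j' k' w'. keys w' \<subseteq> \<I> \<and> (j' = 0 \<or> k' = 0) \<and>
    cover (exponent i' j' k' w') = cover (exponent i j k w) \<and>
    monomial (exponent i j k w) - monomial (exponent i' j' k' w')
      \<in> (ideal_span (insert r B) :: ('b set, 'k::field) mpoly set)"
  using assms
proof (induction k arbitrary: i j w)
  case 0
  then show ?case by (intro exI[of _ i] exI[of _ j] exI[of _ 0] exI[of _ w]) (simp add: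
      ideal.span_zero)
next
  case (Suc k)
  show ?case
  proof (cases j)
    case 0
    then show ?thesis using Suc.prems
      by (intro exI[of _ i] exI[of _ j] exI[of _ "Suc k"] exI[of _ w]) (simp add: ideal.span_zero)
  next
    case (Suc j1)
    define a where "a = exponent i j1 k w"
    have split: "exponent i j (Suc k) w = a + (single R 1 + single T 1)"
      unfolding Suc a_def exponent_def
      by (rule poly_mapping_eqI) (auto simp: lookup_add lookup_single when_def)
    have split': "exponent (i + n) j1 k (w + t) = a + (single {F} n + t)"
      unfolding a_def exponent_def
      by (rule poly_mapping_eqI) (auto simp: lookup_add lookup_single when_def)
    have "keys (w + t) \<subseteq> \<I>" using keys_add[of w t] Suc.prems t by blast
    from Suc.IH[OF this, of "i + n" j1] obtain i' j' k' w' where *: "keys w' \<subseteq> \<I>"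
      "j' = 0 \<or> k' = 0" "cover (exponent i' j' k' w') = cover (exponent (i + n) j1 k (w + t))"
      "monomial (exponent (i + n) j1 k (w + t)) - monomial (exponent i' j' k' w')
        \<in> (ideal_span (insert r B) :: ('b set, 'k) mpoly set)" by blast
    have "monomial (exponent i j (Suc k) w) - monomial (exponent (i + n) j1 k (w + t))
        \<in> (ideal_span (insert r B) :: ('b set, 'k) mpoly set)"
      unfolding split split' monom_diff_shift by (intro ideal.span_scale r_in_ideal)
    note ideal_span_monom_trans[OF this *(4)]
    moreover have "cover (exponent (i + n) j1 k (w + t)) = cover (exponent i j (Suc k) w)"
      unfolding split split' using cover_t by (auto simp: fun_eq_iff)
    ultimately show ?thesis using * by metis
  qed
qed

lemma toric_ideal_eq:
  "toric_ideal \<C> = (ideal_span (insert r (binomials \<I>)) :: ('b set, 'k::field) mpoly set)"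
proof
  let ?L = "ideal_span (insert r (binomials \<I>)) :: ('b set, 'k) mpoly set"
  have "b \<in> ?L" if bin: "b \<in> binomials \<C>" for b
  proof -
    obtain u v where b: "b = monomial u - monomial v" "keys u \<subseteq> \<C>" "keys v \<subseteq> \<C>" "cover u = cover v"
      using bin by (rule binomialsE)
    obtain i j k w where w: "u = exponent i j k w" "keys w \<subseteq> \<I>" using exponent_cases[OF b(2)] .
    from exponent_reduce[where 'k = 'k, OF w(2), of i j k "binomials \<I>", folded w(1)]
    obtain i1 j1 k1 w1 where u: "keys w1 \<subseteq> \<I>" "j1 = 0 \<or> k1 = 0"
      "cover (exponent i1 j1 k1 w1) = cover u"
          "monomial u - monomial (exponent i1 j1 k1 w1) \<in> ?L" by blast
    obtain i j k w where w: "v = exponent i j k w" "keys w \<subseteq> \<I>" using exponent_cases[OF b(3)] .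
    from exponent_reduce[where 'k = 'k, OF w(2), of i j k "binomials \<I>", folded w(1)]
    obtain i2 j2 k2 w2 where v: "keys w2 \<subseteq> \<I>" "j2 = 0 \<or> k2 = 0"
      "cover (exponent i2 j2 k2 w2) = cover v"
          "monomial v - monomial (exponent i2 j2 k2 w2) \<in> ?L" by blast
    have cov: "cover (exponent i1 j1 k1 w1) = cover (exponent i2 j2 k2 w2)" using u v b by simp
    \<comment> \<open>The flow yields the difference of the exponents of \<open>x\<^sub>T\<close>
      and \<open>x\<^sub>R\<close>; one of the two being 0, it determines both. The multiplicity of
      \<open>F\<close> then determines the exponent of \<open>x\<^sub>F\<close>.\<close>
    have "k1 = k2" "j1 = j2" using cover_exponent_eqD(2)[OF cov u(1) v(1)] u(2) v(2) by auto
    moreover from this have "i1 = i2" using cover_exponent_eqD(1)[OF cov u(1) v(1)] by simp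
    ultimately have eq: "exponent i1 j1 k1 w1 = (single {F} i1 + single R j1 + single T k1) + w1"
      "exponent i2 j2 k2 w2 = (single {F} i1 + single R j1 + single T k1) + w2"
      by (simp_all add: exponent_def)
    have "cover w1 = cover w2" using cov unfolding eq by (auto simp: fun_eq_iff)
    then have "monomial w1 - monomial w2 \<in> binomials \<I>" using u(1) v(1) by (intro binomialsI)
    then have "monomial (exponent i1 j1 k1 w1) - monomial (exponent i2 j2 k2 w2) \<in> ?L"
      unfolding eq monom_diff_shift by (intro ideal.span_scale ideal.span_base) auto
    from ideal_span_monom_trans[OF u(4) this]
    have "monomial u - monomial (exponent i2 j2 k2 w2) \<in> ?L" .
    moreover have "monomial (exponent i2 j2 k2 w2) - monomial v \<in> ?L"
      using ideal.span_neg[OF v(4)] by simp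
    ultimately show "b \<in> ?L" unfolding b(1) by (rule ideal_span_monom_trans)
  qed
  then show "toric_ideal \<C> \<subseteq> ?L" unfolding toric_ideal_def by (intro ideal.span_minimal) auto
  have "keys (single {F} n + t) \<subseteq> \<C>" "keys (single R 1 + single T (1::nat)) \<subseteq> \<C>"
    using keys_exponent[OF t, of n 0 0] keys_exponent[of 0 0 1 1] by (simp_all add: exponent_def)
  then have "r \<in> (binomials \<C> :: ('b set, 'k) mpoly set)"
    unfolding r_def using cover_t by (intro binomialsI) auto
  moreover have "binomials \<I> \<subseteq> (binomials \<C> :: ('b set, 'k) mpoly set)"
    unfolding binomials_def \<C>_def by blast
  ultimately show "?L \<subseteq> toric_ideal \<C>" unfolding toric_ideal_def by (intro ideal.span_mono) auto
qed

lemma R_neq_T: "R \<noteq> T"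
  using \<delta>_R \<delta>_T by auto

text \<open>A monomial with the cover of \<open>x\<^sub>R\<close> has flow -1, so it is
  \<open>x\<^sub>R\<close> times a monomial of empty cover, that is \<open>x\<^sub>R\<close> itself;
  likewise for \<open>x\<^sub>T\<close>. Thus \<open>lookup_shifts_toric_ideal\<close> applies to
  the coefficient -1 of \<open>x\<^sub>R x\<^sub>T\<close> in \<open>r\<close>.\<close>

lemma r_notin_shifts: "r \<notin> (linear_span (shifts (toric_ideal \<C>)) :: ('b set, 'k::field) mpoly set)"
proof
  assume *: "r \<in> (linear_span (shifts (toric_ideal \<C>)) :: ('b set, 'k) mpoly set)"
  have ne: "C \<noteq> {}" if "C \<in> \<C>" for C using fin that by (auto simp: \<C>_def)
  have rest: "w = 0" if "cover (a + w) = cover a" "keys w \<subseteq> \<C>" for a w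
  proof (rule cover_eq_0)
    show "cover w e = 0" for e using fun_cong[OF that(1), of e] by simp
  qed (use ne that in auto)
  have R: "v = single R 1" if v: "keys v \<subseteq> \<C>" "cover v = cover (single R 1)" for v
  proof -
    obtain i j k w where w: "v = exponent i j k w" "keys w \<subseteq> \<I>" using exponent_cases[OF v(1)] .
    have "single R 1 = exponent 0 1 0 0" by (simp add: exponent_def)
    then have "j = Suc k" using cover_exponent_eqD(2)[of i j k w 0 1 0 0] v w by simp
    then have "v = single R 1 + exponent i k k w"
      unfolding w exponent_def
      by (intro poly_mapping_eqI) (auto simp: lookup_add lookup_single when_def)
    with rest[of "single R 1" "exponent i k k w"] keys_exponent[OF w(2)] v(2) show ?thesis by simp
  qed
  have T: "v = single T 1" if v: "keys v \<subseteq> \<C>" "cover v = cover (single T 1)" for v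
  proof -
    obtain i j k w where w: "v = exponent i j k w" "keys w \<subseteq> \<I>" using exponent_cases[OF v(1)] .
    have "single T 1 = exponent 0 0 1 0" by (simp add: exponent_def)
    then have "k = Suc j" using cover_exponent_eqD(2)[of i j k w 0 0 1 0] v w by simp
    then have "v = single T 1 + exponent i j j w"
      unfolding w exponent_def
      by (intro poly_mapping_eqI) (auto simp: lookup_add lookup_single when_def)
    with rest[of "single T 1" "exponent i j j w"] keys_exponent[OF w(2)] v(2) show ?thesis by simp
  qed
  have "R \<noteq> {F}" "R \<notin> \<I>" using \<delta>_R \<delta>_F \<delta>_\<I> by auto
  moreover from this have "lookup t R = 0" using t by (meson in_keys_iff subsetD)
  ultimately have "lookup (single {F} n + t) R = 0"
    by (simp add: lookup_add lookup_single_not_eq)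
  moreover have "lookup (single R 1 + single T (1::nat)) R \<noteq> 0" by (simp add: lookup_add)
  ultimately have "single {F} n + t \<noteq> single R 1 + single T 1" by metis
  then have "lookup (r :: ('b set, 'k) mpoly) (single R 1 + single T 1) = - 1"
    by (simp add: r_def lookup_minus lookup_single when_def)
  moreover have "lookup (r :: ('b set, 'k) mpoly) (single R 1 + single T 1) = 0"
    using lookup_shifts_toric_ideal[OF ne R_neq_T R T *] by blast
  ultimately show False by simp
qed

text \<open>The substitution \<open>y\<close> is the projection to the smaller ideal demanded by
  \<open>gen_by_remove_generator\<close>; how it can kill \<open>r\<close> differs from case to
  case, so it remains a parameter.\<close>

lemma gen_by_toric_ideal_step:
  fixes y :: "'b set \<Rightarrow> ('b set, 'k::field) mpoly"
  assumes "\<And>C. lookup (y C) 0 = 0" "\<And>C. C \<in> \<I> \<Longrightarrow> y C = mpoly_var C"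
    and "mpoly_subst mpoly_const y r = 0"
  shows "gen_by N (toric_ideal \<C> :: ('b set, 'k) mpoly set) \<longleftrightarrow>
    N \<ge> 1 \<and> gen_by (N - 1) (toric_ideal \<I> :: ('b set, 'k) mpoly set)"
proof
  assume "gen_by N (toric_ideal \<C> :: ('b set, 'k) mpoly set)"
  then show "N \<ge> 1 \<and> gen_by (N - 1) (toric_ideal \<I> :: ('b set, 'k) mpoly set)"
    unfolding toric_ideal_eq toric_ideal_def[of \<I>]
  proof (rule card_weight.gen_by_remove_generator[rotated -1])
    show "r \<notin> linear_span (shifts (ideal_span (insert r (binomials \<I> :: ('b set, 'k) mpoly set))))"
      using r_notin_shifts unfolding toric_ideal_eq .
    show "card_weight.homogeneous b" if "b \<in> binomials \<I>" for b :: "('b set, 'k) mpoly"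
      using homogeneous_binomial[OF _ that] fin by blast
    show "mpoly_subst mpoly_const y b = b" if "b \<in> binomials \<I>" for b
      using subst_binomial_id[OF that] assms(2) by blast
  qed (use assms in auto)
next
  assume "N \<ge> 1 \<and> gen_by (N - 1) (toric_ideal \<I> :: ('b set, 'k) mpoly set)"
  then show "gen_by N (toric_ideal \<C> :: ('b set, 'k) mpoly set)"
    using gen_by_insert[of "N - 1" "binomials \<I>" r]
    unfolding toric_ideal_eq toric_ideal_def[of \<I>] by (cases N) auto
qed

end

section \<open>Images of toric ideals under substitutions\<close>

lemma ideal_span_subst:
  "ideal_span (mpoly_subst mpoly_const y ` ideal_span S) =
     ideal_span (mpoly_subst mpoly_const y ` (S :: ('i, 'k::comm_ring_1) mpoly set)
       :: ('j, 'k) mpoly set)"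
  by (rule ideal_span_image_span) (simp_all add: const_hom.subst_add const_hom.subst_mult)

lemma gen_by_subst:
  "gen_by N J \<Longrightarrow> gen_by N (ideal_span (mpoly_subst mpoly_const y ` J))"
  for J :: "('i, 'k::comm_ring_1) mpoly set" and y :: "'i \<Rightarrow> ('j, 'k) mpoly"
  by (rule gen_by_image) (simp_all add: const_hom.subst_add const_hom.subst_mult)

lemma subst_power_prod:
  "mpoly_subst mpoly_const x (power_prod y u) =
     power_prod (\<lambda>i. mpoly_subst mpoly_const x (y i) :: ('j, 'k::comm_ring_1) mpoly) u"
  by (induction u rule: exponent_induct)
    (simp_all add: power_prod_add power_prod_single const_hom.subst_mult)

lemma power_prod_eq_monom:
  assumes "\<And>C. C \<in> keys u \<Longrightarrow> y C = mpoly_var C"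
  shows "power_prod y u = (monomial u :: ('i, 'k::comm_semiring_1) mpoly)"
  using power_prod_cong[of u y mpoly_var] assms by (simp add: power_prod_var)

lemma binomials_mono: "\<A> \<subseteq> \<B> \<Longrightarrow> binomials \<A> \<subseteq> binomials \<B>"
  by (intro subsetI, elim binomialsE) (blast intro: binomialsI)

lemma lookup_var_0: "lookup (mpoly_var C :: ('i, 'k::zero_neq_one) mpoly) 0 = 0"
proof -
  have "single C (1::nat) \<noteq> 0" by (metis lookup_single_eq lookup_zero zero_neq_one)
  then show ?thesis by (simp add: mpoly_var_def lookup_single_not_eq)
qed

lemma const_subst_var:
  "mpoly_subst mpoly_const x (mpoly_var i) = (x i :: ('j, 'k::comm_ring_1) mpoly)"
  using const_hom.subst_monom[of x "single i 1"] by (simp add: mpoly_var_def power_prod_single)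

text \<open>In the application \<open>E\<close> is contracted, \<open>F\<close> and \<open>R\<close> are the two paths from \<open>v\<^sub>2\<close> to \<open>v\<^sub>1\<close>, and
  \<open>P\<close> is the other path from \<open>v\<^sub>1\<close> to \<open>v\<^sub>2\<close>; \<open>\<O>\<close> consists of the cycles not running through both vertices.\<close>

locale contracted_paths =
  fixes \<O> :: "'b set set" and F :: 'b and R P :: "'b set" and \<delta> :: "'b \<Rightarrow> int"
  assumes fin: "C \<in> insert {F} (insert R (insert P \<O>)) \<Longrightarrow> finite C \<and> C \<noteq> {}"
    and F_\<O>: "C \<in> \<O> \<Longrightarrow> F \<notin> C" and F_R: "F \<notin> R" and F_P: "F \<notin> P"
    and \<delta>_F: "\<delta> F = 0" and \<delta>_R: "sum \<delta> R = - 1" and \<delta>_P: "sum \<delta> P = 1"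
    and \<delta>_\<O>: "C \<in> \<O> \<Longrightarrow> sum \<delta> C = 0"
begin

lemma finite_R: "finite R" and finite_P: "finite P" and R_ne: "R \<noteq> {}" and P_ne: "P \<noteq> {}"
  using fin by auto

text \<open>Both monomials of \<open>r\<close> contain a variable outside \<I>, namely
  \<open>x\<^sub>F\<close> and \<open>x\<^sub>R\<close>, so it suffices to set such variables to
  0.\<close>

lemma gen_by_uncontracted:
  assumes \<I>: "\<I> = \<O> \<or> \<I> = insert (P \<union> R) \<O>" and disj: "\<I> = \<O> \<or> P \<inter> R = {}"
    and t: "keys t \<subseteq> \<I>" "cover (single P 1 + single R 1) = cover t"
  shows "gen_by N (toric_ideal (insert {F} (insert R (insert (insert F P) \<I>))) :: ('b set,
      'k::field) mpoly set)
    \<longleftrightarrow> N \<ge> 1 \<and> gen_by (N - 1) (toric_ideal \<I> :: ('b set, 'k) mpoly set)"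
proof -
  have PR: "sum \<delta> (P \<union> R) = 0" if "P \<inter> R = {}"
    using sum.union_disjoint[OF finite_P finite_R that, of \<delta>] by (simp add: \<delta>_R \<delta>_P)
  have F_\<I>: "F \<notin> C" and \<delta>_\<I>: "sum \<delta> C = 0" if "C \<in> \<I>" for C
    using \<I> disj that F_\<O> F_R F_P \<delta>_\<O> PR by auto
  have fin\<I>: "finite C \<and> C \<noteq> {}" if "C \<in> \<I>" for C
    using \<I> that fin finite_R finite_P R_ne by auto
  interpret toric_step \<I> F R "insert F P" \<delta> 1 t
  proof
    show "sum \<delta> (insert F P) = 1" using F_P finite_P by (simp add: \<delta>_F \<delta>_P)
    show "cover (single R 1 + single (insert F P) 1) = cover (single {F} 1 + t)"
    proof
      fix e
      show "cover (single R 1 + single (insert F P) 1) e = cover (single {F} 1 + t) e"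
        using fun_cong[OF t(2), of e] F_P by (cases "e = F") auto
    qed
    show "finite C \<and> C \<noteq> {}" if "C \<in> insert {F} (insert R (insert (insert F P) \<I>))" for C
      using that fin\<I>[of C] finite_R R_ne finite_P by blast
  qed (fact F_\<I> \<delta>_\<I> F_R \<delta>_F \<delta>_R t)+
  define y :: "'b set \<Rightarrow> ('b set, 'k) mpoly" where
    "y C = (if C \<in> {{F}, R, insert F P} then 0 else mpoly_var C)" for C
  have "R \<notin> \<I>" "{F} \<notin> \<I>" "insert F P \<notin> \<I>" using F_\<I> \<delta>_\<I> \<delta>_R by auto
  then have y\<I>: "y C = mpoly_var C" if "C \<in> \<I>" for C using that by (auto simp: y_def)
  show ?thesis
    unfolding \<C>_def[symmetric]
  proof (rule gen_by_toric_ideal_step)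
    show "lookup (y C) 0 = (0 :: 'k)" for C
      by (simp add: y_def lookup_var_0)
    show "mpoly_subst mpoly_const y r = (0 :: ('b set, 'k) mpoly)"
      unfolding r_def by (simp add: const_subst_minus power_prod_add power_prod_single)
        (simp add: y_def)
  qed (rule y\<I>)
qed

text \<open>One monomial of \<open>r\<close> now involves variables of \<O> only, which must stay
  fixed, so \<open>r\<close> cannot be killed by zeros. Instead \<open>x\<^sub>R\<close> and
  \<open>x\<^sub>P\<close> receive two factors of this monomial; as \<open>t1\<close> and
  \<open>t2\<close> are nonzero, these have no constant term.\<close>

lemma gen_by_contracted_composite:
  assumes cov: "keys t1 \<subseteq> \<O>" "keys t2 \<subseteq> \<O>" "t1 \<noteq> 0" "t2 \<noteq> 0"
    "cover (single P 1 + single R 1) = cover (t1 + t2)"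
  shows "gen_by N (toric_ideal (insert {F} (insert R (insert P \<O>))) :: ('b set, 'k::field) mpoly set)
    \<longleftrightarrow> N \<ge> 1 \<and> gen_by (N - 1) (toric_ideal \<O> :: ('b set, 'k) mpoly set)"
proof -
  have t12: "keys (t1 + t2) \<subseteq> \<O>" using keys_add[of t1 t2] cov by blast
  interpret toric_step \<O> F R P \<delta> 0 "t1 + t2"
  proof
    show "cover (single R 1 + single P 1) = cover (single {F} 0 + (t1 + t2))"
      using cov(5) by (simp add: add.commute)
  qed (fact fin F_\<O> \<delta>_\<O> F_R \<delta>_F \<delta>_R \<delta>_P t12)+
  define y :: "'b set \<Rightarrow> ('b set, 'k) mpoly" where
    "y C = (if C = R then monomial t1 else if C = P then monomial t2 else mpoly_var C)" for C
  have "R \<noteq> P" "R \<notin> \<O>" "P \<notin> \<O>" using \<delta>_\<O> \<delta>_R \<delta>_P by auto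
  then have y: "y C = mpoly_var C" if "C \<in> \<O>" for C using that by (auto simp: y_def)
  show ?thesis
    unfolding \<C>_def[symmetric]
  proof (rule gen_by_toric_ideal_step)
    show "lookup (y C) 0 = (0 :: 'k)" for C
      using cov(3,4) by (simp add: y_def lookup_var_0 lookup_single_not_eq)
    have "power_prod y (t1 + t2) = (monomial (t1 + t2) :: ('b set, 'k) mpoly)"
      using t12 y by (intro power_prod_eq_monom) auto
    moreover have "power_prod y (single R 1 + single P 1) = monomial t1 * monomial t2"
      using \<open>R \<noteq> P\<close> by (simp add: power_prod_add power_prod_single) (simp add: y_def)
    ultimately show "mpoly_subst mpoly_const y r = (0 :: ('b set, 'k) mpoly)"
      unfolding r_def by (simp add: const_subst_minus mult_single)
  qed (rule y)
qed

text \<open>Generators are carried over by ring homomorphisms in both directions: \<open>h\<close>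
  eliminates the variable of \<open>P \<union> R\<close>, and \<open>z\<close>, which sets
  \<open>x\<^sub>R\<close> to 1 and renames \<open>x\<^sub>P\<close>, undoes \<open>h\<close> on the
  binomials of \<open>?I\<close>.\<close>

lemma gen_by_contracted_primitive:
  assumes disj: "P \<inter> R = {}" and PR_\<O>: "P \<union> R \<notin> \<O>"
  shows "gen_by N (toric_ideal (insert {F} (insert R (insert P \<O>))) :: ('b set, 'k::field) mpoly set)
    \<longleftrightarrow> gen_by N (toric_ideal (insert (P \<union> R) \<O>) :: ('b set, 'k) mpoly set)"
    (is "gen_by N (toric_ideal ?C) \<longleftrightarrow> gen_by N (toric_ideal ?I)")
proof -
  have PR: "sum \<delta> (P \<union> R) = 0"
    using sum.union_disjoint[OF finite_P finite_R disj, of \<delta>] by (simp add: \<delta>_R \<delta>_P)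
  have PR_ne: "P \<union> R \<noteq> P" "P \<union> R \<noteq> R" "P \<union> R \<noteq> {F}" "R \<noteq> P" "{F} \<noteq> P" "{F} \<noteq> R"
    using disj R_ne P_ne F_P F_R by auto
  have O_ne: "P \<notin> \<O>" "R \<notin> \<O>" using \<delta>_\<O> \<delta>_R \<delta>_P by auto
  have cover_PR: "cover (single R 1 + single P 1) = cover (single (P \<union> R) (1::nat))"
    using disj by (auto simp: fun_eq_iff)
  interpret toric_step ?I F R P \<delta> 0 "single (P \<union> R) 1"
  proof
    show "cover (single R 1 + single P 1) = cover (single {F} 0 + single (P \<union> R) 1)"
      using cover_PR by simp
    show "finite C \<and> C \<noteq> {}" if "C \<in> insert {F} (insert R (insert P ?I))" for C
      using that fin[of C] finite_R finite_P P_ne by blast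
    show "F \<notin> C" if "C \<in> ?I" for C using that F_\<O>[of C] F_R F_P by blast
    show "sum \<delta> C = 0" if "C \<in> ?I" for C using that \<delta>_\<O>[of C] PR by blast
    show "keys (single (P \<union> R) 1) \<subseteq> ?I" by simp
  qed (fact F_R \<delta>_F \<delta>_R \<delta>_P)+
  define y :: "'b set \<Rightarrow> ('b set, 'k) mpoly" where
    "y C = (if C = P \<union> R then monomial (single R 1 + single P 1) else mpoly_var C)" for C
  define z :: "'b set \<Rightarrow> ('b set, 'k) mpoly" where
    "z C = (if C = P then mpoly_var (P \<union> R) else if C = R then 1 else mpoly_var C)" for C
  define h where "h = mpoly_subst mpoly_const y"
  \<comment> \<open>\<open>toric_step\<close> describes the ideal of the larger family that also
    contains \<open>P \<union> R\<close>; \<open>h\<close> retracts this ideal to the one of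
    \<open>?C\<close>.\<close>
  have C: "\<C> = insert (P \<union> R) ?C" by (auto simp: \<C>_def)
  have h_binom: "h b = b" if "b \<in> binomials ?C" for b
    unfolding h_def using PR_ne PR_\<O> by (intro subst_binomial_id[OF that]) (auto simp: y_def)
  have h_C: "h ` binomials \<C> \<subseteq> binomials ?C"
  proof (intro image_subsetI, unfold h_def, rule subst_binomials)
    fix C assume "C \<in> \<C>"
    show "\<exists>g. y C = monomial g \<and> keys g \<subseteq> ?C \<and> cover g = cover (single C 1)"
    proof (cases "C = P \<union> R")
      case True
      have "keys (single R 1 + single P (1::nat)) \<subseteq> ?C"
        using keys_add[of "single R 1" "single P (1::nat)"] by auto
      then show ?thesis using True cover_PR by (auto simp: y_def)
    next
      case False
      then show ?thesis using \<open>C \<in> \<C>\<close> unfolding C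
        by (intro exI[of _ "single C 1"]) (auto simp: y_def mpoly_var_def)
    qed
  qed
  have "h r = 0"
    unfolding h_def r_def using PR_ne
    by (simp add: const_subst_minus power_prod_add power_prod_single)
      (simp add: y_def mpoly_var_def mult_single)
  have "toric_ideal ?C = ideal_span (h ` binomials \<C>)"
  proof
    have "b \<in> h ` binomials \<C>" if "b \<in> binomials ?C" for b
    proof (rule image_eqI)
      show "b = h b" using h_binom[OF that] by simp
      show "b \<in> binomials \<C>" using binomials_mono[of ?C \<C>] that unfolding C by blast
    qed
    then have "binomials ?C \<subseteq> h ` binomials \<C>" by blast
    then show "toric_ideal ?C \<subseteq> ideal_span (h ` binomials \<C>)"
      unfolding toric_ideal_def by (rule ideal.span_mono)
    show "ideal_span (h ` binomials \<C>) \<subseteq> toric_ideal ?C"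
      unfolding toric_ideal_def by (rule ideal.span_mono[OF h_C])
  qed
  also have "\<dots> = ideal_span (h ` toric_ideal \<C>)"
    unfolding toric_ideal_def h_def ideal_span_subst ..
  also have "\<dots> = ideal_span (h ` insert r (binomials ?I))"
    unfolding toric_ideal_eq h_def ideal_span_subst ..
  also have "\<dots> = ideal_span (h ` binomials ?I)"
    using \<open>h r = 0\<close> by (simp add: ideal.span_insert[of 0])
  finally have C_eq: "toric_ideal ?C = ideal_span (h ` binomials ?I)" .
  have zy: "mpoly_subst mpoly_const z (y C) = mpoly_var C" if "C \<in> ?I" for C
  proof (cases "C = P \<union> R")
    case True
    have "mpoly_subst mpoly_const z (y C) = z R * z P"
      using True by (simp add: y_def power_prod_add power_prod_single)
    then show ?thesis using True PR_ne(4) by (simp add: z_def)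
  next
    case False
    with that have "C \<in> \<O>" by blast
    with O_ne have "C \<noteq> P" "C \<noteq> R" by metis+
    then show ?thesis using False by (simp add: y_def z_def const_subst_var)
  qed
  have zh: "mpoly_subst mpoly_const z (h b) = b" if bin: "b \<in> binomials ?I" for b
  proof -
    obtain u v where b: "b = monomial u - monomial v" "keys u \<subseteq> ?I" "keys v \<subseteq> ?I"
      using bin by (rule binomialsE)
    have "mpoly_subst mpoly_const z (power_prod y m) = monomial m" if "keys m \<subseteq> ?I" for m
      unfolding subst_power_prod using that zy by (intro power_prod_eq_monom) auto
    then show ?thesis using b by (simp add: h_def const_subst_minus)
  qed
  show ?thesis
  proof
    assume "gen_by N (toric_ideal ?C :: ('b set, 'k) mpoly set)"
    then have "gen_by N (ideal_span (mpoly_subst mpoly_const z ` (toric_ideal ?C :: ('b set, 'k)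
        mpoly set))
        :: ('b set, 'k) mpoly set)"
      by (rule gen_by_subst)
    also have "ideal_span (mpoly_subst mpoly_const z ` (toric_ideal ?C :: ('b set, 'k) mpoly set)) =
        ideal_span (mpoly_subst mpoly_const z ` h ` binomials ?I)"
      unfolding C_eq ideal_span_subst ..
    also have "mpoly_subst mpoly_const z ` h ` binomials ?I = binomials ?I"
      using zh by (force simp: image_image)
    finally show "gen_by N (toric_ideal ?I :: ('b set, 'k) mpoly set)"
      by (simp add: toric_ideal_def)
  next
    assume "gen_by N (toric_ideal ?I :: ('b set, 'k) mpoly set)"
    then have "gen_by N (ideal_span (h ` toric_ideal ?I))" unfolding h_def by (rule gen_by_subst)
    then show "gen_by N (toric_ideal ?C :: ('b set, 'k) mpoly set)"
      unfolding C_eq toric_ideal_def[of ?I] h_def ideal_span_subst .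
  qed
qed

end

section \<open>Monomial algebras\<close>

lemma finite_obtains_maximum:
  fixes s :: "'a \<Rightarrow> 'b::linorder"
  assumes "finite S" "S \<noteq> {}"
  obtains a where "a \<in> S" "\<And>m. m \<in> S \<Longrightarrow> s m \<le> s a"
proof -
  have "Max (s ` S) \<in> s ` S" using assms by (intro Max_in) auto
  then obtain a where "a \<in> S" "s a = Max (s ` S)" by auto
  with that[of a] show ?thesis using assms(1) by simp
qed

text \<open>Kronecker substitution: the weight \<open>K\<close> of the new variable exceeds all
  former sums, so quotient and remainder modulo \<open>K\<close> recover both parts.\<close>

lemma separating_weights_on:
  fixes U :: "('i \<Rightarrow>\<^sub>0 nat) set"
  assumes "finite V" "finite U"
  shows "\<exists>k :: 'i \<Rightarrow> nat. \<forall>m\<in>U. \<forall>m'\<in>U. (\<Sum>i\<in>V. lookup m i * k i) = (\<Sum>i\<in>V. lookup m' i * k i)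
    \<longrightarrow> (\<forall>i\<in>V. lookup m i = lookup m' i)"
  using assms(1)
proof (induction V rule: finite_induct)
  case empty
  then show ?case by simp
next
  case (insert j V)
  then obtain k where k: "\<And>m m'. m \<in> U \<Longrightarrow> m' \<in> U \<Longrightarrow>
      (\<Sum>i\<in>V. lookup m i * k i) = (\<Sum>i\<in>V. lookup m' i * k i) \<Longrightarrow> \<forall>i\<in>V. lookup m i = lookup m' i"
    by blast
  define s where "s m = (\<Sum>i\<in>V. lookup m i * k i)" for m :: "'i \<Rightarrow>\<^sub>0 nat"
  obtain K where K: "\<And>m. m \<in> U \<Longrightarrow> s m < K"
  proof
    show "s m < Suc (Max (s ` U))" if "m \<in> U" for m
      using Max_ge[of "s ` U" "s m"] that assms(2) by (simp add: le_imp_less_Suc)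
  qed
  have sum: "(\<Sum>i\<in>insert j V. lookup m i * (k(j := K)) i) = lookup m j * K + s m" for m
    using insert.hyps by (simp add: s_def) (intro sum.cong, auto)
  have "\<forall>i\<in>insert j V. lookup m i = lookup m' i"
    if m: "m \<in> U" "m' \<in> U" and eq: "lookup m j * K + s m = lookup m' j * K + s m'" for m m'
  proof -
    have "(lookup m j * K + s m) mod K = s m" "(lookup m' j * K + s m') mod K = s m'"
      using K m by simp_all
    then have "s m = s m'" using eq by metis
    moreover from this have "lookup m j = lookup m' j" using eq K[OF m(1)] by simp
    ultimately show ?thesis using k[OF m] by (simp add: s_def)
  qed
  then show ?case unfolding sum[symmetric] by (intro exI[of _ "k(j := K)"]) blast
qed

text \<open>Serves both to specialise polynomials to one variable and to single out leading terms
  compatibly with products.\<close>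

lemma separating_weights:
  fixes U :: "('i \<Rightarrow>\<^sub>0 nat) set"
  assumes "finite U"
  obtains s :: "('i \<Rightarrow>\<^sub>0 nat) \<Rightarrow> nat" and k :: "'i \<Rightarrow> nat"
  where "inj_on s U" "\<And>m n. s (m + n) = s m + s n"
    "\<And>m. s m = (\<Sum>i\<in>keys m. lookup m i * k i)"
proof -
  have fin: "finite (\<Union>(keys ` U))" using assms by auto
  from separating_weights_on[OF this assms] obtain k where k: "\<And>m m'. m \<in> U \<Longrightarrow> m' \<in> U \<Longrightarrow>
      (\<Sum>i\<in>\<Union>(keys ` U). lookup m i * k i) = (\<Sum>i\<in>\<Union>(keys ` U). lookup m' i * k i) \<Longrightarrow>
      \<forall>i\<in>\<Union>(keys ` U). lookup m i = lookup m' i" by blast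
  define s where "s m = (\<Sum>i\<in>keys m. lookup m i * k i)" for m
  have s: "s m = (\<Sum>i\<in>S. lookup m i * k i)" if "finite S" "keys m \<subseteq> S" for S m
    unfolding s_def using that by (intro sum.mono_neutral_left) (auto simp: in_keys_iff)
  have "inj_on s U"
  proof (rule inj_onI)
    fix m m' assume m: "m \<in> U" "m' \<in> U" "s m = s m'"
    have sub: "keys m \<subseteq> \<Union>(keys ` U)" "keys m' \<subseteq> \<Union>(keys ` U)" using m(1,2) by blast+
    have "(\<Sum>i\<in>\<Union>(keys ` U). lookup m i * k i) = (\<Sum>i\<in>\<Union>(keys ` U). lookup m' i * k i)"
      using m(3) s[OF fin sub(1)] s[OF fin sub(2)] by simp
    from k[OF m(1,2) this] have eq: "\<And>i. i \<in> \<Union>(keys ` U) \<Longrightarrow> lookup m i = lookup m' i"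
      by blast
    show "m = m'"
    proof (rule poly_mapping_eqI)
      show "lookup m i = lookup m' i" for i
        using eq[of i] sub by (metis not_in_keys_iff_lookup_eq_zero subsetD)
    qed
  qed
  moreover have "s (m + n) = s m + s n" for m n
    using s[of "keys m \<union> keys n"] keys_add[of m n]
    by (simp add: lookup_add distrib_right sum.distrib)
  ultimately show ?thesis using that s_def by blast
qed

text \<open>Along the curve with coordinates \<open>z ^ k i\<close> the polynomial becomes one in a
  single variable with the same coefficients.\<close>

lemma mpoly_eq_0_if_eval_eq_0:
  fixes f :: "('i, 'k::field_char_0) mpoly"
  assumes "\<And>x. mpoly_eval x f = 0"
  shows "f = 0"
proof -
  obtain s k where s: "inj_on s (keys f)" "\<And>m. s m = (\<Sum>i\<in>keys m. lookup m i * k i)"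
    using separating_weights[OF finite_keys, of f] by metis
  define p where "p = (\<Sum>m\<in>keys f. Polynomial.monom (lookup f m) (s m))"
  have "poly p z = 0" for z
  proof -
    have "power_prod (\<lambda>i. z ^ k i) m = z ^ s m" for m
      by (simp add: power_prod_def s(2) power_sum mult.commute flip: power_mult)
    then have "poly p z = mpoly_eval (\<lambda>i. z ^ k i) f"
      by (simp add: p_def poly_sum poly_monom id_hom.subst_superset[of "keys f"])
    then show ?thesis using assms by simp
  qed
  then have "p = 0" using poly_all_0_iff_0 by blast
  have "lookup f m = 0" if "m \<in> keys f" for m
  proof -
    have "coeff p (s m) = (\<Sum>m'\<in>keys f. if m' = m then lookup f m' else 0)"
      unfolding p_def coeff_sum coeff_monom using s(1) that
      by (intro sum.cong) (auto dest: inj_onD)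
    then show ?thesis using that \<open>p = 0\<close> by simp
  qed
  then show ?thesis by (intro poly_mapping_eqI) (metis lookup_zero not_in_keys_iff_lookup_eq_zero)
qed

text \<open>Built like \<open>mpoly_ring\<close>, so that the invariant ring and the ring of the
  primitive cycles are equal, not just isomorphic, to such algebras.\<close>

definition monoid_algebra :: "('i \<Rightarrow>\<^sub>0 nat) set \<Rightarrow> ('i, 'k::comm_ring_1) mpoly ring" where
  "monoid_algebra M = ring_of_type_algebra \<lparr>carrier := {f. keys f \<subseteq> M}\<rparr>"

section \<open>Monoid algebras and their prime ideals\<close>

locale exponent_monoid =
  fixes M :: "('i \<Rightarrow>\<^sub>0 nat) set"
  assumes zero_M: "0 \<in> M" and add_M: "m \<in> M \<Longrightarrow> n \<in> M \<Longrightarrow> m + n \<in> M"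
begin

lemma monoid_algebra_simps [simp]:
  "carrier (monoid_algebra M) = {f. keys f \<subseteq> M}"
  "mult (monoid_algebra M) = (*)" "one (monoid_algebra M) = 1"
  "zero (monoid_algebra M) = 0" "add (monoid_algebra M) = (+)"
  by (simp_all add: monoid_algebra_def ring_of_type_algebra_def)

lemma keys_add_M: "keys f \<subseteq> M \<Longrightarrow> keys g \<subseteq> M \<Longrightarrow> keys (f + g) \<subseteq> M"
  using keys_add[of f g] by blast

lemma keys_mult_M:
  fixes f g :: "('i, 'k::comm_ring_1) mpoly"
  shows "keys f \<subseteq> M \<Longrightarrow> keys g \<subseteq> M \<Longrightarrow> keys (f * g) \<subseteq> M"
  using keys_mult[of f g] add_M by blast

lemma keys_sum_M: "(\<And>a. a \<in> A \<Longrightarrow> keys (h a) \<subseteq> M) \<Longrightarrow> keys (sum h A) \<subseteq> M"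
  by (induction A rule: infinite_finite_induct) (simp_all add: keys_add_M)

lemma keys_const_M: "keys (mpoly_const c) \<subseteq> M"
  using zero_M by (simp add: mpoly_const_def)

lemma keys_power_M:
  fixes f :: "('i, 'k::comm_ring_1) mpoly"
  shows "keys f \<subseteq> M \<Longrightarrow> keys (f ^ n) \<subseteq> M"
  by (induction n) (simp_all add: zero_M keys_mult_M)

lemma cring_monoid_algebra: "cring (monoid_algebra M :: ('i, 'k::comm_ring_1) mpoly ring)"
proof (rule cringI)
  show "abelian_group (monoid_algebra M :: ('i, 'k) mpoly ring)"
  proof (rule abelian_groupI)
    show "\<exists>g\<in>carrier (monoid_algebra M). g \<oplus>\<^bsub>monoid_algebra M\<^esub> f = \<zero>\<^bsub>monoid_algebra M\<^esub>"
      if "f \<in> carrier (monoid_algebra M)" for f :: "('i, 'k) mpoly"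
    proof
      show "- f \<in> carrier (monoid_algebra M)" using that by (auto simp: in_keys_iff)
    qed simp
  qed (simp_all add: keys_add_M algebra_simps)
  show "comm_monoid (monoid_algebra M :: ('i, 'k) mpoly ring)"
    by (rule comm_monoidI) (auto simp: keys_mult_M zero_M algebra_simps)
qed (simp add: distrib_right)

definition prime_in :: "('i, 'k::comm_ring_1) mpoly set \<Rightarrow> bool" where
  "prime_in P \<longleftrightarrow> P \<subseteq> {f. keys f \<subseteq> M} \<and> 0 \<in> P \<and> 1 \<notin> P \<and>
     (\<forall>f\<in>P. \<forall>g\<in>P. f + g \<in> P) \<and> (\<forall>f g. keys f \<subseteq> M \<longrightarrow> g \<in> P \<longrightarrow> f * g \<in> P) \<and>
     (\<forall>f g. keys f \<subseteq> M \<longrightarrow> keys g \<subseteq> M \<longrightarrow> f * g \<in> P \<longrightarrow> f \<in> P \<or> g \<in> P)"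

lemma prime_in_add: "prime_in P \<Longrightarrow> f \<in> P \<Longrightarrow> g \<in> P \<Longrightarrow> f + g \<in> P"
  and prime_in_mult: "prime_in P \<Longrightarrow> keys f \<subseteq> M \<Longrightarrow> g \<in> P \<Longrightarrow> f * g \<in> P"
  and prime_in_prime: "prime_in P \<Longrightarrow> keys f \<subseteq> M \<Longrightarrow> keys g \<subseteq> M \<Longrightarrow> f * g \<in> P \<Longrightarrow> f \<in> P \<or> g \<in> P"
  unfolding prime_in_def by simp_all

lemma prime_in_uminus:
  assumes "prime_in P" "f \<in> P"
  shows "- f \<in> P"
proof -
  have "- f = mpoly_const (- 1) * f"
    by (rule poly_mapping_eqI) (simp add: lookup_mpoly_const_mult)
  then show ?thesis using prime_in_mult[OF assms(1) keys_const_M assms(2)] by simp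
qed

lemma ideal_monoid_algebraI:
  fixes P :: "('i, 'k::comm_ring_1) mpoly set"
  assumes sub: "P \<subseteq> {f. keys f \<subseteq> M}" and zero: "0 \<in> P"
    and add: "\<And>f g. f \<in> P \<Longrightarrow> g \<in> P \<Longrightarrow> f + g \<in> P"
    and mult: "\<And>f g. keys f \<subseteq> M \<Longrightarrow> g \<in> P \<Longrightarrow> f * g \<in> P"
  shows "ideal P (monoid_algebra M :: ('i, 'k) mpoly ring)"
proof -
  interpret R: cring "monoid_algebra M :: ('i, 'k) mpoly ring" by (rule cring_monoid_algebra)
  show ?thesis
  proof (rule idealI)
    show "subgroup P (add_monoid (monoid_algebra M :: ('i, 'k) mpoly ring))"
    proof (rule R.add.subgroupI)
      show "\<ominus>\<^bsub>monoid_algebra M\<^esub> f \<in> P" if "f \<in> P" for f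
      proof -
        have "keys f \<subseteq> M" using sub that by blast
        then have "\<ominus>\<^bsub>monoid_algebra M\<^esub> f = - f"
          by (intro R.minus_equality) simp_all
        also have "- f = mpoly_const (- 1) * f"
          by (rule poly_mapping_eqI) (simp add: lookup_mpoly_const_mult)
        finally show ?thesis using mult[OF keys_const_M that] by simp
      qed
    qed (use sub zero add in auto)
    fix f g :: "('i, 'k) mpoly"
    assume "f \<in> P" "g \<in> carrier (monoid_algebra M)"
    then have "g * f \<in> P" using mult by simp
    then show "g \<otimes>\<^bsub>monoid_algebra M\<^esub> f \<in> P" "f \<otimes>\<^bsub>monoid_algebra M\<^esub> g \<in> P"
      by (simp_all add: mult.commute)
  qed (rule R.ring_axioms)
qed

lemma primeideal_iff_prime_in:
  "primeideal P (monoid_algebra M :: ('i, 'k::comm_ring_1) mpoly ring) \<longleftrightarrow> prime_in P"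
proof
  assume P: "primeideal P (monoid_algebra M :: ('i, 'k) mpoly ring)"
  interpret primeideal P "monoid_algebra M :: ('i, 'k) mpoly ring" by (rule P)
  have "P \<subseteq> {f. keys f \<subseteq> M}" using a_subset by simp
  moreover have "0 \<in> P"
    using additive_subgroup.zero_closed[OF ideal.axioms(1)[OF ideal_axioms]] by simp
  moreover have "1 \<notin> P" using one_imp_carrier I_notcarr by auto
  moreover have "f + g \<in> P" if "f \<in> P" "g \<in> P" for f g
    using additive_subgroup.a_closed[OF ideal.axioms(1)[OF ideal_axioms] that] by simp
  moreover have "f * g \<in> P" if "keys f \<subseteq> M" "g \<in> P" for f g
    using I_l_closed[of g f] that by simp
  moreover have "f \<in> P \<or> g \<in> P" if "keys f \<subseteq> M" "keys g \<subseteq> M" "f * g \<in> P" for f g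
    using I_prime[of f g] that by simp
  ultimately show "prime_in P" unfolding prime_in_def by blast
next
  assume P: "prime_in P"
  show "primeideal P (monoid_algebra M :: ('i, 'k) mpoly ring)"
  proof (rule primeidealI)
    show "ideal P (monoid_algebra M :: ('i, 'k) mpoly ring)"
      using P by (intro ideal_monoid_algebraI) (simp_all add: prime_in_def)
    show "carrier (monoid_algebra M) \<noteq> P"
      using P zero_M by (auto simp: prime_in_def)
  qed (use P cring_monoid_algebra in \<open>auto simp: prime_in_def\<close>)
qed

end

subsection \<open>Chains of primes are bounded by the growth\<close>

text \<open>Formulated for families, because different products of powers may coincide; a repetition
  is itself a linear dependence.\<close>

lemma (in vector_space) linear_dependence_of_card:
  assumes "finite E" "finite B" "\<And>a. a \<in> E \<Longrightarrow> \<phi> a \<in> span B" "card B < card E"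
  shows "\<exists>c. (\<exists>a\<in>E. c a \<noteq> 0) \<and> (\<Sum>a\<in>E. scale (c a) (\<phi> a)) = 0"
proof (cases "inj_on \<phi> E")
  case True
  have "\<not> independent (\<phi> ` E)"
    using independent_span_bound[OF assms(2), of "\<phi> ` E"] assms(3,4) card_image[OF True] by auto
  then obtain u where u: "\<exists>v\<in>\<phi> ` E. u v \<noteq> 0" "(\<Sum>v\<in>\<phi> ` E. scale (u v) v) = 0"
    using dependent_finite[of "\<phi> ` E"] assms(1) by auto
  then show ?thesis
    using sum.reindex[OF True, of "\<lambda>v. scale (u v) v"] by (intro exI[of _ "u \<circ> \<phi>"]) auto
next
  case False
  then obtain a b where ab: "a \<in> E" "b \<in> E" "a \<noteq> b" "\<phi> a = \<phi> b" by (auto simp: inj_on_def)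
  define c where "c x = (if x = a then 1 else if x = b then - 1 else (0::'a))" for x
  have "(\<Sum>x\<in>E. scale (c x) (\<phi> x)) = (\<Sum>x\<in>{a, b}. scale (c x) (\<phi> x))"
    using assms(1) ab by (intro sum.mono_neutral_right) (auto simp: c_def)
  also have "\<dots> = 0" using ab by (simp add: c_def)
  finally show ?thesis using ab(1) by (intro exI[of _ c]) (auto simp: c_def)
qed

text \<open>Lists follow the induction along a chain of primes. The surplus of the longer list is
  ignored.\<close>

fun list_power :: "'r::comm_monoid_mult list \<Rightarrow> nat list \<Rightarrow> 'r" where
  "list_power (x # xs) (k # ks) = x ^ k * list_power xs ks"
| "list_power _ _ = 1"

interpretation total_degree: weighted "\<lambda>_. Suc 0"
  by standard simp

context exponent_monoid
begin

lemma keys_list_power: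
  fixes xs :: "('i, 'k::comm_ring_1) mpoly list"
  shows "(\<And>x. x \<in> set xs \<Longrightarrow> keys x \<subseteq> M) \<Longrightarrow> keys (list_power xs ks) \<subseteq> M"
  by (induction xs ks rule: list_power.induct) (simp_all add: zero_M keys_mult_M keys_power_M)

text \<open>The lexicographically lowest term of an algebraic relation between elements
  \<open>x\<^sub>i \<in> P\<^sub>i\<^sub>+\<^sub>1 - P\<^sub>i\<close> cannot be cancelled.\<close>

lemma prime_chain_independent:
  fixes xs :: "('i, 'k::field) mpoly list" and P :: "nat \<Rightarrow> ('i, 'k) mpoly set"
  assumes "\<And>i. i \<le> length xs \<Longrightarrow> prime_in (P i)"
    and "\<And>i. i < length xs \<Longrightarrow> P i \<subseteq> P (Suc i) \<and> xs ! i \<in> P (Suc i) \<and> xs ! i \<notin> P i"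
    and "finite E" "\<And>a. a \<in> E \<Longrightarrow> length a = length xs" "\<exists>a\<in>E. c a \<noteq> 0"
  shows "(\<Sum>a\<in>E. mpoly_const (c a) * list_power xs a) \<notin> P 0"
  using assms
proof (induction xs arbitrary: P E c)
  case Nil
  then have "E \<subseteq> {[]}" by auto
  then have E: "E = {[]}" "c [] \<noteq> 0" using Nil.prems(5) by auto
  have P: "prime_in (P 0)" using Nil.prems(1)[of 0] by simp
  have "mpoly_const (inverse (c [])) * mpoly_const (c []) = (1 :: ('i, 'k) mpoly)"
    using E(2) by (simp flip: mpoly_const_mult)
  then have "mpoly_const (c []) \<notin> P 0" using P prime_in_mult[OF P keys_const_M]
      by (metis prime_in_def)
  then show ?case by (simp add: E(1))
next
  case (Cons x xs)
  show ?case
  proof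
    assume rel: "(\<Sum>a\<in>E. mpoly_const (c a) * list_power (x # xs) a) \<in> P 0"
    have P0: "prime_in (P 0)" and P1: "prime_in (P 1)"
      using Cons.prems(1)[of 0] Cons.prems(1)[of 1] by simp_all
    have x: "P 0 \<subseteq> P 1" "x \<in> P 1" "x \<notin> P 0" using Cons.prems(2)[of 0] by simp_all
    have keys_x: "keys x \<subseteq> M" using P1 x(2) by (auto simp: prime_in_def)
    have keys_xs: "keys y \<subseteq> M" if y: "y \<in> set xs" for y
    proof -
      obtain i where i: "i < length xs" "y = xs ! i" using y by (metis in_set_conv_nth)
      then have "y \<in> P (Suc (Suc i))" "prime_in (P (Suc (Suc i)))"
        using Cons.prems(1)[of "Suc (Suc i)"] Cons.prems(2)[of "Suc i"] by simp_all
      then show ?thesis by (auto simp: prime_in_def)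
    qed
    define E' where "E' = {a \<in> E. c a \<noteq> 0}"
    \<comment> \<open>The common factor \<open>x ^ k\<close> can be cancelled because
      \<open>x\<close> is outside the prime \<open>P 0\<close>. Modulo \<open>P 1\<close>, which
      contains \<open>x\<close>, only the terms with exponent exactly \<open>k\<close> survive, and
      they form a relation for the rest of the chain.\<close>
    define k where "k = Min (hd ` E')"
    have E': "finite E'" "E' \<noteq> {}" using Cons.prems(3,5) by (auto simp: E'_def)
    have k_le: "k \<le> hd a" if "a \<in> E'" for a using E' that by (simp add: k_def)
    have split: "a = hd a # tl a" "length (tl a) = length xs" if "a \<in> E'" for a
      using Cons.prems(4)[of a] that by (cases a; simp add: E'_def)+
    define g where "g a = mpoly_const (c a) * (x ^ (hd a - k) * list_power xs (tl a))" for a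
    have keys_g: "keys (g a) \<subseteq> M" for a
      unfolding g_def
      by (intro keys_mult_M keys_const_M keys_power_M keys_x keys_list_power keys_xs)
    have "(\<Sum>a\<in>E. mpoly_const (c a) * list_power (x # xs) a) =
        (\<Sum>a\<in>E'. mpoly_const (c a) * list_power (x # xs) a)"
      using Cons.prems(3) by (intro sum.mono_neutral_right) (auto simp: E'_def)
    also have "\<dots> = (\<Sum>a\<in>E'. x ^ k * g a)"
    proof (rule sum.cong)
      fix a assume a: "a \<in> E'"
      have "list_power (x # xs) a = x ^ hd a * list_power xs (tl a)"
        using list_power.simps(1)[of x xs "hd a" "tl a"] unfolding split(1)[OF a, symmetric] .
      moreover have "x ^ hd a = x ^ k * x ^ (hd a - k)"
        using k_le[OF a] by (simp flip: power_add)
      ultimately show "mpoly_const (c a) * list_power (x # xs) a = x ^ k * g a"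
        by (simp add: g_def mult_ac)
    qed simp
    also have "\<dots> = x ^ k * (\<Sum>a\<in>E'. g a)" by (simp add: sum_distrib_left)
    finally have "x ^ k * (\<Sum>a\<in>E'. g a) \<in> P 0" using rel by simp
    moreover have "x ^ j \<notin> P 0" for j
    proof (induction j)
      case 0
      then show ?case using P0 by (simp add: prime_in_def)
    next
      case (Suc j)
      then show ?case using P0 x(3) keys_x keys_power_M[OF keys_x, of j]
        by (auto simp: prime_in_def)
    qed
    moreover have "keys (\<Sum>a\<in>E'. g a) \<subseteq> M" by (intro keys_sum_M keys_g)
    ultimately have "(\<Sum>a\<in>E'. g a) \<in> P 0"
      using prime_in_prime[OF P0 keys_power_M[OF keys_x, of k]] by blast
    then have sum_P1: "(\<Sum>a\<in>E'. g a) \<in> P 1" using x(1) by blast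
    define E0 where "E0 = {a \<in> E'. hd a = k}"
    have g_P1: "g a \<in> P 1" if a: "a \<in> E' - E0" for a
    proof -
      obtain j where j: "hd a - k = Suc j"
        using a k_le[of a] by (cases "hd a - k") (auto simp: E0_def)
      have "g a = (mpoly_const (c a) * (x ^ j * list_power xs (tl a))) * x"
        by (simp add: g_def j mult_ac)
      moreover have "keys (mpoly_const (c a) * (x ^ j * list_power xs (tl a))) \<subseteq> M"
        by (intro keys_mult_M keys_const_M keys_power_M keys_x keys_list_power keys_xs)
      ultimately show ?thesis using P1 x(2) by (simp add: prime_in_def)
    qed
    have "(\<Sum>a\<in>A. g a) \<in> P 1" if "finite A" "A \<subseteq> E' - E0" for A
      using that
    proof (induction A rule: finite_induct)
      case (insert a A)
      then show ?case using g_P1[of a] P1 by (simp add: prime_in_def)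
    qed (use P1 in \<open>simp add: prime_in_def\<close>)
    then have "- (\<Sum>a\<in>E' - E0. g a) \<in> P 1" using E'(1) by (intro prime_in_uminus[OF P1]) simp
    moreover have "(\<Sum>a\<in>E'. g a) = (\<Sum>a\<in>E0. g a) + (\<Sum>a\<in>E' - E0. g a)"
      using E'(1) by (subst sum.subset_diff[of E0]) (auto simp: E0_def)
    ultimately have "(\<Sum>a\<in>E'. g a) + - (\<Sum>a\<in>E' - E0. g a) \<in> P 1"
      using sum_P1 by (intro prime_in_add[OF P1])
    then have "(\<Sum>a\<in>E0. g a) \<in> P 1"
      using \<open>(\<Sum>a\<in>E'. g a) = (\<Sum>a\<in>E0. g a) + (\<Sum>a\<in>E' - E0. g a)\<close> by simp
    moreover have "(\<Sum>a\<in>E0. g a) = (\<Sum>b\<in>tl ` E0. mpoly_const (c (k # b)) * list_power xs b)"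
    proof (subst sum.reindex)
      show "inj_on tl E0" using split(1) by (auto simp: inj_on_def E0_def) metis
      show "(\<Sum>a\<in>E0. g a) =
          (\<Sum>a\<in>E0. ((\<lambda>b. mpoly_const (c (k # b)) * list_power xs b) \<circ> tl) a)"
      proof (rule sum.cong)
        fix a assume "a \<in> E0"
        then have "hd a = k" "a = k # tl a" using split(1)[of a] by (auto simp: E0_def)
        then show "g a = ((\<lambda>b. mpoly_const (c (k # b)) * list_power xs b) \<circ> tl) a"
          by (simp add: g_def)
      qed simp
    qed
    moreover have "(\<Sum>b\<in>tl ` E0. mpoly_const (c (k # b)) * list_power xs b) \<notin> (P \<circ> Suc) 0"
    proof (rule Cons.IH)
      show "prime_in ((P \<circ> Suc) i)" if "i \<le> length xs" for i using Cons.prems(1) that by simp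
      show "(P \<circ> Suc) i \<subseteq> (P \<circ> Suc) (Suc i) \<and> xs ! i \<in> (P \<circ> Suc) (Suc i) \<and> xs ! i \<notin> (P \<circ> Suc) i"
        if "i < length xs" for i using Cons.prems(2)[of "Suc i"] that by simp
      show "finite (tl ` E0)" using E'(1) by (simp add: E0_def)
      show "length b = length xs" if "b \<in> tl ` E0" for b
        using that split(2) by (auto simp: E0_def)
      have "k \<in> hd ` E'" unfolding k_def using E' by (intro Min_in) auto
      then obtain a where a: "a \<in> E'" "hd a = k" by auto
      then have "c (k # tl a) \<noteq> 0" using split(1)[OF a(1)] by (auto simp: E'_def)
      then show "\<exists>b\<in>tl ` E0. c (k # b) \<noteq> 0" using a by (auto simp: E0_def)
    qed
    ultimately show False by simp
  qed
qed

definition bounded :: "nat \<Rightarrow> ('i, 'k::comm_ring_1) mpoly \<Rightarrow> bool" where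
  "bounded n f \<longleftrightarrow> (\<forall>m\<in>keys f. m \<in> M \<and> total_degree.wdeg m \<le> n)"

lemma bounded_mult: "bounded n f \<Longrightarrow> bounded n' g \<Longrightarrow> bounded (n + n') (f * g)"
  unfolding bounded_def using keys_mult[of f g]
  by (fastforce simp: total_degree.wdeg_add intro: add_M add_mono)

lemma bounded_1: "bounded n 1"
  using zero_M by (simp add: bounded_def total_degree.wdeg_def)

lemma bounded_power: "bounded n f \<Longrightarrow> bounded (n * k) (f ^ k)"
  by (induction k) (simp_all add: bounded_1 bounded_mult)

lemma bounded_list_power:
  fixes xs :: "('i, 'k::comm_ring_1) mpoly list"
  shows "(\<And>x. x \<in> set xs \<Longrightarrow> bounded n x) \<Longrightarrow> bounded (n * sum_list ks) (list_power xs ks)"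
proof (induction xs ks rule: list_power.induct)
  case (1 x xs k ks)
  have "bounded (n * k + n * sum_list ks) (x ^ k * list_power xs ks)"
    using 1 by (intro bounded_mult bounded_power) auto
  then show ?case by (simp add: distrib_left)
qed (simp_all add: bounded_1)

text \<open>A longer chain would provide r + 1 independent elements. Their products with exponents
  below N number N^(r+1), but lie in a space whose dimension grows like N^r only.\<close>

lemma prime_chain_length_le:
  fixes P :: "nat \<Rightarrow> ('i, 'k::field) mpoly set"
  assumes growth: "\<And>n. finite {m \<in> M. total_degree.wdeg m \<le> n} \<and>
      card {m \<in> M. total_degree.wdeg m \<le> n} \<le> (K * (n + 1)) ^ r"
    and P: "\<And>i. i \<le> d \<Longrightarrow> prime_in (P i)" "\<And>i. i < d \<Longrightarrow> P i \<subset> P (Suc i)"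
  shows "d \<le> r"
proof (rule ccontr)
  assume "\<not> d \<le> r"
  have "\<exists>x. x \<in> P (Suc i) - P i" if "i < d" for i using P(2)[OF that] by blast
  then obtain x where x: "\<And>i. i < d \<Longrightarrow> x i \<in> P (Suc i) - P i" by metis
  define xs where "xs = map x [0..<Suc r]"
  have xs: "length xs = Suc r" "\<And>i. i < Suc r \<Longrightarrow> xs ! i = x i"
    by (simp_all add: xs_def del: upt_Suc)
  define D where "D = Max (total_degree.wdeg ` (\<Union>y\<in>set xs. keys y))"
  have "bounded D y" if y: "y \<in> set xs" for y
  proof -
    obtain i where i: "i < Suc r" "y = x i" using y by (auto simp: xs_def simp del: upt_Suc)
    then have "y \<in> P (Suc i)" "prime_in (P (Suc i))" using x[of i] P(1)[of "Suc i"] \<open>\<not> d \<le> r\<close> by auto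
    then have "keys y \<subseteq> M" by (auto simp: prime_in_def)
    moreover have "total_degree.wdeg m \<le> D" if "m \<in> keys y" for m
      unfolding D_def using that \<open>y \<in> set xs\<close> by (intro Max_ge) auto
    ultimately show ?thesis by (auto simp: bounded_def)
  qed
  note bounded = bounded_list_power[of xs D, OF this]
  \<comment> \<open>\<open>C\<close> absorbs all constants: the degree bound \<open>n\<close>
    satisfies \<open>K * (n + 1) \<le> C * N\<close>, so the dimension is at most
    \<open>C ^ r * N ^ r\<close>, and \<open>N\<close> is chosen larger than
    \<open>C ^ r\<close>.\<close>
  define C where "C = K * (D * Suc r + 1)"
  define N where "N = C ^ r + 1"
  define E where "E = {a. set a \<subseteq> {..<N} \<and> length a = Suc r}"
  have E: "finite E" "card E = N ^ Suc r"
    unfolding E_def using finite_lists_length_eq[of "{..<N}" "Suc r"]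
      card_lists_length_eq[of "{..<N}" "Suc r"] by simp_all
  define n where "n = D * (Suc r * N)"
  define B where "B = (monomial ` {m \<in> M. total_degree.wdeg m \<le> n} :: ('i, 'k) mpoly set)"
  have "finite B" unfolding B_def using growth by blast
  have "card B \<le> (K * (n + 1)) ^ r"
    unfolding B_def using growth[of n] card_image_le le_trans by blast
  also have "\<dots> \<le> (C * N) ^ r"
  proof (rule power_mono)
    have "n + 1 \<le> (D * Suc r + 1) * N" by (simp add: n_def N_def algebra_simps)
    then have "K * (n + 1) \<le> K * ((D * Suc r + 1) * N)" by (rule mult_le_mono2)
    then show "K * (n + 1) \<le> C * N" by (simp only: C_def mult.assoc)
  qed simp
  also have "\<dots> = C ^ r * N ^ r" by (rule power_mult_distrib)
  also have "\<dots> < N * N ^ r" by (intro mult_strict_right_mono) (simp_all add: N_def)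
  also have "\<dots> = card E" by (simp add: E(2))
  finally have card: "card B < card E" .
  have span: "list_power xs a \<in> linear_span B" if "a \<in> E" for a
  proof -
    have "sum_list a \<le> length a * N"
      using sum_list_mono[of a id "\<lambda>_. N"] that by (force simp: E_def sum_list_triv)
    then have "D * sum_list a \<le> n" using that by (simp add: E_def n_def)
    then have "monomial m \<in> B" if "m \<in> keys (list_power xs a)" for m
      using bounded[of a] that by (fastforce simp: bounded_def B_def)
    then have "(\<Sum>m\<in>keys (list_power xs a). mpoly_const (lookup (list_power xs a) m) * monomial m)
        \<in> linear_span B"
      by (intro mpoly_space.span_sum mpoly_space.span_scale mpoly_space.span_base)
    then show ?thesis using mpoly_expand[of "keys (list_power xs a)" "list_power xs a"] by simp
  qed
  obtain c where c: "\<exists>a\<in>E. c a \<noteq> 0" "(\<Sum>a\<in>E. mpoly_const (c a) * list_power xs a) = 0"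
    using mpoly_space.linear_dependence_of_card[OF E(1) \<open>finite B\<close>, of "list_power xs", OF span card]
    by blast
  have "(\<Sum>a\<in>E. mpoly_const (c a) * list_power xs a) \<notin> P 0"
  proof (rule prime_chain_independent)
    show "prime_in (P i)" if "i \<le> length xs" for i using that P(1) \<open>\<not> d \<le> r\<close> xs by simp
    show "P i \<subseteq> P (Suc i) \<and> xs ! i \<in> P (Suc i) \<and> xs ! i \<notin> P i" if "i < length xs" for i
      using that P(2)[of i] x[of i] \<open>\<not> d \<le> r\<close> xs by auto
    show "length a = length xs" if "a \<in> E" for a using that xs by (simp add: E_def)
  qed (use E c in auto)
  moreover have "0 \<in> P 0" using P(1)[of 0] by (simp add: prime_in_def)
  ultimately show False using c(2) by simp
qed

lemma krull_dim_monoid_algebra_le: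
  assumes "\<And>n. finite {m \<in> M. total_degree.wdeg m \<le> n} \<and>
      card {m \<in> M. total_degree.wdeg m \<le> n} \<le> (K * (n + 1)) ^ r"
  shows "krull_dim (monoid_algebra M :: ('i, 'k::field) mpoly ring) \<le> enat r"
  unfolding krull_dim_def primeideal_iff_prime_in
proof (rule Sup_least)
  fix x assume "x \<in> {enat d | d. \<exists>P :: nat \<Rightarrow> ('i, 'k) mpoly set.
    (\<forall>i\<le>d. prime_in (P i)) \<and> (\<forall>i<d. P i \<subset> P (Suc i))}"
  then obtain d and P :: "nat \<Rightarrow> ('i, 'k) mpoly set" where "x = enat d"
    "\<And>i. i \<le> d \<Longrightarrow> prime_in (P i)" "\<And>i. i < d \<Longrightarrow> P i \<subset> P (Suc i)" by blast
  then show "x \<le> enat r" using prime_chain_length_le[OF assms, of d P] by simp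
qed

section \<open>Prime ideals from sets of variables\<close>

definition face_ideal :: "'i set \<Rightarrow> ('i, 'k::comm_ring_1) mpoly set" where
  "face_ideal A = {f. keys f \<subseteq> M \<and> (\<forall>m\<in>keys f. \<not> keys m \<subseteq> A)}"

lemma keys_add_nat: "keys (m + n) = keys m \<union> keys n" for m n :: "'j \<Rightarrow>\<^sub>0 nat"
  by (auto simp: in_keys_iff lookup_add)

text \<open>This is the kernel of setting the variables outside \<open>A\<close> to 0. If both
  factors have terms supported in \<open>A\<close>, the highest ones for a separating weight
  multiply to a term of the product that nothing cancels.\<close>

lemma prime_in_face_ideal: "prime_in (face_ideal A :: ('i, 'k::field) mpoly set)"
proof -
  let ?P = "face_ideal A :: ('i, 'k) mpoly set"
  have add: "f + g \<in> ?P" if "f \<in> ?P" "g \<in> ?P" for f g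
    using that keys_add[of f g] keys_add_M[of f g] unfolding face_ideal_def by blast
  have mult: "f * g \<in> ?P" if "keys f \<subseteq> M" "g \<in> ?P" for f g
  proof -
    have "\<not> keys m \<subseteq> A" if m: "m \<in> keys (f * g)" for m
    proof -
      obtain a b where "m = a + b" "b \<in> keys g" using keys_mult[of f g] m by blast
      then show ?thesis using \<open>g \<in> ?P\<close> by (auto simp: face_ideal_def keys_add_nat)
    qed
    then show ?thesis using that keys_mult_M[of f g] by (auto simp: face_ideal_def)
  qed
  have prime: "f \<in> ?P \<or> g \<in> ?P" if fg: "keys f \<subseteq> M" "keys g \<subseteq> M" "f * g \<in> ?P" for f g
  proof (rule ccontr)
    assume "\<not> ?thesis"
    define U where "U h = {m \<in> keys h. keys m \<subseteq> A}" for h :: "('i, 'k) mpoly"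
    have ne: "U f \<noteq> {}" "U g \<noteq> {}" and fin: "finite (U f)" "finite (U g)"
      using \<open>\<not> (f \<in> ?P \<or> g \<in> ?P)\<close> fg by (auto simp: face_ideal_def U_def)
    obtain s :: "('i \<Rightarrow>\<^sub>0 nat) \<Rightarrow> nat" where s: "inj_on s (U f \<union> U g)" "\<And>m n. s (m + n) = s m + s n"
      using separating_weights[of "U f \<union> U g"] fin by (metis finite_UnI)
    obtain a where a: "a \<in> U f" "\<And>m. m \<in> U f \<Longrightarrow> s m \<le> s a"
      using finite_obtains_maximum[OF fin(1) ne(1)] by blast
    obtain b where b: "b \<in> U g" "\<And>m. m \<in> U g \<Longrightarrow> s m \<le> s b"
      using finite_obtains_maximum[OF fin(2) ne(2)] by blast
    have unique: "m = a \<and> n = b" if mn: "m \<in> keys f" "n \<in> keys g" "m + n = a + b" for m n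
    proof -
      have "keys (m + n) \<subseteq> A" unfolding mn(3) using a(1) b(1) by (auto simp: keys_add_nat U_def)
      then have mn': "m \<in> U f" "n \<in> U g"
        unfolding keys_add_nat[of m n] using mn(1,2) by (simp_all add: U_def)
      have "s m + s n = s a + s b" using arg_cong[OF mn(3), of s] by (simp add: s(2))
      then have "s m = s a" "s n = s b" using a(2)[OF mn'(1)] b(2)[OF mn'(2)] by linarith+
      then show ?thesis using s(1) mn' a(1) b(1) by (auto dest: inj_onD)
    qed
    have "f * g = (\<Sum>m\<in>keys f. \<Sum>n\<in>keys g. single (m + n) (lookup f m * lookup g n))"
      by (subst sum_single_lookup[of f, symmetric], subst sum_single_lookup[of g, symmetric])
        (simp add: sum_product mult_single)
    then have "lookup (f * g) (a + b) =
        (\<Sum>m\<in>keys f. \<Sum>n\<in>keys g. if m + n = a + b then lookup f m * lookup g n else 0)"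
      by (simp add: lookup_sum lookup_single when_def)
    also have "\<dots> = (\<Sum>m\<in>keys f. if m = a then \<Sum>n\<in>keys g.
        if n = b then lookup f m * lookup g n else 0 else 0)"
      using unique by (intro sum.cong refl) (auto intro!: sum.cong sum.neutral)
    also have "\<dots> = lookup f a * lookup g b" using a(1) b(1) by (simp add: U_def)
    finally have "a + b \<in> keys (f * g)" using a(1) b(1) by (simp add: U_def in_keys_iff)
    moreover have "keys (a + b) \<subseteq> A"
      unfolding keys_add_nat[of a b] using a(1) b(1) by (simp add: U_def)
    ultimately show False using fg(3) by (simp add: face_ideal_def)
  qed
  show ?thesis
    unfolding prime_in_def
  proof (intro conjI ballI allI impI)
    show "?P \<subseteq> {f. keys f \<subseteq> M}" "0 \<in> ?P" "1 \<notin> ?P" by (auto simp: face_ideal_def)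
  qed (simp_all add: add mult prime)
qed

lemma face_ideal_psubset:
  assumes "A \<subseteq> keys m" "\<not> keys m \<subseteq> A" "m \<in> M"
  shows "(face_ideal (keys m) :: ('i, 'k::field) mpoly set) \<subset> face_ideal A"
proof -
  have "(monomial m :: ('i, 'k) mpoly) \<in> face_ideal A - face_ideal (keys m)"
    using assms by (simp add: face_ideal_def)
  moreover have "(face_ideal (keys m) :: ('i, 'k) mpoly set) \<subseteq> face_ideal A"
    using assms(1) by (auto simp: face_ideal_def dest: subset_trans)
  ultimately show ?thesis by blast
qed

lemma krull_dim_monoid_algebra_ge:
  assumes "\<And>i. i < k \<Longrightarrow> A i \<subset> A (Suc i)" "\<And>i. i < k \<Longrightarrow> \<exists>m\<in>M. keys m = A (Suc i)"
  shows "enat k \<le> krull_dim (monoid_algebra M :: ('i, 'k::field) mpoly ring)"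
  unfolding krull_dim_def primeideal_iff_prime_in
proof (intro Sup_upper CollectI exI conjI allI impI)
  \<comment> \<open>Larger sets give smaller ideals, so the chain is traversed backwards.\<close>
  show "prime_in (face_ideal (A (k - i)) :: ('i, 'k) mpoly set)" for i by (rule prime_in_face_ideal)
  show "(face_ideal (A (k - i)) :: ('i, 'k) mpoly set) \<subset> face_ideal (A (k - Suc i))" if "i < k" for i
  proof -
    have i: "k - Suc i < k" "Suc (k - Suc i) = k - i" using that by simp_all
    obtain m where m: "m \<in> M" "keys m = A (k - i)" using assms(2)[OF i(1)] i(2) by auto
    have "A (k - Suc i) \<subset> A (k - i)" using assms(1)[OF i(1)] i(2) by simp
    then show ?thesis using face_ideal_psubset[of "A (k - Suc i)" m] m by auto
  qed
qed (rule refl)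

end

section \<open>Circulations and the dimension of the quotient\<close>

definition inflow :: "('v, 'a) pre_digraph \<Rightarrow> ('a \<Rightarrow> 'b::comm_monoid_add) \<Rightarrow> 'v \<Rightarrow> 'b" where
  "inflow Q x v = (\<Sum>e\<in>arcs Q. if head Q e = v then x e else 0)"

definition outflow :: "('v, 'a) pre_digraph \<Rightarrow> ('a \<Rightarrow> 'b::comm_monoid_add) \<Rightarrow> 'v \<Rightarrow> 'b" where
  "outflow Q x v = (\<Sum>e\<in>arcs Q. if tail Q e = v then x e else 0)"

text \<open>Vanishing off the arcs makes circulations of natural numbers the exponents of invariant
  monomials. The type of values is left open, since differences are taken over the integers.\<close>

definition circulations :: "('v, 'a) pre_digraph \<Rightarrow> ('a \<Rightarrow> 'b::comm_monoid_add) set" where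
  "circulations Q = {x. (\<forall>e. e \<notin> arcs Q \<longrightarrow> x e = 0) \<and> (\<forall>v\<in>verts Q. inflow Q x v = outflow Q x v)}"

lemma inflow_add: "inflow Q (\<lambda>e. x e + y e) v = inflow Q x v + inflow Q y v"
  and outflow_add: "outflow Q (\<lambda>e. x e + y e) v = outflow Q x v + outflow Q y v"
  by (auto simp: inflow_def outflow_def sum.distrib[symmetric] intro!: sum.cong)

lemma inflow_mult: "inflow Q (\<lambda>e. c * x e) v = c * inflow Q x v"
  and outflow_mult: "outflow Q (\<lambda>e. c * x e) v = c * outflow Q x v"
  for c :: "'b::semiring_0"
  by (auto simp: inflow_def outflow_def sum_distrib_left intro!: sum.cong)

lemma inflow_of_nat: "inflow Q (\<lambda>e. of_nat (x e)) v = (of_nat (inflow Q x v) :: 'b::semiring_1)"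
  and outflow_of_nat: "outflow Q (\<lambda>e. of_nat (x e)) v = (of_nat (outflow Q x v) :: 'b)"
  by (auto simp: inflow_def outflow_def intro!: sum.cong)

lemma circulations_add: "x \<in> circulations Q \<Longrightarrow> y \<in> circulations Q \<Longrightarrow> (\<lambda>e. x e + y e) \<in> circulations Q"
  by (simp add: circulations_def inflow_add outflow_add)

lemma circulations_mult: "x \<in> circulations Q \<Longrightarrow> (\<lambda>e. c * x e) \<in> circulations Q"
  for c :: "'b::semiring_0"
  by (simp add: circulations_def inflow_mult outflow_mult)

lemma circulations_of_nat: "x \<in> circulations Q \<Longrightarrow>
    (\<lambda>e. of_nat (x e) :: 'b::semiring_1) \<in> circulations Q"
  by (simp add: circulations_def inflow_of_nat outflow_of_nat)

lemma circulations_nat: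
  assumes "z \<in> circulations Q" "\<And>e. z e \<ge> 0"
  shows "(\<lambda>e. nat (z e)) \<in> circulations Q"
proof -
  have "int (inflow Q (\<lambda>e. nat (z e)) v) = inflow Q z v"
    "int (outflow Q (\<lambda>e. nat (z e)) v) = outflow Q z v" for v
    using assms(2) by (auto simp flip: inflow_of_nat outflow_of_nat)
  then show ?thesis using assms(1) by (auto simp: circulations_def) (metis of_nat_eq_iff)
qed

lemma circulations_0: "(\<lambda>_. 0) \<in> circulations Q"
  by (simp add: circulations_def inflow_def outflow_def)

lemma keys_circulation: "lookup m \<in> circulations Q \<Longrightarrow> keys m \<subseteq> arcs Q"
  by (auto simp: circulations_def in_keys_iff)

interpretation circulation_monoid: exponent_monoid "{m. lookup m \<in> circulations Q}" for Q
proof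
  show "0 \<in> {m. lookup m \<in> circulations Q}" by (simp add: circulations_0 lookup_zero[abs_def])
  show "m + n \<in> {m. lookup m \<in> circulations Q}"
    if "m \<in> {m. lookup m \<in> circulations Q}" "n \<in> {m. lookup m \<in> circulations Q}" for m n
    using circulations_add[of "lookup m" Q "lookup n"] that by (simp add: lookup_add[abs_def])
qed

section \<open>Torus invariants\<close>

context fin_digraph
begin

lemma
  fixes g :: "'a \<Rightarrow> 'k::field"
  shows prod_power_head: "(\<Prod>e\<in>arcs G. g (head G e) ^ m e) = (\<Prod>v\<in>verts G. g v ^ inflow G m v)"
    and prod_power_tail: "(\<Prod>e\<in>arcs G. g (tail G e) ^ m e) = (\<Prod>v\<in>verts G. g v ^ outflow G m v)"
proof -
  have *: "(\<Prod>e\<in>arcs G. g (f e) ^ m e) = (\<Prod>v\<in>verts G. g v ^ (\<Sum>e\<in>arcs G. if f e = v then m e else 0))"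
    if "\<And>e. e \<in> arcs G \<Longrightarrow> f e \<in> verts G" for f
  proof -
    have "(\<Prod>v\<in>verts G. g v ^ (\<Sum>e\<in>arcs G. if f e = v then m e else 0)) =
        (\<Prod>v\<in>verts G. \<Prod>e\<in>arcs G. if f e = v then g (f e) ^ m e else 1)"
      by (auto simp: power_sum intro!: prod.cong)
    also have "\<dots> = (\<Prod>e\<in>arcs G. \<Prod>v\<in>verts G. if f e = v then g (f e) ^ m e else 1)"
      by (rule prod.swap)
    also have "\<dots> = (\<Prod>e\<in>arcs G. g (f e) ^ m e)" using that by (intro prod.cong refl) simp
    finally show ?thesis by simp
  qed
  show "(\<Prod>e\<in>arcs G. g (head G e) ^ m e) = (\<Prod>v\<in>verts G. g v ^ inflow G m v)"
    "(\<Prod>e\<in>arcs G. g (tail G e) ^ m e) = (\<Prod>v\<in>verts G. g v ^ outflow G m v)"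
    unfolding inflow_def outflow_def by (rule *, simp)+
qed

text \<open>The scalar by which the torus element \<open>g\<close> acts on the monomial
  \<open>m\<close>.\<close>

definition character :: "('a \<Rightarrow> 'k::field) \<Rightarrow> ('b \<Rightarrow>\<^sub>0 nat) \<Rightarrow> 'k" where
  "character g m = (\<Prod>v\<in>verts G. g v ^ inflow G (lookup m) v) *
     inverse (\<Prod>v\<in>verts G. g v ^ outflow G (lookup m) v)"

lemma power_prod_rep_act:
  assumes "keys m \<subseteq> arcs G"
  shows "power_prod (rep_act G g x) m = character g m * power_prod x m"
  unfolding power_prod_superset[OF finite_arcs assms] character_def
    prod_power_head[symmetric] prod_power_tail[symmetric]
  by (simp add: rep_act_def power_mult_distrib prod.distrib prod_inversef[symmetric] power_inverse
      mult_ac)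

lemma character_eq_1:
  assumes "lookup m \<in> circulations G" "g \<in> torus G"
  shows "character g m = (1 :: 'k::field)"
proof -
  have "(\<Prod>v\<in>verts G. g v ^ inflow G (lookup m) v) = (\<Prod>v\<in>verts G. g v ^ outflow G (lookup m) v)"
    using assms(1) by (intro prod.cong) (auto simp: circulations_def)
  moreover have "(\<Prod>v\<in>verts G. g v ^ outflow G (lookup m) v) \<noteq> 0"
    using assms(2) by (auto simp: torus_def)
  ultimately show ?thesis by (simp add: character_def)
qed

text \<open>Monomials are eigenvectors of the torus, so an invariant polynomial consists of
  invariant monomials.\<close>

lemma carrier_iss_ring:
  "carrier (iss_ring G :: ('b, 'k::field_char_0) mpoly ring) =
      {f. \<forall>m\<in>keys f. lookup m \<in> circulations G}"
proof (intro equalityI subsetI)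
  fix f :: "('b, 'k) mpoly" assume f: "f \<in> {f. \<forall>m\<in>keys f. lookup m \<in> circulations G}"
  have keys: "keys m \<subseteq> arcs G" if "m \<in> keys f" for m
    using f that keys_circulation by blast
  have "mpoly_eval (rep_act G g x) f = mpoly_eval x f" if "g \<in> torus G" for g :: "'a \<Rightarrow> 'k" and x
    unfolding id_hom.subst_superset[OF finite_keys subset_refl]
    using f keys character_eq_1[OF _ that] by (intro sum.cong refl) (simp add: power_prod_rep_act)
  then show "f \<in> carrier (iss_ring G)"
    using keys by (simp add: iss_ring_def mpoly_ring_def)
next
  fix f :: "('b, 'k) mpoly" assume "f \<in> carrier (iss_ring G)"
  then have keys: "\<And>m. m \<in> keys f \<Longrightarrow> keys m \<subseteq> arcs G"
    and inv: "\<And>g x. g \<in> torus G \<Longrightarrow> mpoly_eval (rep_act G g x) f = mpoly_eval x f"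
    by (simp_all add: iss_ring_def mpoly_ring_def)
  have char: "character g m = 1" if g: "g \<in> torus G" and m: "m \<in> keys f" for g :: "'a \<Rightarrow> 'k" and m
  proof -
    \<comment> \<open>\<open>h\<close> is the translate of \<open>f\<close> by \<open>g\<close>. It
      has the same values as \<open>f\<close>, hence the same coefficients.\<close>
    define h where "h = (\<Sum>m\<in>keys f. single m (lookup f m * character g m))"
    have "mpoly_eval x h = mpoly_eval x f" for x
    proof -
      have "mpoly_eval x h = (\<Sum>m\<in>keys f. lookup f m * character g m * power_prod x m)"
        by (simp add: h_def id_hom.subst_sum id_hom.subst_single)
      also have "\<dots> = mpoly_eval (rep_act G g x) f"
        unfolding id_hom.subst_superset[OF finite_keys subset_refl]
        using keys by (intro sum.cong refl) (simp add: power_prod_rep_act)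
      finally show ?thesis using inv[OF g] by simp
    qed
    then have "mpoly_eval x (h - f) = 0" for x
      using id_hom.subst_add[of x "h - f" f] by simp
    then have "h = f" using mpoly_eq_0_if_eval_eq_0[of "h - f"] by simp
    moreover have "lookup h m = lookup f m * character g m"
      using m by (simp add: h_def lookup_sum lookup_single when_def)
    ultimately show ?thesis using m by (simp add: in_keys_iff)
  qed
  have "lookup m \<in> circulations G" if m: "m \<in> keys f" for m
  proof -
    have "inflow G (lookup m) v = outflow G (lookup m) v" if v: "v \<in> verts G" for v
    proof -
      \<comment> \<open>In characteristic 0 the powers of 2 are distinct, so this single torus
        element tests conservation at \<open>v\<close>.\<close>
      define g where "g u = (if u = v then 2 else 1 :: 'k)" for u
      have "(\<Prod>u\<in>verts G. g u ^ k u) = 2 ^ k v" for k :: "'a \<Rightarrow> nat"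
        using v by (simp add: g_def if_distrib[of "\<lambda>x. x ^ _"] cong: if_cong)
      then have "character g m = 2 ^ inflow G (lookup m) v * inverse (2 ^ outflow G (lookup m) v)"
        by (simp add: character_def)
      moreover have "character g m = 1" using m by (intro char) (auto simp: torus_def g_def)
      ultimately have "(2 :: 'k) ^ inflow G (lookup m) v = 2 ^ outflow G (lookup m) v"
        by (simp add: field_simps)
      then have "(of_nat (2 ^ inflow G (lookup m) v) :: 'k) = of_nat (2 ^ outflow G (lookup m) v)"
        by simp
      then have "2 ^ inflow G (lookup m) v = (2 ^ outflow G (lookup m) v :: nat)"
        by (simp only: of_nat_eq_iff)
      then show ?thesis by simp
    qed
    then show ?thesis using keys[OF m] by (auto simp: circulations_def in_keys_iff)
  qed
  then show "f \<in> {f. \<forall>m\<in>keys f. lookup m \<in> circulations G}" by blast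
qed

lemma iss_ring_eq_monoid_algebra:
  "(iss_ring G :: ('b, 'k::field_char_0) mpoly ring) = monoid_algebra {m. lookup m \<in> circulations G}"
proof -
  have "(iss_ring G :: ('b, 'k) mpoly ring) =
      ring_of_type_algebra \<lparr>carrier := carrier (iss_ring G :: ('b, 'k) mpoly ring)\<rparr>"
    by (simp add: iss_ring_def mpoly_ring_def)
  then show ?thesis unfolding carrier_iss_ring monoid_algebra_def by (simp add: subset_eq)
qed

section \<open>Growth of the number of circulations\<close>

definition flows_upto :: "nat \<Rightarrow> ('b \<Rightarrow> nat) set" where
  "flows_upto n = {x \<in> circulations G. sum x (arcs G) \<le> n}"

lemma finite_flows_upto: "finite (flows_upto n)"
proof (rule finite_subset)
  show "flows_upto n \<subseteq> {x. \<forall>e. (e \<in> arcs G \<longrightarrow> x e \<in> {..n}) \<and> (e \<notin> arcs G \<longrightarrow> x e = 0)}"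
  proof
    fix x assume x: "x \<in> flows_upto n"
    have "x e \<le> n" if "e \<in> arcs G" for e
      using member_le_sum[of e "arcs G" x] that x by (auto simp: flows_upto_def)
    then show "x \<in> {x. \<forall>e. (e \<in> arcs G \<longrightarrow> x e \<in> {..n}) \<and> (e \<notin> arcs G \<longrightarrow> x e = 0)}"
      using x by (auto simp: flows_upto_def circulations_def)
  qed
qed (intro finite_set_of_finite_funs, simp_all)

lemma degree_circulation:
  assumes "lookup m \<in> circulations G"
  shows "total_degree.wdeg m = sum (lookup m) (arcs G)"
  using assms total_degree.wdeg_superset[of "arcs G" m]
  by (auto simp: circulations_def in_keys_iff)

lemma krull_dim_iss_ring_le:
  assumes "\<And>n. card (flows_upto n) \<le> (K * (n + 1)) ^ r"
  shows "krull_dim (iss_ring G :: ('b, 'k::field_char_0) mpoly ring) \<le> enat r"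
  unfolding iss_ring_eq_monoid_algebra
proof (rule circulation_monoid.krull_dim_monoid_algebra_le[where Q = G and K = K])
  fix n
  let ?M = "{m \<in> {m. lookup m \<in> circulations G}. total_degree.wdeg m \<le> n}"
  have inj: "inj_on lookup ?M" by (rule inj_onI) (rule lookup_inject[THEN iffD1])
  have sub: "lookup ` ?M \<subseteq> flows_upto n" by (auto simp: flows_upto_def degree_circulation)
  have "finite ?M" using inj_on_finite[OF inj sub finite_flows_upto] .
  moreover have "card ?M \<le> card (flows_upto n)"
    using card_inj_on_le[OF inj sub finite_flows_upto] .
  ultimately show "finite ?M \<and> card ?M \<le> (K * (n + 1)) ^ r"
    using assms[of n] le_trans by blast
qed

definition support :: "('b \<Rightarrow> nat) \<Rightarrow> 'b set" where
  "support x = {e. x e > 0}"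

text \<open>These sets correspond to the faces of the cone of circulations.\<close>

definition supports :: "'b set set" where
  "supports = support ` circulations G"

lemma supports_subset: "A \<in> supports \<Longrightarrow> A \<subseteq> arcs G"
  by (auto simp: supports_def support_def circulations_def)

lemma finite_supports: "finite supports"
  using supports_subset by (intro finite_subset[of supports "Pow (arcs G)"]) auto

text \<open>Each step of a saturated chain of supports imposes just one linear condition: outside the
  smaller support, all circulations within the larger one are proportional, since otherwise a
  suitable difference has its support strictly in between.\<close>

lemma circulation_vanishing:
  assumes A: "A \<in> supports" and B: "B \<in> supports" "B \<subset> A"
    and maximal: "\<And>D. D \<in> supports \<Longrightarrow> B \<subset> D \<Longrightarrow> D \<subset> A \<Longrightarrow> False"
    and e: "e \<in> A - B" and x: "(x :: 'b \<Rightarrow> int) \<in> circulations G" "\<And>f. f \<notin> A \<Longrightarrow> x f = 0" "x e = 0"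
  shows "f \<notin> B \<Longrightarrow> x f = 0"
proof -
  obtain u where u: "u \<in> circulations G" "support u = A" using A by (auto simp: supports_def)
  obtain w where w: "w \<in> circulations G" "support w = B" using B by (auto simp: supports_def)
  have upos: "f \<in> A \<longleftrightarrow> u f > 0" and wpos: "f \<in> B \<longleftrightarrow> w f > 0" for f
    using u(2) w(2) by (auto simp: support_def)
  have finA: "finite A" using finite_subset[OF supports_subset[OF A] finite_arcs] .
  have nonneg: "x f \<ge> 0" if x: "(x :: 'b \<Rightarrow> int) \<in> circulations G" "\<And>f. f \<notin> A \<Longrightarrow> x f = 0" "x e = 0"
    and f: "f \<in> A - B" for x f
  proof (rule ccontr)
    assume neg: "\<not> x f \<ge> 0"
    \<comment> \<open>\<open>g\<close> minimises the ratio of \<open>x\<close> to \<open>u\<close>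
      on \<open>A - B\<close>; subtracting that multiple of \<open>u\<close>, with denominators
      cleared, leaves a circulation that is nonnegative there and vanishes at
      \<open>g\<close>.\<close>
    define q where "q f = - (real_of_int (x f) / real (u f))" for f
    obtain g where g: "g \<in> A - B" "\<And>f. f \<in> A - B \<Longrightarrow> q f \<le> q g"
      using finite_obtains_maximum[of "A - B" q] finA f by auto
    have ratio: "int (u g) * x f - x g * int (u f) \<ge> 0" if "f \<in> A - B" for f
    proof -
      have "real_of_int (x g) / real (u g) \<le> real_of_int (x f) / real (u f)"
        using g(2)[OF that] by (simp add: q_def)
      then have "real_of_int (x g) * real (u f) \<le> real_of_int (x f) * real (u g)"
        using that g(1) upos[of f] upos[of g] by (simp add: divide_simps split: if_splits)
      then have "real_of_int (x g * int (u f)) \<le> real_of_int (x f * int (u g))" by simp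
      then show ?thesis by (simp only: of_int_le_iff mult.commute)
    qed
    have "x g < 0"
    proof (rule ccontr)
      assume "\<not> x g < 0"
      then have "x g * int (u f) \<ge> 0" by simp
      then have "int (u g) * x f \<ge> 0" using ratio[OF f] by linarith
      moreover have "int (u g) * x f < 0" using neg g(1) upos[of g] by (intro mult_pos_neg) auto
      ultimately show False by simp
    qed
    define y where "y f = int (u g) * x f + (- x g) * int (u f)" for f
    have y: "y \<in> circulations G"
      unfolding y_def
      by (intro circulations_add circulations_mult x circulations_of_nat u)
    \<comment> \<open>A large multiple of \<open>w\<close>, which is positive exactly on
      \<open>B\<close>, repairs the signs on \<open>B\<close> and changes nothing elsewhere.\<close>
    define N where "N = (\<Sum>f\<in>A. \<bar>y f\<bar>) + 1"
    have N: "\<bar>y f\<bar> < N" if "f \<in> A" for f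
      using member_le_sum[of f A "\<lambda>f. \<bar>y f\<bar>"] that finA by (simp add: N_def)
    define z where "z f = y f + N * int (w f)" for f
    have z: "z \<in> circulations G"
      unfolding z_def by (intro circulations_add circulations_mult y circulations_of_nat w)
    have zB: "z f > 0" if "f \<in> B" for f
    proof -
      have "N * 1 \<le> N * int (w f)"
        using wpos[of f] that N B by (intro mult_left_mono) (auto simp: N_def sum_nonneg)
      moreover have "f \<in> A" using that B(2) by blast
      ultimately show ?thesis using N[of f] by (simp add: z_def)
    qed
    have z_out: "z f = y f" if "f \<notin> B" for f using wpos[of f] that by (simp add: z_def)
    have zA: "z f = 0" if "f \<notin> A" for f
    proof -
      have "f \<notin> B" using that B(2) by blast
      then show ?thesis using z_out[of f] upos[of f] x(2)[OF that] that by (simp add: y_def)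
    qed
    have "z f \<ge> 0" for f
      using zB[of f] zA[of f] z_out[of f] ratio[of f]
          by (cases "f \<in> A"; cases "f \<in> B") (auto simp: y_def)
    then have "(\<lambda>f. nat (z f)) \<in> circulations G" by (rule circulations_nat[OF z])
    then have "support (\<lambda>f. nat (z f)) \<in> supports" by (simp add: supports_def)
    \<comment> \<open>At \<open>e\<close> the circulation \<open>x\<close> is 0 while
      \<open>x g\<close> is negative, so \<open>z e\<close> is positive; at \<open>g\<close> it is
      0. The support of \<open>z\<close> is thus strictly between \<open>B\<close> and
      \<open>A\<close>.\<close>
    moreover have "B \<subset> support (\<lambda>f. nat (z f))"
    proof -
      have "z e > 0"
        using z_out[of e] \<open>e \<in> A - B\<close> x(3) \<open>x g < 0\<close> upos[of e] by (simp add: y_def mult_neg_pos)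
      then show ?thesis using zB \<open>e \<in> A - B\<close> by (auto simp: support_def)
    qed
    moreover have "support (\<lambda>f. nat (z f)) \<subset> A"
    proof -
      have "z g = 0" using z_out[of g] g(1) by (simp add: y_def)
      moreover have "support (\<lambda>f. nat (z f)) \<subseteq> A" using zA by (force simp: support_def)
      ultimately show ?thesis using g(1) by (auto simp: support_def)
    qed
    ultimately show False using maximal by blast
  qed
  assume f: "f \<notin> B"
  show "x f = 0"
  proof (cases "f \<in> A")
    case True
    have "(\<lambda>f. (- 1) * x f) \<in> circulations G" using x(1) by (rule circulations_mult)
    from nonneg[OF this] x(2,3) f True have "(- 1) * x f \<ge> 0" by auto
    moreover have "x f \<ge> 0" using nonneg[OF x] f True by auto
    ultimately show ?thesis by simp
  qed (rule x(2))
qed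

text \<open>\<open>T\<close> holds one test coordinate for each step of the chain; together they
  determine an integral circulation supported in \<open>A\<close>.\<close>

definition saturated_chain :: "'b set \<Rightarrow> nat \<Rightarrow> (nat \<Rightarrow> 'b set) \<Rightarrow> 'b set \<Rightarrow> bool" where
  "saturated_chain A k C T \<longleftrightarrow>
     C 0 = {} \<and> C k = A \<and> (\<forall>i<k. C i \<subset> C (Suc i) \<and> C (Suc i) \<in> supports) \<and>
     finite T \<and> card T = k \<and> T \<subseteq> A \<and>
     (\<forall>x::'b \<Rightarrow> int. x \<in> circulations G \<longrightarrow> (\<forall>f. f \<notin> A \<longrightarrow> x f = 0) \<longrightarrow> (\<forall>f\<in>T. x f = 0)
       \<longrightarrow> (\<forall>f. x f = 0))"

lemma saturated_chainD:
  assumes "saturated_chain A k C T"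
  shows "C 0 = {}" "C k = A" "\<And>i. i < k \<Longrightarrow> C i \<subset> C (Suc i)" "\<And>i. i < k \<Longrightarrow> C (Suc i) \<in> supports"
    "finite T" "card T = k" "T \<subseteq> A"
    "\<And>(x :: 'b \<Rightarrow> int) f. x \<in> circulations G \<Longrightarrow> (\<And>f. f \<notin> A \<Longrightarrow> x f = 0) \<Longrightarrow>
      (\<And>f. f \<in> T \<Longrightarrow> x f = 0) \<Longrightarrow> x f = 0"
  using assms unfolding saturated_chain_def by simp_all

text \<open>Below \<open>A\<close> take a maximal support \<open>B\<close> and any new coordinate
  \<open>e\<close> in \<open>A - B\<close>: a circulation within \<open>A\<close> that vanishes at
  \<open>e\<close> is confined to \<open>B\<close> by \<open>circulation_vanishing\<close>.\<close>

lemma saturated_chain_exists: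
  assumes "A \<in> supports"
  shows "\<exists>k C T. saturated_chain A k C T"
  using assms
proof (induction "card A" arbitrary: A rule: less_induct)
  case less
  have finA: "finite A" using finite_subset[OF supports_subset[OF less.prems] finite_arcs] .
  show ?case
  proof (cases "A = {}")
    case True
    then have "saturated_chain A 0 (\<lambda>_. {}) {}" by (simp add: saturated_chain_def)
    then show ?thesis by blast
  next
    case False
    have "{} \<in> supports"
      using circulations_0 unfolding supports_def
          by (intro image_eqI[of _ _ "\<lambda>_. 0"]) (auto simp: support_def)
    then have ne: "{D \<in> supports. D \<subset> A} \<noteq> {}" using False by blast
    have "finite {D \<in> supports. D \<subset> A}" using finite_supports by simp
    from finite_has_maximal[OF this ne] obtain B where B': "B \<in> {D \<in> supports. D \<subset> A}"
      and max: "\<forall>D\<in>{D \<in> supports. D \<subset> A}. B \<subseteq> D \<longrightarrow> B = D" by blast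
    from B' have B: "B \<in> supports" "B \<subset> A" by simp_all
    have "card B < card A" using B(2) finA by (rule psubset_card_mono[rotated])
    from less.hyps[OF this B(1)] obtain k C T where IH: "saturated_chain B k C T" by blast
    note IH = saturated_chainD[OF IH]
    obtain e where e: "e \<in> A - B" using B(2) by blast
    define C' where "C' = C(Suc k := A)"
    have zero: "x f = 0" if x: "x \<in> circulations G" "\<And>f. f \<notin> A \<Longrightarrow> x f = (0::int)"
      "\<And>f. f \<in> insert e T \<Longrightarrow> x f = 0" for x f
    proof (rule IH(8)[OF x(1)])
      show "x f = 0" if "f \<notin> B" for f
      proof (rule circulation_vanishing[OF less.prems B _ e x(1) x(2) _ that])
        show False if "D \<in> supports" "B \<subset> D" "D \<subset> A" for D using max that by blast
      qed (use x(3) in auto)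
    qed (use x(3) in auto)
    have "saturated_chain A (Suc k) C' (insert e T)"
      unfolding saturated_chain_def
    proof (intro conjI allI impI)
      show "C' i \<subset> C' (Suc i)" "C' (Suc i) \<in> supports" if "i < Suc k" for i
        using IH(2) IH(3,4)[of i] B less.prems that by (cases "i = k"; simp add: C'_def)+
      show "C' 0 = {}" "C' (Suc k) = A" using IH(1) by (simp_all add: C'_def)
      show "finite (insert e T)" using IH(5) by simp
      show "card (insert e T) = Suc k" "insert e T \<subseteq> A"
        using IH(5,6,7) e B(2) by (auto simp: card_insert_if)
    qed (use zero in blast)
    then show ?thesis by blast
  qed
qed

text \<open>The same \<open>k\<close> serves twice: the chain below the largest support yields
  \<open>k\<close> proper inclusions of primes, and the \<open>k\<close> test coordinates embed the
  circulations of size at most \<open>n\<close> into a cube with side \<open>n + 1\<close>.\<close>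

lemma krull_dim_iss_ring_growth:
  "\<exists>k. enat k \<le> krull_dim (iss_ring G :: ('b, 'k::field_char_0) mpoly ring) \<and>
     (\<forall>n. card (flows_upto n) \<le> (n + 1) ^ k)"
proof -
  have "supports \<noteq> {}" using circulations_0 by (auto simp: supports_def)
  from finite_has_maximal[OF finite_supports this] obtain A where A: "A \<in> supports"
    and max: "\<forall>D\<in>supports. A \<subseteq> D \<longrightarrow> A = D" by blast
  obtain u where u: "u \<in> circulations G" "support u = A" using A by (auto simp: supports_def)
  \<comment> \<open>Adding circulations unites their supports, so a maximal support contains all
    others.\<close>
  have le_A: "x f = 0" if x: "x \<in> circulations G" "f \<notin> A" for x :: "'b \<Rightarrow> nat" and f
  proof -
    have "support (\<lambda>e. x e + u e) \<in> supports"
      unfolding supports_def using circulations_add[OF x(1) u(1)] by blast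
    moreover have "support (\<lambda>e. x e + u e) = support x \<union> A" using u(2) by (auto simp: support_def)
    ultimately have "support x \<union> A = A" using max by auto
    then have "f \<notin> support x" using x(2) by blast
    then show ?thesis by (simp add: support_def)
  qed
  obtain k C T where chain: "saturated_chain A k C T" using saturated_chain_exists[OF A] by blast
  note C = saturated_chainD(1-4)[OF chain] and T = saturated_chainD(5-8)[OF chain]
  have "enat k \<le> krull_dim (iss_ring G :: ('b, 'k) mpoly ring)"
    unfolding iss_ring_eq_monoid_algebra
  proof (rule circulation_monoid.krull_dim_monoid_algebra_ge)
    show "C i \<subset> C (Suc i)" if "i < k" for i using C(3)[OF that] .
    show "\<exists>m\<in>{m :: 'b \<Rightarrow>\<^sub>0 nat. lookup m \<in> circulations G}. keys m = C (Suc i)" if i: "i < k" for i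
    proof -
      obtain x where x: "x \<in> circulations G" "support x = C (Suc i)"
        using C(4)[OF i] by (auto simp: supports_def)
      have "finite {e. x e \<noteq> 0}"
        using x(1) by (intro finite_subset[OF _ finite_arcs]) (auto simp: circulations_def)
      then have "lookup (Abs_poly_mapping x) = x" by simp
      then show ?thesis using x
          by (intro bexI[of _ "Abs_poly_mapping x"]) (auto simp: in_keys_iff support_def)
    qed
  qed
  moreover have "card (flows_upto n) \<le> (n + 1) ^ k" for n
  proof -
    have inj: "inj_on (\<lambda>x. restrict x T) (flows_upto n)"
    proof (rule inj_onI)
      fix x y assume xy: "x \<in> flows_upto n" "y \<in> flows_upto n" "restrict x T = restrict y T"
      then have x: "x \<in> circulations G" and y: "y \<in> circulations G" by (auto simp: flows_upto_def)
      define z where "z f = int (x f) + (- 1) * int (y f)" for f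
      have "z f = 0" for f
      proof (rule T(4))
        show "z \<in> circulations G"
          unfolding z_def by (intro circulations_add circulations_mult circulations_of_nat x y)
        show "z f = 0" if "f \<notin> A" for f using le_A[OF x that] le_A[OF y that] by (simp add: z_def)
        show "z f = 0" if "f \<in> T" for f
          using fun_cong[OF xy(3), of f] that by (simp add: z_def)
      qed
      then show "x = y" by (auto simp: z_def fun_eq_iff)
    qed
    have "(\<lambda>x. restrict x T) ` flows_upto n \<subseteq> (\<Pi>\<^sub>E f\<in>T. {..n})"
    proof (intro image_subsetI)
      fix x assume x: "x \<in> flows_upto n"
      have "x f \<le> n" if "f \<in> T" for f
        using member_le_sum[of f "arcs G" x] that T(3) supports_subset[OF A] x
        by (auto simp: flows_upto_def)
      then show "restrict x T \<in> (\<Pi>\<^sub>E f\<in>T. {..n})" by auto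
    qed
    then have "card (flows_upto n) \<le> card (\<Pi>\<^sub>E f\<in>T. {..n})"
      using T(1) by (intro card_inj_on_le[OF inj] finite_PiE) auto
    then show ?thesis using T(1,2) by (simp add: card_PiE)
  qed
  ultimately show ?thesis by blast
qed

text \<open>The constant \<open>K\<close> makes the criterion insensitive to replacing
  \<open>n\<close> by a multiple, and that is all that lifting along a contraction costs.\<close>

lemma krull_dim_iss_ring_le_iff:
  "krull_dim (iss_ring G :: ('b, 'k::field_char_0) mpoly ring) \<le> enat r \<longleftrightarrow>
     (\<exists>K. \<forall>n. card (flows_upto n) \<le> (K * (n + 1)) ^ r)"
proof
  assume le: "krull_dim (iss_ring G :: ('b, 'k) mpoly ring) \<le> enat r"
  obtain k where k: "enat k \<le> krull_dim (iss_ring G :: ('b, 'k) mpoly ring)"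
    "\<And>n. card (flows_upto n) \<le> (n + 1) ^ k"
    using krull_dim_iss_ring_growth by blast
  have "enat k \<le> enat r" using k(1) le by (rule order_trans)
  then have "k \<le> r" by simp
  then have "(n + 1) ^ k \<le> (n + 1) ^ r" for n :: nat by (intro power_increasing) auto
  then have "card (flows_upto n) \<le> (1 * (n + 1)) ^ r" for n using k(2)[of n] le_trans
      by (metis mult_1)
  then show "\<exists>K. \<forall>n. card (flows_upto n) \<le> (K * (n + 1)) ^ r" by blast
qed (use krull_dim_iss_ring_le in blast)

end

section \<open>Contracting an arc of a connected pair\<close>

text \<open>Up to the names of the arcs, gluing \<open>v\<^sub>1\<close> and \<open>v\<^sub>2\<close> is contracting the arc \<open>E\<close> from
  \<open>v\<^sub>1\<close> to \<open>v\<^sub>2\<close>; \<open>\<gamma>\<close> renames the arcs.\<close>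

locale contraction =
  fixes Q :: "('v, 'a) pre_digraph" and Q' :: "('w, 'c) pre_digraph"
    and \<gamma> :: "'c \<Rightarrow> 'a" and \<tau> :: "'v \<Rightarrow> 'w" and E F :: 'a and v1 v2 :: 'v
  assumes fin_Q: "fin_digraph Q" and fin_Q': "fin_digraph Q'"
    and E: "E \<in> arcs Q" "tail Q E = v1" "head Q E = v2"
    and F: "F \<in> arcs Q" "tail Q F = v2" "head Q F = v1"
    and v12: "v1 \<noteq> v2"
    and \<gamma>: "bij_betw \<gamma> (arcs Q') (arcs Q - {E})"
    and tail': "a \<in> arcs Q' \<Longrightarrow> tail Q' a = \<tau> (tail Q (\<gamma> a))"
    and head': "a \<in> arcs Q' \<Longrightarrow> head Q' a = \<tau> (head Q (\<gamma> a))"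
    and verts': "verts Q' = \<tau> ` verts Q"
    and \<tau>_eq_iff: "u \<in> verts Q \<Longrightarrow> v \<in> verts Q \<Longrightarrow>
      \<tau> u = \<tau> v \<longleftrightarrow> u = v \<or> u \<in> {v1, v2} \<and> v \<in> {v1, v2}"
begin

sublocale Q: fin_digraph Q by (rule fin_Q)
sublocale Q': fin_digraph Q' by (rule fin_Q')

lemma v1_vert: "v1 \<in> verts Q" and v2_vert: "v2 \<in> verts Q"
  using E Q.tail_in_verts Q.head_in_verts by auto

lemma \<gamma>_arcs: "a \<in> arcs Q' \<Longrightarrow> \<gamma> a \<in> arcs Q" "a \<in> arcs Q' \<Longrightarrow> \<gamma> a \<noteq> E"
  using \<gamma> by (auto simp: bij_betw_def)

section \<open>Conservation under contraction\<close>

lemma inflow_eq: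
  "inflow Q' (\<lambda>a. if a \<in> arcs Q' then x (\<gamma> a) else 0) w =
     (\<Sum>e\<in>arcs Q - {E}. if \<tau> (head Q e) = w then x e else 0)"
  and outflow_eq:
  "outflow Q' (\<lambda>a. if a \<in> arcs Q' then x (\<gamma> a) else 0) w =
     (\<Sum>e\<in>arcs Q - {E}. if \<tau> (tail Q e) = w then x e else 0)"
  unfolding inflow_def outflow_def
  by (subst sum.reindex_bij_betw[OF \<gamma>, symmetric], rule sum.cong, simp_all add: head' tail')+

text \<open>\<open>f\<close> stands for \<open>head Q\<close> or \<open>tail Q\<close>, so that
  inflow and outflow are treated at once.\<close>

lemma sum_end_outside:
  assumes "\<And>e. e \<in> arcs Q \<Longrightarrow> f e \<in> verts Q" "f E \<in> {v1, v2}" "v \<in> verts Q" "v \<notin> {v1, v2}"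
  shows "(\<Sum>e\<in>arcs Q - {E}. if \<tau> (f e) = \<tau> v then x e else 0) = (\<Sum>e\<in>arcs Q.
      if f e = v then x e else 0)"
  using assms \<tau>_eq_iff by (intro sum.mono_neutral_cong_left) auto

lemma sum_end_inside:
  fixes x :: "'a \<Rightarrow> nat"
  assumes "\<And>e. e \<in> arcs Q \<Longrightarrow> f e \<in> verts Q" "f E \<in> {v1, v2}"
  shows "(\<Sum>e\<in>arcs Q - {E}. if \<tau> (f e) = \<tau> v1 then x e else 0) + x E =
    (\<Sum>e\<in>arcs Q. if f e = v1 then x e else 0) + (\<Sum>e\<in>arcs Q. if f e = v2 then x e else 0)"
proof -
  have "(\<Sum>e\<in>arcs Q. if f e = v1 then x e else 0) + (\<Sum>e\<in>arcs Q. if f e = v2 then x e else 0) =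
      (\<Sum>e\<in>arcs Q. if f e \<in> {v1, v2} then x e else 0)"
    unfolding sum.distrib[symmetric] using v12 by (intro sum.cong) auto
  also have "\<dots> = (\<Sum>e\<in>arcs Q - {E}. if f e \<in> {v1, v2} then x e else 0) + x E"
    using assms(2) E(1) by (subst sum.remove[of _ E]) auto
  also have "(\<Sum>e\<in>arcs Q - {E}. if f e \<in> {v1, v2} then x e else 0) =
      (\<Sum>e\<in>arcs Q - {E}. if \<tau> (f e) = \<tau> v1 then x e else 0)"
    using assms(1) \<tau>_eq_iff[OF _ v1_vert] by (intro sum.cong refl) auto
  finally show ?thesis by simp
qed

lemma inflow_outside:
  "v \<in> verts Q \<Longrightarrow> v \<notin> {v1, v2} \<Longrightarrow>
    inflow Q' (\<lambda>a. if a \<in> arcs Q' then x (\<gamma> a) else 0) (\<tau> v) = inflow Q x v"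
  and outflow_outside:
  "v \<in> verts Q \<Longrightarrow> v \<notin> {v1, v2} \<Longrightarrow>
    outflow Q' (\<lambda>a. if a \<in> arcs Q' then x (\<gamma> a) else 0) (\<tau> v) = outflow Q x v"
  unfolding inflow_eq outflow_eq unfolding inflow_def outflow_def
  using E by (auto intro!: sum_end_outside)

text \<open>The contracted arc is lost once as an incoming and once as an outgoing arc, so
  \<open>x E\<close> cancels from the balance at the merged vertex.\<close>

lemma inflow_inside:
  "inflow Q' (\<lambda>a. if a \<in> arcs Q' then x (\<gamma> a) else 0) (\<tau> v1) + x E = inflow Q x v1 + inflow Q x v2"
  and outflow_inside:
  "outflow Q' (\<lambda>a. if a \<in> arcs Q' then x (\<gamma> a) else 0) (\<tau> v1) + x E = outflow Q x v1 + outflow Q x v2"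
  for x :: "'a \<Rightarrow> nat"
  unfolding inflow_eq outflow_eq unfolding inflow_def outflow_def
  by (rule sum_end_inside, simp_all add: E)+

lemma contract_circulation:
  fixes x :: "'a \<Rightarrow> nat"
  assumes "x \<in> circulations Q"
  shows "(\<lambda>a. if a \<in> arcs Q' then x (\<gamma> a) else 0) \<in> circulations Q'"
proof -
  let ?y = "\<lambda>a. if a \<in> arcs Q' then x (\<gamma> a) else 0"
  have bal: "inflow Q x v = outflow Q x v" if "v \<in> verts Q" for v
    using assms that by (simp add: circulations_def)
  have "inflow Q' ?y (\<tau> v) = outflow Q' ?y (\<tau> v)" if v: "v \<in> verts Q" for v
  proof (cases "v \<in> {v1, v2}")
    case True
    then have "\<tau> v = \<tau> v1" using v v1_vert \<tau>_eq_iff by auto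
    then show ?thesis
      using inflow_inside[of x] outflow_inside[of x] bal[OF v1_vert] bal[OF v2_vert] by simp
  qed (use v bal in \<open>simp add: inflow_outside outflow_outside\<close>)
  then show ?thesis by (auto simp: circulations_def verts')
qed

lemma
  fixes x :: "'a \<Rightarrow> nat"
  shows outflow_v1: "outflow Q x v1 = x E + outflow Q (x(E := 0)) v1"
    and inflow_v1: "inflow Q (x(E := k)) v1 = inflow Q x v1"
proof -
  have "(\<Sum>e\<in>arcs Q - {E}. if tail Q e = v1 then x e else 0) =
      (\<Sum>e\<in>arcs Q - {E}. if tail Q e = v1 then (x(E := 0)) e else 0)"
    by (intro sum.cong) auto
  then show "outflow Q x v1 = x E + outflow Q (x(E := 0)) v1"
    using E by (simp add: outflow_def sum.remove[of _ E])
  show "inflow Q (x(E := k)) v1 = inflow Q x v1"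
    unfolding inflow_def using E v12 by (intro sum.cong) auto
qed

lemma contract_inj:
  fixes x y :: "'a \<Rightarrow> nat"
  assumes x: "x \<in> circulations Q" and y: "y \<in> circulations Q" and eq: "\<And>e. e \<in> arcs Q - {E} \<Longrightarrow>
      x e = y e"
  shows "x = y"
proof -
  have "x e = y e" if "e \<noteq> E" for e
    using x y eq[of e] that by (cases "e \<in> arcs Q") (auto simp: circulations_def)
  then have off: "x(E := 0) = y(E := 0)" by auto
  have bal: "inflow Q z v1 = z E + outflow Q (z(E := 0)) v1"
      if "z \<in> circulations Q" for z :: "'a \<Rightarrow> nat"
    using that v1_vert outflow_v1[of z] by (simp add: circulations_def)
  have "inflow Q x v1 = inflow Q y v1" using off inflow_v1 by metis
  then have "x E = y E" using bal[OF x] bal[OF y] off by simp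
  then show ?thesis using off by (metis fun_upd_triv fun_upd_upd)
qed

lemma sum_contract:
  "(\<Sum>a\<in>arcs Q'. if a \<in> arcs Q' then x (\<gamma> a) else 0) = sum x (arcs Q - {E})"
  using sum.reindex_bij_betw[OF \<gamma>, of x] by simp

section \<open>Comparison of growth and dimension\<close>

lemma card_flows_upto_le: "card (Q.flows_upto n) \<le> card (Q'.flows_upto n)"
proof (rule card_inj_on_le)
  let ?c = "\<lambda>x a. if a \<in> arcs Q' then x (\<gamma> a) else (0::nat)"
  show "inj_on ?c (Q.flows_upto n)"
  proof (rule inj_onI)
    fix x y assume x: "x \<in> Q.flows_upto n" and y: "y \<in> Q.flows_upto n" and eq: "?c x = ?c y"
    show "x = y"
    proof (rule contract_inj)
      show "x e = y e" if e: "e \<in> arcs Q - {E}" for e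
      proof -
        obtain a where "a \<in> arcs Q'" "e = \<gamma> a" using e \<gamma> by (auto simp: bij_betw_def)
        then show ?thesis using fun_cong[OF eq, of a] by simp
      qed
    qed (use x y in \<open>simp_all add: Q.flows_upto_def\<close>)
  qed
  show "?c ` Q.flows_upto n \<subseteq> Q'.flows_upto n"
  proof (intro image_subsetI)
    fix x assume x: "x \<in> Q.flows_upto n"
    have "sum x (arcs Q - {E}) \<le> sum x (arcs Q)" by (intro sum_mono2) auto
    then show "?c x \<in> Q'.flows_upto n"
      using x contract_circulation[of x] sum_contract[of x]
          by (simp add: Q.flows_upto_def Q'.flows_upto_def)
  qed
qed (rule Q'.finite_flows_upto)

text \<open>A circulation on the contracted quiver lifts to one on \<open>Q\<close> after adding a large multiple
  of the 2-cycle through \<open>E\<close> and \<open>F\<close>.\<close>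

definition lift0 :: "nat \<Rightarrow> ('c \<Rightarrow> nat) \<Rightarrow> 'a \<Rightarrow> nat" where
  "lift0 n y e = (if e \<in> arcs Q - {E} then y (the_inv_into (arcs Q') \<gamma> e) + (if e =
      F then n else 0) else 0)"

definition lift :: "nat \<Rightarrow> ('c \<Rightarrow> nat) \<Rightarrow> 'a \<Rightarrow> nat" where
  "lift n y = (lift0 n y)(E := inflow Q (lift0 n y) v1 - outflow Q (lift0 n y) v1)"

lemma F_neq_E: "F \<noteq> E"
  using E F v12 by auto

lemma lift0_\<gamma>: "a \<in> arcs Q' \<Longrightarrow> lift0 n y (\<gamma> a) = y a + (if \<gamma> a = F then n else 0)"
  using \<gamma> \<gamma>_arcs by (simp add: lift0_def the_inv_into_f_f bij_betw_def)

text \<open>The factor 4: the arcs other than \<open>E\<close> carry at most \<open>n\<close> from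
  \<open>y\<close> and \<open>n\<close> added on \<open>F\<close>, and \<open>E\<close> carries at
  most the inflow at \<open>v1\<close>, which is bounded by these \<open>2 * n\<close>.\<close>

lemma lift_circulation:
  assumes y: "y \<in> Q'.flows_upto n"
  shows "lift n y \<in> Q.flows_upto (4 * n)"
proof -
  define x where "x = lift0 n y"
  define z where "z e = (if e = F then n else 0)" for e
  have y': "y \<in> circulations Q'" "sum y (arcs Q') \<le> n" using y by (auto simp: Q'.flows_upto_def)
  have contract_x: "(\<lambda>a. if a \<in> arcs Q' then x (\<gamma> a) else 0) =
      (\<lambda>a. y a + (if a \<in> arcs Q' then z (\<gamma> a) else 0))"
    using y'(1) by (auto simp: x_def z_def lift0_\<gamma> circulations_def)
  have xE: "x E = 0" by (simp add: x_def lift0_def)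
  have zE: "z E = 0" using F_neq_E by (simp add: z_def)
  have z: "inflow Q z v = (if v = v1 then n else 0)" "outflow Q z v = (if v = v2 then n else 0)" for v
  proof -
    have "inflow Q z v = (\<Sum>e\<in>{F}. if head Q e = v then z e else 0)"
      unfolding inflow_def using F by (intro sum.mono_neutral_right) (auto simp: z_def)
    then show "inflow Q z v = (if v = v1 then n else 0)" using F by (simp add: z_def)
    have "outflow Q z v = (\<Sum>e\<in>{F}. if tail Q e = v then z e else 0)"
      unfolding outflow_def using F by (intro sum.mono_neutral_right) (auto simp: z_def)
    then show "outflow Q z v = (if v = v2 then n else 0)" using F by (simp add: z_def)
  qed
  have bal_y: "inflow Q' y (\<tau> v) = outflow Q' y (\<tau> v)" if "v \<in> verts Q" for v
    using y'(1) that by (auto simp: circulations_def verts')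
  have outside: "inflow Q x v = outflow Q x v" if v: "v \<in> verts Q" "v \<notin> {v1, v2}" for v
  proof -
    have "inflow Q x v = inflow Q' y (\<tau> v) + inflow Q z v"
      using inflow_outside[OF v, of x] inflow_outside[OF v, of z]
          unfolding contract_x inflow_add by simp
    moreover have "outflow Q x v = outflow Q' y (\<tau> v) + outflow Q z v"
      using outflow_outside[OF v, of x] outflow_outside[OF v, of z]
          unfolding contract_x outflow_add by simp
    ultimately show ?thesis using bal_y[OF v(1)] v(2) z[of v] by auto
  qed
  have inside: "inflow Q x v1 + inflow Q x v2 = outflow Q x v1 + outflow Q x v2"
    using inflow_inside[of x] outflow_inside[of x] inflow_inside[of z] outflow_inside[of z]
      bal_y[OF v1_vert] z[of v1] z[of v2] v12 xE zE
    unfolding contract_x inflow_add outflow_add by simp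
  have sum_x: "sum x (arcs Q) \<le> 2 * n"
  proof -
    have "sum x (arcs Q) = sum x (arcs Q - {E})" using E xE by (simp add: sum.remove[of _ E])
    also have "\<dots> = (\<Sum>a\<in>arcs Q'. y a + (if a \<in> arcs Q' then z (\<gamma> a) else 0))"
      using sum_contract[of x] unfolding contract_x by simp
    also have "\<dots> = sum y (arcs Q') + sum z (arcs Q - {E})"
      using sum_contract[of z] by (simp add: sum.distrib)
    also have "sum z (arcs Q - {E}) = n" using F F_neq_E by (simp add: z_def)
    finally show ?thesis using y'(2) by simp
  qed
  have in_le: "inflow Q x v1 \<le> 2 * n"
  proof -
    have "inflow Q x v1 \<le> sum x (arcs Q)" unfolding inflow_def by (intro sum_mono) simp
    then show ?thesis using sum_x by linarith
  qed
  \<comment> \<open>So the subtraction in \<open>lift\<close> is not truncated: \<open>F\<close>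
    alone brings at least \<open>n\<close> into \<open>v1\<close>, while all arcs other than
    \<open>F\<close> together carry at most \<open>n\<close>.\<close>
  have "outflow Q x v1 \<le> inflow Q x v1"
  proof -
    have "outflow Q x v1 \<le> sum x (arcs Q - {F})"
      unfolding outflow_def using F v12 by (simp add: sum.remove[of _ F] sum_mono)
    moreover have "x F \<ge> n" using F F_neq_E by (simp add: x_def lift0_def)
    moreover have "sum x (arcs Q) = x F + sum x (arcs Q - {F})" using F
        by (simp add: sum.remove[of _ F])
    moreover have "x F \<le> inflow Q x v1"
      using F member_le_sum[of F "arcs Q" "\<lambda>e. if head Q e = v1 then x e else 0"]
          by (simp add: inflow_def)
    ultimately show ?thesis using sum_x by linarith
  qed
  define k where "k = inflow Q x v1 - outflow Q x v1"
  have k: "inflow Q x v1 = outflow Q x v1 + k" using \<open>outflow Q x v1 \<le> inflow Q x v1\<close>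
      by (simp add: k_def)
  have l: "lift n y = x(E := k)" by (simp add: lift_def x_def k_def)
  have split: "x(E := k) = (\<lambda>e. x e + (if e = E then k else 0))" using xE by auto
  have kE: "inflow Q (\<lambda>e. if e = E then k else 0) v = (if v = v2 then k else 0)"
    "outflow Q (\<lambda>e. if e = E then k else 0) v = (if v = v1 then k else 0)" for v
  proof -
    have "inflow Q (\<lambda>e. if e = E then k else 0) v = (\<Sum>e\<in>{E}. if head Q e = v then k else 0)"
      unfolding inflow_def using E by (intro sum.mono_neutral_cong_right) auto
    then show "inflow Q (\<lambda>e. if e = E then k else 0) v = (if v = v2 then k else 0)" using E by simp
    have "outflow Q (\<lambda>e. if e = E then k else 0) v = (\<Sum>e\<in>{E}. if tail Q e = v then k else 0)"
      unfolding outflow_def using E by (intro sum.mono_neutral_cong_right) auto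
    then show "outflow Q (\<lambda>e. if e = E then k else 0) v = (if v = v1 then k else 0)" using E by simp
  qed
  have "inflow Q (x(E := k)) v = outflow Q (x(E := k)) v" if "v \<in> verts Q" for v
    unfolding split inflow_add outflow_add kE
    using k inside outside[OF that] v12 by (cases "v = v1"; cases "v = v2") auto
  moreover have "(x(E := k)) e = 0" if "e \<notin> arcs Q" for e
    using that E by (auto simp: x_def lift0_def)
  moreover have "sum (x(E := k)) (arcs Q) \<le> 4 * n"
  proof -
    have "sum (x(E := k)) (arcs Q) = sum x (arcs Q) + k"
      unfolding split using E by (simp add: sum.distrib)
    then show ?thesis using sum_x in_le by (simp add: k_def)
  qed
  ultimately show ?thesis unfolding l by (simp add: Q.flows_upto_def circulations_def)
qed

lemma card_flows_upto_ge: "card (Q'.flows_upto n) \<le> card (Q.flows_upto (4 * n))"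
proof (rule card_inj_on_le)
  show "inj_on (lift n) (Q'.flows_upto n)"
  proof (rule inj_onI, rule ext)
    fix y z a assume y: "y \<in> Q'.flows_upto n" and z: "z \<in> Q'.flows_upto n" and eq: "lift n y =
        lift n z"
    show "y a = z a"
    proof (cases "a \<in> arcs Q'")
      case True
      then show ?thesis
        using fun_cong[OF eq, of "\<gamma> a"] \<gamma>_arcs(2)[OF True] by (simp add: lift_def lift0_\<gamma>)
    qed (use y z in \<open>simp add: Q'.flows_upto_def circulations_def\<close>)
  qed
qed (use lift_circulation Q.finite_flows_upto in auto)

lemma krull_dim_contraction:
  "krull_dim (iss_ring Q' :: ('c, 'k::field_char_0) mpoly ring) =
     krull_dim (iss_ring Q :: ('a, 'k) mpoly ring)"
proof -
  have "krull_dim (iss_ring Q' :: ('c, 'k) mpoly ring) \<le> enat r \<longleftrightarrow>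
      krull_dim (iss_ring Q :: ('a, 'k) mpoly ring) \<le> enat r" for r
    unfolding Q.krull_dim_iss_ring_le_iff Q'.krull_dim_iss_ring_le_iff
  proof
    assume "\<exists>K. \<forall>n. card (Q'.flows_upto n) \<le> (K * (n + 1)) ^ r"
    then show "\<exists>K. \<forall>n. card (Q.flows_upto n) \<le> (K * (n + 1)) ^ r"
      using card_flows_upto_le le_trans by blast
  next
    assume "\<exists>K. \<forall>n. card (Q.flows_upto n) \<le> (K * (n + 1)) ^ r"
    then obtain K where K: "\<And>n. card (Q.flows_upto n) \<le> (K * (n + 1)) ^ r" by blast
    have "card (Q'.flows_upto n) \<le> ((4 * K) * (n + 1)) ^ r" for n
    proof -
      have "(K * (4 * n + 1)) ^ r \<le> ((4 * K) * (n + 1)) ^ r"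
          by (intro power_mono) (simp_all add: algebra_simps)
      then show ?thesis using card_flows_upto_ge[of n] K[of "4 * n"] by linarith
    qed
    then show "\<exists>K. \<forall>n. card (Q'.flows_upto n) \<le> (K * (n + 1)) ^ r" by blast
  qed
  then show ?thesis by (metis enat_ord_code(3) linorder_linear not_infinity_eq order_antisym)
qed

end

section \<open>Cycles\<close>

context wf_digraph
begin

declare cas_append_iff [simp del]

lemma awalk_verts_cas: "cas u p v \<Longrightarrow> awalk_verts u p = map (tail G) p @ [v]"
  by (induction p arbitrary: u) simp_all

lemma cas_append: "cas u (p @ q) v \<longleftrightarrow> (\<exists>w. cas u p w \<and> cas w q v)"
  by (induction p arbitrary: u) auto

lemma apath_iff:
  "apath u p v \<longleftrightarrow> u \<in> verts G \<and> set p \<subseteq> arcs G \<and> cas u p v \<and> distinct (map (tail G) p @ [v])"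
  unfolding apath_def awalk_def by (metis awalk_verts_cas)

text \<open>Listing tails of arcs treats loops and longer cycles alike and turns rotations of the
  cycle into rotations of the list.\<close>

lemma cycle_iff:
  "cycle p \<longleftrightarrow> p \<noteq> [] \<and> set p \<subseteq> arcs G \<and> cas (tail G (hd p)) p (tail G (hd p)) \<and>
      distinct (map (tail G) p)"
proof
  have tl: "tl (awalk_verts u p) = map (tail G) (tl p) @ [u]" if "cas u p u" "p \<noteq> []" for u
    unfolding awalk_verts_cas[OF that(1)] using that(2) by (cases p) simp_all
  have hd: "tail G (hd p) = u" if "cas u p u" "p \<noteq> []" for u
    using that by (cases p) simp_all
  have dist: "distinct (map (tail G) (tl p) @ [tail G (hd p)]) \<longleftrightarrow> distinct (map (tail G) p)"
    if "p \<noteq> []"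
    using that by (cases p) auto
  {
    assume "cycle p"
    then obtain u where "awalk u p u" "distinct (tl (awalk_verts u p))" "p \<noteq> []"
      unfolding cycle_def by blast
    then show "p \<noteq> [] \<and> set p \<subseteq> arcs G \<and> cas (tail G (hd p)) p (tail G (hd p)) \<and>
        distinct (map (tail G) p)"
      using tl[of u] hd[of u] dist unfolding awalk_def by metis
  }
  assume p: "p \<noteq> [] \<and> set p \<subseteq> arcs G \<and> cas (tail G (hd p)) p (tail G (hd p)) \<and>
        distinct (map (tail G) p)"
  then have "tail G (hd p) \<in> verts G" by (meson hd_in_set subsetD tail_in_verts)
  then show "cycle p"
    unfolding cycle_def awalk_def using p tl[of "tail G (hd p)"] dist by metis
qed

lemma set_heads_cycle:
  assumes "cas u p u"
  shows "head G ` set p = tail G ` set p"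
proof -
  have "insert u (head G ` set p) = insert v (tail G ` set p)" if "cas u p v" for u v p
    using that by (induction p arbitrary: u) auto
  then have "insert u (head G ` set p) = insert u (tail G ` set p)" using assms by blast
  moreover have "p \<noteq> [] \<Longrightarrow> u \<in> tail G ` set p" using assms by (cases p) auto
  moreover have "p \<noteq> [] \<Longrightarrow> u \<in> head G ` set p"
  proof -
    have "p \<noteq> [] \<Longrightarrow> cas u p v \<Longrightarrow> v \<in> head G ` set p" for u v
      by (induction p arbitrary: u) (auto, metis cas.simps(1) image_iff)
    then show "p \<noteq> [] \<Longrightarrow> u \<in> head G ` set p" using assms by blast
  qed
  ultimately show ?thesis by (cases "p = []") auto
qed

lemma cycle_append_commute:
  assumes "cycle (p @ q)"
  shows "cycle (q @ p)"
proof (cases "p = [] \<or> q = []")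
  case False
  from assms obtain w where w: "cas (tail G (hd p)) p w" "cas w q (tail G (hd p))"
    using False by (auto simp: cycle_iff cas_append)
  then have "w = tail G (hd q)" using False by (cases q) auto
  then show ?thesis using assms w False by (auto simp: cycle_iff cas_append)
qed (use assms in auto)

lemma cycle_rotate: "cycle p \<Longrightarrow> cycle (rotate n p)"
  using cycle_append_commute[of "take (n mod length p) p" "drop (n mod length p) p"]
  by (simp add: rotate_drop_take)

text \<open>At most one arc of \<open>S\<close> leaves each vertex, so a walk inside
  \<open>S\<close> never has a choice.\<close>

lemma cas_unique:
  assumes "cas u p v" "cas u q w" "length p = length q" "inj_on (tail G) S" "set p \<subseteq> S" "set q \<subseteq> S"
  shows "p = q"
  using assms
proof (induction p arbitrary: q u)
  case (Cons e p)
  then obtain f q' where q: "q = f # q'" by (cases q) auto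
  have "e = f" using Cons.prems by (auto simp: q dest: inj_onD)
  then show ?case using Cons.IH[of "head G e" q'] Cons.prems by (auto simp: q)
qed simp

lemma rotate_to_arc:
  assumes "cycle p" "e \<in> set p"
  obtains n where "hd (rotate n p) = e"
proof -
  obtain n where "n < length p" "p ! n = e" using assms(2) by (metis in_set_conv_nth)
  then have "hd (rotate n p) = e" using assms(2) by (subst hd_rotate_conv_nth) auto
  then show ?thesis by (rule that)
qed

text \<open>Rotated to a common first arc, both cycles are walks of equal length in a set of arcs
  with distinct tails. So a primitive cycle may be replaced by its set of arcs.\<close>

lemma cycle_eq_rotate:
  assumes "cycle p" "cycle q" "set p = set q"
  shows "\<exists>n. q = rotate n p"
proof -
  have "q \<noteq> []" using assms(2) by (simp add: cycle_iff)
  then obtain n where n: "hd (rotate n p) = hd q"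
    using rotate_to_arc[OF assms(1), of "hd q"] assms(3) by auto
  have "cycle (rotate n p)" using assms(1) by (rule cycle_rotate)
  then have r: "cas (tail G (hd q)) (rotate n p) (tail G (hd q))" "distinct (map (tail G) p)"
    using n assms(1) by (auto simp: cycle_iff)
  have q: "cas (tail G (hd q)) q (tail G (hd q))" "distinct (map (tail G) q)"
    using assms(2) by (auto simp: cycle_iff)
  have "length p = card (set p)" "length q = card (set q)"
    using r(2) q(2) by (simp_all add: distinct_card distinct_map)
  then have "rotate n p = q"
    using r q assms(3) by (intro cas_unique[OF r(1) q(1), where S =
        "set q"]) (auto simp: distinct_map)
  then show ?thesis by blast
qed

section \<open>Primitive cycles as sets of arcs\<close>

definition cycle_sets :: "'b set set" where
  "cycle_sets = {set p | p. cycle p}"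

lemma finite_nonempty_cycle_set: "C \<in> cycle_sets \<Longrightarrow> finite C \<and> C \<noteq> {} \<and> C \<subseteq> arcs G"
  by (auto simp: cycle_sets_def cycle_iff)

definition arc_set :: "'b list set \<Rightarrow> 'b set" where
  "arc_set c = \<Union>(set ` c)"

lemma arc_set_rotations: "arc_set {rotate n p | n. True} = set p"
  by (auto simp: arc_set_def)

lemma arc_set_primitive_cycles: "arc_set ` primitive_cycles G = cycle_sets"
proof -
  have P: "primitive_cycles G = (\<lambda>p. {rotate n p | n. True}) ` {p. cycle p}"
    unfolding primitive_cycles_def by blast
  have "arc_set ` primitive_cycles G = set ` {p. cycle p}"
    unfolding P image_image arc_set_rotations ..
  then show ?thesis unfolding cycle_sets_def by blast
qed

lemma rotations_rotate: "{rotate n (rotate k p) | n. True} = {rotate n p | n. True}"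
    for p :: "'x list"
proof (cases "p = []")
  case False
  have "rotate n p \<in> {rotate n (rotate k p) | n. True}" for n
  proof -
    \<comment> \<open>Rotating by \<open>k * length p - k\<close> undoes the rotation by
      \<open>k\<close>; this bound keeps the subtraction from being truncated.\<close>
    have "k \<le> k * length p" using False by (cases p) auto
    then have "n + (k * length p - k) + k = n + k * length p" by linarith
    then have "rotate (n + (k * length p - k)) (rotate k p) = rotate (n + k * length p) p"
      by (simp only: rotate_rotate)
    also have "\<dots> = rotate n p" by (metis mod_mult_self1 mult.commute rotate_conv_mod)
    finally show ?thesis by (intro CollectI exI[of _ "n + (k * length p - k)"]) simp
  qed
  then show ?thesis by (auto simp: rotate_rotate)
qed simp

lemma inj_on_arc_set: "inj_on arc_set (primitive_cycles G)"
proof (rule inj_onI)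
  fix c d assume "c \<in> primitive_cycles G" "d \<in> primitive_cycles G" and eq: "arc_set c = arc_set d"
  then obtain p q where p: "cycle p" "c = {rotate n p | n. True}" and q: "cycle q"
      "d = {rotate n q | n. True}"
    by (auto simp: primitive_cycles_def)
  have "set p = set q" using eq unfolding p(2) q(2) arc_set_rotations .
  then obtain k where "q = rotate k p" using cycle_eq_rotate[OF p(1) q(1)] by blast
  then show "c = d" unfolding p(2) q(2) by (simp only: rotations_rotate)
qed

text \<open>The two terms cancel for loops, so conservation at \<open>v\<close> says that the sum
  over the arcs vanishes.\<close>

definition net :: "'a \<Rightarrow> 'b \<Rightarrow> int" where
  "net v e = of_bool (tail G e = v) - of_bool (head G e = v)"

lemma sum_net_cas:
  assumes "cas a p b" "distinct (map (tail G) p)"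
  shows "sum (net v) (set p) = of_bool (a = v) - of_bool (b = v)"
proof -
  have "sum_list (map (net v) p) = of_bool (a = v) - of_bool (b = v)" if "cas a p b" for a p
    using that by (induction p arbitrary: a) (auto simp: net_def)
  then show ?thesis using assms by (simp add: distinct_map sum.distinct_set_conv_list)
qed

lemma sum_net_cycle_set: "C \<in> cycle_sets \<Longrightarrow> sum (net v) C = 0"
  by (auto simp: cycle_sets_def cycle_iff sum_net_cas)

lemma head_in_tails_cycle_set:
  assumes "C \<in> cycle_sets" "e \<in> C"
  shows "head G e \<in> tail G ` C"
proof -
  obtain p where "cycle p" "C = set p" using assms(1) by (auto simp: cycle_sets_def)
  then have "head G ` C = tail G ` C"
    using set_heads_cycle[of "tail G (hd p)" p] by (simp add: cycle_iff)
  then show ?thesis using assms(2) by blast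
qed

section \<open>Paths between two vertices and decomposition of closed walks\<close>

lemma cycle_set_through_two:
  assumes "C \<in> cycle_sets" "u \<in> tail G ` C" "v \<in> tail G ` C" "u \<noteq> v"
  shows "\<exists>p q. apath u p v \<and> apath v q u \<and> C = set p \<union> set q \<and> distinct (map (tail G) (p @ q))"
proof -
  obtain p0 where p0: "cycle p0" "C = set p0" using assms(1) by (auto simp: cycle_sets_def)
  obtain e where e: "e \<in> set p0" "tail G e = u" using assms(2) p0 by auto
  obtain n where n: "hd (rotate n p0) = e" using rotate_to_arc[OF p0(1) e(1)] .
  define c where "c = rotate n p0"
  have c: "cycle c" "set c = C" "tail G (hd c) = u"
    using cycle_rotate[OF p0(1)] p0(2) n e(2) by (simp_all add: c_def)
  obtain f where f: "f \<in> set c" "tail G f = v" using assms(3) c(2) by auto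
  obtain p q where pq: "c = p @ f # q" using f(1) by (metis split_list)
  have cas: "cas u c u" and dist: "distinct (map (tail G) c)" and arcs: "set c \<subseteq> arcs G"
    using c by (auto simp: cycle_iff)
  have "cas u p v" "cas v (f # q) u" using cas f(2) by (auto simp: pq cas_append)
  moreover have "p \<noteq> []"
    using c(3) f(2) assms(4) by (auto simp: pq)
  moreover have "u \<in> tail G ` set p" using \<open>cas u p v\<close> \<open>p \<noteq> []\<close> by (cases p) auto
  moreover have "u \<in> verts G" "v \<in> verts G"
    using arcs f \<open>u \<in> tail G ` set p\<close> by (auto simp: pq)
  ultimately have "apath u p v" "apath v (f # q) u"
    using dist arcs f(2) by (auto simp: apath_iff pq)
  moreover have "C = set p \<union> set (f # q)" using c(2) by (auto simp: pq)
  ultimately show ?thesis using dist unfolding pq by blast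
qed

lemma cycle_set_of_paths:
  assumes "apath u p v" "apath v q u" "u \<noteq> v" "distinct (map (tail G) (p @ q))"
  shows "set p \<union> set q \<in> cycle_sets" "u \<in> tail G ` (set p \<union> set q)" "v \<in> tail G ` (set p \<union> set q)"
proof -
  have p: "cas u p v" "set p \<subseteq> arcs G" and q: "cas v q u" "set q \<subseteq> arcs G"
    using assms(1,2) by (auto simp: apath_iff)
  have "p \<noteq> []" "q \<noteq> []" using p q assms(3) by auto
  then have u: "u = tail G (hd p)" and v: "v = tail G (hd q)" using p q by (cases p; cases q; auto)+
  have "cycle (p @ q)"
    using p q assms(4) \<open>p \<noteq> []\<close> u by (auto simp: cycle_iff cas_append)
  then show "set p \<union> set q \<in> cycle_sets" unfolding cycle_sets_def
      by (metis (mono_tags) mem_Collect_eq set_append)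
  show "u \<in> tail G ` (set p \<union> set q)" "v \<in> tail G ` (set p \<union> set q)"
    using u v \<open>p \<noteq> []\<close> \<open>q \<noteq> []\<close> by auto
qed

text \<open>Vertices do not repeat, so nothing precedes an arc leaving \<open>u\<close> and nothing
  follows an arc entering \<open>v\<close>.\<close>

lemma apath_arc:
  assumes "apath u p v" "e \<in> set p" "tail G e = u" "head G e = v"
  shows "p = [e]"
proof -
  obtain p1 p2 where p: "p = p1 @ e # p2" using assms(2) by (metis split_list)
  have cas: "cas u p v" and dist: "distinct (map (tail G) p @ [v])"
    using assms(1) by (auto simp: apath_iff)
  have "p1 = []"
  proof (cases p1)
    case (Cons f r)
    then show ?thesis using cas dist assms(3) by (auto simp: p)
  qed simp
  moreover have "p2 = []"
  proof (cases p2)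
    case (Cons f r)
    then show ?thesis using cas dist assms(4) by (auto simp: p cas_append)
  qed simp
  ultimately show ?thesis by (simp add: p)
qed

lemma apath_single:
  assumes "e \<in> arcs G" "tail G e \<noteq> head G e"
  shows "apath (tail G e) [e] (head G e)"
  using assms by (simp add: apath_iff)

lemma start_notin_apath: "apath u p v \<Longrightarrow> e \<in> set p \<Longrightarrow> tail G e \<noteq> v"
  by (auto simp: apath_iff)

text \<open>Between two visits of the same vertex a closed walk is cut out, and both pieces are
  shorter. The bound by \<open>set p\<close> makes it possible to control which vertices the cycles
  meet.\<close>

lemma closed_walk_decomposition:
  assumes "cas u p u" "p \<noteq> []" "set p \<subseteq> arcs G"
  shows "\<exists>t. keys t \<subseteq> {C \<in> cycle_sets. C \<subseteq> set p} \<and> t \<noteq> 0 \<and> (\<forall>e. cover t e = count_list p e)"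
  using assms
proof (induction "length p" arbitrary: p u rule: less_induct)
  case less
  have hd: "tail G (hd p) = u" using less.prems by (cases p) auto
  show ?case
  proof (cases "distinct (map (tail G) p)")
    case True
    then have "set p \<in> cycle_sets" using less.prems hd by (auto simp: cycle_sets_def cycle_iff)
    moreover have "cover (single (set p) 1) e = count_list p e" for e
    proof -
      have "count_list q e = of_bool (e \<in> set q)" if "distinct q" for q
        using that by (induction q) auto
      moreover have "distinct p" using True by (simp add: distinct_map)
      ultimately show ?thesis by simp
    qed
    moreover have "single (set p) (1::nat) \<noteq> 0" by (metis lookup_single_eq lookup_zero zero_neq_one)
    ultimately show ?thesis by (intro exI[of _ "single (set p) 1"]) auto
  next
    case False
    then obtain v xs ys zs where "map (tail G) p = xs @ [v] @ ys @ [v] @ zs"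
      by (metis not_distinct_decomp)
    then obtain a r where 1: "p = a @ r" "map (tail G) r = [v] @ ys @ [v] @ zs"
      by (auto simp: map_eq_append_conv)
    then obtain e r1 where 2: "r = e # r1" "tail G e = v" "map (tail G) r1 = ys @ [v] @ zs"
      by (auto simp: map_eq_Cons_conv)
    then obtain b r2 where 3: "r1 = b @ r2" "map (tail G) r2 = [v] @ zs"
      by (auto simp: map_eq_append_conv)
    then obtain f c where "r2 = f # c" "tail G f = v"
      by (auto simp: map_eq_Cons_conv)
    with 1 2 3 have p: "p = a @ (e # b) @ (f # c)" "tail G e = v" "tail G f = v" by simp_all
    have cas: "cas u a v" "cas v (e # b) v" "cas v (f # c) u"
      using less.prems(1) p(2,3) unfolding p(1) cas_append by auto
    have "cas u (a @ f # c) u" using cas unfolding cas_append by blast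
    moreover have "length (a @ f # c) < length p" "length (e # b) < length p" by (simp_all add: p(1))
    moreover have "set (a @ f # c) \<subseteq> arcs G" "set (e # b) \<subseteq> arcs G"
      using less.prems(3) by (auto simp: p(1))
    ultimately obtain t1 t2 where
      t1: "keys t1 \<subseteq> {C \<in> cycle_sets. C \<subseteq> set (a @ f # c)}" "t1 \<noteq> 0"
          "\<forall>g. cover t1 g = count_list (a @ f # c) g"
      and t2: "keys t2 \<subseteq> {C \<in> cycle_sets. C \<subseteq> set (e # b)}" "t2 \<noteq> 0"
          "\<forall>g. cover t2 g = count_list (e # b) g"
      using less.hyps[of "a @ f # c" u] less.hyps[of "e # b" v] cas(2) by blast
    have "keys (t1 + t2) \<subseteq> {C \<in> cycle_sets. C \<subseteq> set p}"
      using keys_add[of t1 t2] t1(1) t2(1) by (fastforce simp: p(1))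
    moreover have "t1 + t2 \<noteq> 0"
      using t1(2) by (metis lookup_add lookup_zero add_is_0 poly_mapping_eqI)
    moreover have "cover (t1 + t2) g = count_list p g" for g
      using t1(3) t2(3) by (simp add: p(1))
    ultimately show ?thesis by blast
  qed
qed

end

section \<open>Complete intersections and toric ideals\<close>

text \<open>The exponent of a monomial whose variables are renamed by \<open>f\<close>; variables
  with the same new name are merged.\<close>

definition push :: "('i \<Rightarrow> 'j) \<Rightarrow> ('i \<Rightarrow>\<^sub>0 nat) \<Rightarrow> ('j \<Rightarrow>\<^sub>0 nat)" where
  "push f u = (\<Sum>i\<in>keys u. single (f i) (lookup u i))"

lemma push_superset:
  assumes "finite S" "keys u \<subseteq> S"
  shows "push f u = (\<Sum>i\<in>S. single (f i) (lookup u i))"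
  unfolding push_def using assms by (intro sum.mono_neutral_left) (auto simp: in_keys_iff)

lemma push_0 [simp]: "push f 0 = 0"
  by (simp add: push_def)

lemma push_single [simp]: "push f (single i n) = single (f i) n"
  by (cases "n = 0") (simp_all add: push_def)

lemma push_add: "push f (u + v) = push f u + push f v"
proof -
  have "finite (keys u \<union> keys v)" by simp
  moreover have "keys (u + v) \<subseteq> keys u \<union> keys v" by (rule keys_add)
  ultimately show ?thesis
    by (simp add: push_superset[of "keys u \<union> keys v"] lookup_add single_add sum.distrib)
qed

lemma cover_push: "cover (push f u) e = (\<Sum>i\<in>keys u. if e \<in> f i then lookup u i else 0)"
proof -
  have "cover (\<Sum>i\<in>S. single (f i) (lookup u i)) e = (\<Sum>i\<in>S. if e \<in> f i then lookup u i else 0)" for S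
    by (induction S rule: infinite_finite_induct) simp_all
  then show ?thesis by (simp add: push_def)
qed

lemma keys_push: "keys (push f u) \<subseteq> f ` keys u"
proof
  fix x assume "x \<in> keys (push f u)"
  then have "lookup (push f u) x \<noteq> 0" by (simp add: in_keys_iff)
  then obtain i where "i \<in> keys u" "lookup (single (f i) (lookup u i)) x \<noteq> 0"
    unfolding push_def lookup_sum by (meson sum.not_neutral_contains_not_neutral)
  then show "x \<in> f ` keys u" by (auto simp: lookup_single when_def split: if_splits)
qed

lemma power_prod_var_push:
  "power_prod (\<lambda>i. mpoly_var (f i)) u = (monomial (push f u) :: ('j, 'k::comm_semiring_1) mpoly)"
  by (induction u rule: exponent_induct)
    (simp_all add: power_prod_add power_prod_single push_add mpoly_var_def mult_single)

lemma const_subst_id: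
  fixes p :: "('i, 'k::comm_ring_1) mpoly"
  assumes "\<And>m i. m \<in> keys p \<Longrightarrow> i \<in> keys m \<Longrightarrow> y i = mpoly_var i"
  shows "mpoly_subst mpoly_const y p = p"
proof -
  have "mpoly_subst mpoly_const y p = (\<Sum>m\<in>keys p. mpoly_const (lookup p m) * monomial m)"
    unfolding const_hom.subst_superset[OF finite_keys subset_refl]
    using assms by (intro sum.cong refl) (simp add: power_prod_eq_monom)
  then show ?thesis using mpoly_expand[OF finite_keys subset_refl, of p] by simp
qed

lemma const_subst_subst:
  "mpoly_subst mpoly_const x (mpoly_subst mpoly_const y p) =
     mpoly_subst mpoly_const (\<lambda>i. mpoly_subst mpoly_const x (y i) :: ('j, 'k::comm_ring_1) mpoly) p"
  unfolding const_hom.subst_superset[OF finite_keys subset_refl, of y p]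
    const_hom.subst_superset[OF finite_keys subset_refl, of _ p]
  by (simp add: const_hom.subst_sum const_hom.subst_mult subst_power_prod)

text \<open>Moving all monomials of a fibre to one representative makes their coefficients add up to
  0 there. This is why the kernel of a monomial map is generated by binomials.\<close>

lemma fibre_sum_zero_expansion:
  fixes p :: "('i, 'k::comm_ring_1) mpoly" and \<phi> :: "('i \<Rightarrow>\<^sub>0 nat) \<Rightarrow> 'x"
  assumes "\<And>w. (\<Sum>u\<in>{u \<in> keys p. \<phi> u = w}. lookup p u) = 0"
  obtains r where "\<And>u. u \<in> keys p \<Longrightarrow> r u \<in> keys p \<and> \<phi> (r u) = \<phi> u"
    "p = (\<Sum>u\<in>keys p. mpoly_const (lookup p u) * (monomial u - monomial (r u)))"
proof -
  define s where "s w = (SOME u. u \<in> keys p \<and> \<phi> u = w)" for w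
  have s: "s (\<phi> u) \<in> keys p \<and> \<phi> (s (\<phi> u)) = \<phi> u" if "u \<in> keys p" for u
    unfolding s_def using someI[of "\<lambda>v. v \<in> keys p \<and> \<phi> v = \<phi> u" u] that by simp
  have "(\<Sum>u\<in>keys p. mpoly_const (lookup p u) * monomial (s (\<phi> u))) =
      (\<Sum>w\<in>\<phi> ` keys p. \<Sum>u\<in>{u \<in> keys p. \<phi> u = w}. mpoly_const (lookup p u) * monomial (s (\<phi> u)))"
    by (rule sum.image_gen) simp
  also have "\<dots> = (\<Sum>w\<in>\<phi> ` keys p. mpoly_const (\<Sum>u\<in>{u \<in> keys p. \<phi> u = w}. lookup p u) * monomial (s w))"
  proof (intro sum.cong refl)
    fix w
    have "mpoly_const (sum g A) = (\<Sum>u\<in>A. mpoly_const (g u) :: ('i, 'k) mpoly)"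
        for g and A :: "('i \<Rightarrow>\<^sub>0 nat) set"
      by (induction A rule: infinite_finite_induct) (simp_all add: mpoly_const_add)
    then show "(\<Sum>u\<in>{u \<in> keys p. \<phi> u = w}. mpoly_const (lookup p u) * monomial (s (\<phi> u))) =
        mpoly_const (\<Sum>u\<in>{u \<in> keys p. \<phi> u = w}. lookup p u) * monomial (s w)"
      by (simp add: sum_distrib_right)
  qed
  also have "\<dots> = 0" using assms by simp
  finally have "p = (\<Sum>u\<in>keys p. mpoly_const (lookup p u) * (monomial u - monomial (s (\<phi> u))))"
    using mpoly_expand[OF finite_keys subset_refl, of p]
    by (simp add: right_diff_distrib sum_subtractf)
  then show ?thesis using that[of "s \<circ> \<phi>"] s by simp
qed

section \<open>The kernel of the cycle homomorphism\<close>

context fin_digraph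
begin

lemma finite_arc_set: "c \<in> primitive_cycles G \<Longrightarrow> finite (arc_set c)"
  using finite_nonempty_cycle_set arc_set_primitive_cycles by blast

lemma cycle_hom_monomial:
  assumes "keys u \<subseteq> primitive_cycles G"
  shows "\<exists>w. cycle_hom (monomial u) = (monomial w :: ('b, 'k::comm_ring_1) mpoly) \<and>
    lookup w = cover (push arc_set u)"
proof -
  have prod: "(\<Prod>e\<in>A. mpoly_var e) = (monomial (\<Sum>e\<in>A. single e 1) :: ('b, 'k) mpoly)" for A :: "'b set"
    by (induction A rule: infinite_finite_induct) (simp_all add: mpoly_var_def mult_single)
  have "\<exists>w. power_prod cycle_poly u = (monomial w :: ('b, 'k) mpoly) \<and>
      lookup w = cover (push arc_set u)"
    using assms
  proof (induction u rule: exponent_induct)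
    case zero
    then show ?case by (intro exI[of _ 0]) (simp add: fun_eq_iff)
  next
    case (add c u)
    have c: "c \<in> primitive_cycles G" and u: "keys u \<subseteq> primitive_cycles G"
      using add.prems unfolding keys_single_add by simp_all
    obtain w where w: "power_prod cycle_poly u = (monomial w :: ('b, 'k) mpoly)"
      "lookup w = cover (push arc_set u)"
      using add.IH[OF u] by blast
    define v where "v = (\<Sum>e\<in>arc_set c. single e (1::nat))"
    have "power_prod cycle_poly (single c 1 + u) = (monomial (v + w) :: ('b, 'k) mpoly)"
      using prod[of "arc_set c"] w(1)
      by (simp add: power_prod_add power_prod_single cycle_poly_def arc_set_def v_def mult_single)
    moreover have "lookup v e = (if e \<in> arc_set c then 1 else 0)" for e
      using finite_arc_set[OF c] by (simp add: v_def lookup_sum lookup_single when_def)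
    then have "lookup (v + w) = cover (push arc_set (single c 1 + u))"
      by (simp add: fun_eq_iff lookup_add w(2) push_add)
    ultimately show ?case by blast
  qed
  then show ?thesis by (simp add: cycle_hom_def)
qed

definition ambient :: "('b list set, 'k::comm_ring_1) mpoly ring" where
  "ambient = mpoly_ring (primitive_cycles G)"

definition relations :: "('b list set, 'k::field) mpoly set" where
  "relations = {p. (\<forall>m\<in>keys p. keys m \<subseteq> primitive_cycles G) \<and> cycle_hom p = 0}"

lemma complete_intersection_relations:
  "complete_intersection TYPE('k::field) G \<longleftrightarrow>
     (\<exists>gs. set gs \<subseteq> carrier ambient \<and>
        enat (length gs) + krull_dim (iss_ring G :: ('b, 'k) mpoly ring) =
            enat (card (primitive_cycles G)) \<and>
        (relations :: ('b list set, 'k) mpoly set) = Idl\<^bsub>ambient\<^esub> (set gs))"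
  unfolding complete_intersection_def Let_def ambient_def relations_def a_kernel_def'
  by (simp add: mpoly_ring_def iss_ring_def ring_of_type_algebra_def)

lemma ambient_eq: "ambient = monoid_algebra {m. keys m \<subseteq> primitive_cycles G}"
  by (simp add: ambient_def mpoly_ring_def monoid_algebra_def subset_eq)

end

text \<open>The variables may be named by sets over another ground set as long as the same pairs of
  monomials are identified. This brings the kernels for \<open>Q\<close> and \<open>Q'\<close> into
  one polynomial ring.\<close>

locale cycle_encoding = fin_digraph G for G :: "('a, 'b) pre_digraph" +
  fixes \<sigma> :: "'b list set \<Rightarrow> 'd set"
  assumes inj_\<sigma>: "inj_on \<sigma> (primitive_cycles G)"
    and cover_\<sigma>: "keys u \<subseteq> primitive_cycles G \<Longrightarrow> keys v \<subseteq> primitive_cycles G \<Longrightarrow>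
      cover (push arc_set u) = cover (push arc_set v) \<longleftrightarrow> cover (push \<sigma> u) = cover (push \<sigma> v)"
begin

definition I where "I = primitive_cycles G"

sublocale exponent_monoid "{m. keys m \<subseteq> I}"
proof
  show "m + n \<in> {m. keys m \<subseteq> I}" if "m \<in> {m. keys m \<subseteq> I}" "n \<in> {m. keys m \<subseteq> I}" for m n
    using keys_add[of m n] that by auto
qed simp

definition encode :: "('b list set, 'k::comm_ring_1) mpoly \<Rightarrow> ('d set, 'k) mpoly" where
  "encode = mpoly_subst mpoly_const (\<lambda>c. mpoly_var (\<sigma> c))"

text \<open>Variables outside the image of \<sigma> go to 0, because \<open>toric_ideal\<close> is
  formed in the polynomial ring in all variables, whereas \<open>ambient\<close> has only those of
  the primitive cycles.\<close>

definition decode :: "('d set, 'k::comm_ring_1) mpoly \<Rightarrow> ('b list set, 'k) mpoly" where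
  "decode = mpoly_subst mpoly_const (\<lambda>C. if C \<in> \<sigma> ` I then mpoly_var (inv_into I \<sigma> C) else 0)"

lemma ambient_eq_I: "ambient = monoid_algebra {m. keys m \<subseteq> I}"
  unfolding ambient_eq I_def ..

lemma inv_\<sigma>: "c \<in> I \<Longrightarrow> inv_into I \<sigma> (\<sigma> c) = c"
  using inj_\<sigma> by (simp add: I_def)

lemma decode_encode: "keys p \<subseteq> {m. keys m \<subseteq> I} \<Longrightarrow> decode (encode p) = p"
  for p :: "('b list set, 'k::comm_ring_1) mpoly"
  unfolding encode_def decode_def const_subst_subst
proof (rule const_subst_id)
  fix m c assume "keys p \<subseteq> {m. keys m \<subseteq> I}" "m \<in> keys p" "c \<in> keys m"
  then have "c \<in> I" by blast
  then show "mpoly_subst mpoly_const (\<lambda>C. if C \<in> \<sigma> ` I then mpoly_var (inv_into I \<sigma> C) else 0)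
      (mpoly_var (\<sigma> c)) = (mpoly_var c :: ('b list set, 'k) mpoly)"
    by (simp add: const_subst_var inv_\<sigma>)
qed

lemma encode_decode: "keys p \<subseteq> {m. keys m \<subseteq> \<sigma> ` I} \<Longrightarrow> encode (decode p) = p"
  unfolding encode_def decode_def const_subst_subst
  by (rule const_subst_id) (auto simp: const_subst_var f_inv_into_f)

lemma keys_decode: "keys (decode p :: ('b list set, 'c::comm_ring_1) mpoly) \<subseteq> {m. keys m \<subseteq> I}"
proof -
  define y :: "'d set \<Rightarrow> ('b list set, 'c) mpoly" where
    "y = (\<lambda>C. if C \<in> \<sigma> ` I then mpoly_var (inv_into I \<sigma> C) else 0)"
  have y: "keys (y C) \<subseteq> {m. keys m \<subseteq> I}" for C
    by (auto simp: y_def mpoly_var_def inv_into_into split: if_splits)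
  have "keys (power_prod y m) \<subseteq> {m. keys m \<subseteq> I}" for m
    by (induction m rule: exponent_induct)
      (simp_all add: power_prod_add power_prod_single keys_mult_M y)
  then show ?thesis
    unfolding decode_def y_def[symmetric] const_hom.subst_superset[OF finite_keys subset_refl]
    by (intro keys_sum_M keys_mult_M keys_const_M)
qed

lemma decode_monomial:
  assumes "keys U \<subseteq> \<sigma> ` I"
  shows "\<exists>u. keys u \<subseteq> I \<and> push \<sigma> u = U \<and>
      decode (monomial U) = (monomial u :: ('b list set, 'k::comm_ring_1) mpoly)"
  using assms
proof (induction U rule: exponent_induct)
  case zero
  then show ?case by (intro exI[of _ 0]) (simp add: decode_def)
next
  case (add C U)
  have C: "C \<in> \<sigma> ` I" and U: "keys U \<subseteq> \<sigma> ` I" using add.prems unfolding keys_single_add by simp_all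
  obtain u where u: "keys u \<subseteq> I" "push \<sigma> u = U"
      "decode (monomial U) = (monomial u :: ('b list set, 'k) mpoly)"
    using add.IH[OF U] by blast
  let ?c = "inv_into I \<sigma> C"
  have "decode (monomial (single C 1 + U)) = (monomial (single ?c 1 + u) :: ('b list set, 'k) mpoly)"
    using u(3) C by (simp add: decode_def power_prod_add power_prod_single mpoly_var_def mult_single)
  moreover have "keys (single ?c 1 + u) \<subseteq> I"
    unfolding keys_single_add using u(1) C by (simp add: inv_into_into)
  moreover have "push \<sigma> (single ?c 1 + u) = single C 1 + U"
    using u(2) C by (simp add: push_add f_inv_into_f)
  ultimately show ?case by blast
qed

text \<open>A coefficient of \<open>cycle_hom p\<close> is the sum of the coefficients of
  \<open>p\<close> over one fibre of the map on exponents, so \<open>p\<close> is a combination of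
  binomials.\<close>

lemma encode_relations:
  fixes p :: "('b list set, 'k::field) mpoly"
  assumes "p \<in> relations"
  shows "encode p \<in> toric_ideal (\<sigma> ` I)"
proof -
  have p: "\<And>m. m \<in> keys p \<Longrightarrow> keys m \<subseteq> I" "cycle_hom p = 0"
    using assms by (auto simp: relations_def I_def)
  obtain W where W: "\<And>u. keys u \<subseteq> I \<Longrightarrow> cycle_hom (monomial u) = (monomial (W u) :: ('b, 'k) mpoly) \<and>
      lookup (W u) = cover (push arc_set u)"
    using cycle_hom_monomial unfolding I_def by metis
  have hom: "cycle_hom p = (\<Sum>u\<in>keys p. single (W u) (lookup p u))"
  proof -
    have "power_prod cycle_poly u = (monomial (W u) :: ('b, 'k) mpoly)" if "u \<in> keys p" for u
      using W[OF p(1)[OF that]] by (simp add: cycle_hom_def)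
    then show ?thesis
      unfolding cycle_hom_def const_hom.subst_superset[OF finite_keys subset_refl]
      by (intro sum.cong refl) (simp add: mpoly_const_def mult_single)
  qed
  have "(\<Sum>u\<in>{u \<in> keys p. W u = w}. lookup p u) = 0" for w
  proof -
    have "(\<Sum>u\<in>{u \<in> keys p. W u = w}. lookup p u) = lookup (cycle_hom p) w"
      unfolding hom by (simp add: lookup_sum lookup_single when_def sum.inter_filter)
    then show ?thesis by (simp add: p(2))
  qed
  then obtain r where r: "\<And>u. u \<in> keys p \<Longrightarrow> r u \<in> keys p \<and> W (r u) = W u"
    "p = (\<Sum>u\<in>keys p. mpoly_const (lookup p u) * (monomial u - monomial (r u)))"
    using fibre_sum_zero_expansion[of p W] by blast
  have "encode (monomial u - monomial (r u)) \<in> (binomials (\<sigma> ` I) :: ('d set, 'k) mpoly set)"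
      if u: "u \<in> keys p" for u
  proof -
    have k: "keys u \<subseteq> I" "keys (r u) \<subseteq> I" using p(1) r(1)[OF u] u by auto
    have "cover (push arc_set u) = cover (push arc_set (r u))"
      using W[OF k(1)] W[OF k(2)] r(1)[OF u] by metis
    then have "cover (push \<sigma> u) = cover (push \<sigma> (r u))" using cover_\<sigma> k unfolding I_def by blast
    moreover have "keys (push \<sigma> u) \<subseteq> \<sigma> ` I" "keys (push \<sigma> (r u)) \<subseteq> \<sigma> ` I"
      by (rule subset_trans[OF keys_push image_mono[OF k(1)]])
        (rule subset_trans[OF keys_push image_mono[OF k(2)]])
    moreover have "encode (monomial u - monomial (r u)) =
        (monomial (push \<sigma> u) - monomial (push \<sigma> (r u)) :: ('d set, 'k) mpoly)"
      by (simp add: encode_def const_subst_minus power_prod_var_push)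
    ultimately show ?thesis using binomialsI by metis
  qed
  then have "(\<Sum>u\<in>keys p. mpoly_const (lookup p u) * encode (monomial u - monomial (r u)))
      \<in> toric_ideal (\<sigma> ` I)"
    unfolding toric_ideal_def by (intro ideal.span_sum ideal.span_scale ideal.span_base)
  moreover have "encode p = (\<Sum>u\<in>keys p. mpoly_const (lookup p u) * encode (monomial u - monomial
      (r u)))"
    by (subst r(2)) (simp add: encode_def const_hom.subst_sum const_hom.subst_mult)
  ultimately show ?thesis by simp
qed

lemma decode_toric_ideal:
  fixes f :: "('d set, 'k::field) mpoly"
  assumes "f \<in> toric_ideal (\<sigma> ` I)"
  shows "decode f \<in> relations"
proof -
  have "cycle_hom (decode f) = 0"
    using assms unfolding toric_ideal_def
  proof (induction f rule: ideal.span_induct_alt)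
    case base
    then show ?case by (simp add: decode_def cycle_hom_def)
  next
    case (step c b f)
    obtain U V where b: "b = monomial U - monomial V" "keys U \<subseteq> \<sigma> ` I" "keys V \<subseteq> \<sigma> ` I"
        "cover U = cover V"
      using step(1) by (rule binomialsE)
    obtain u where u: "keys u \<subseteq> I" "push \<sigma> u = U"
        "decode (monomial U) = (monomial u :: ('b list set, 'k) mpoly)"
      using decode_monomial[OF b(2)] by blast
    obtain v where v: "keys v \<subseteq> I" "push \<sigma> v = V"
        "decode (monomial V) = (monomial v :: ('b list set, 'k) mpoly)"
      using decode_monomial[OF b(3)] by blast
    have cov: "cover (push arc_set u) = cover (push arc_set v)"
      using cover_\<sigma>[of u v] u v b(4) unfolding I_def by simp
    obtain w where w: "cycle_hom (monomial u) = (monomial w :: ('b, 'k) mpoly)"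
        "lookup w = cover (push arc_set u)"
      using cycle_hom_monomial u(1) unfolding I_def by blast
    obtain w' where w': "cycle_hom (monomial v) = (monomial w' :: ('b, 'k) mpoly)"
        "lookup w' = cover (push arc_set v)"
      using cycle_hom_monomial v(1) unfolding I_def by blast
    have "w = w'" using w(2) w'(2) cov by (simp add: poly_mapping_eq_iff)
    then have "cycle_hom (decode b) = 0"
      using u(3) v(3) w(1) w'(1) by (simp add: b(1) decode_def cycle_hom_def const_subst_minus)
    then show ?case
      using step(2) by (simp add: decode_def cycle_hom_def const_hom.subst_add const_hom.subst_mult)
  qed
  then show ?thesis using keys_decode[of f] by (auto simp: relations_def I_def)
qed

lemma ideal_relations: "ideal relations (ambient :: ('b list set, 'k::field) mpoly ring)"
  unfolding ambient_eq_I
proof (rule ideal_monoid_algebraI)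
  show "relations \<subseteq> {f :: ('b list set, 'k) mpoly. keys f \<subseteq> {m. keys m \<subseteq> I}}"
    by (auto simp: relations_def I_def)
  show "0 \<in> relations" by (simp add: relations_def cycle_hom_def)
  show "f + g \<in> relations" if "f \<in> relations" "g \<in> relations" for f g :: "('b list set, 'k) mpoly"
    using that keys_add_M[of f g]
    by (simp add: relations_def cycle_hom_def const_hom.subst_add subset_eq I_def)
  show "f * g \<in> relations"
      if "keys f \<subseteq> {m. keys m \<subseteq> I}" "g \<in> relations" for f g :: "('b list set, 'k) mpoly"
    using that keys_mult_M[of f g]
    by (simp add: relations_def cycle_hom_def const_hom.subst_mult subset_eq I_def)
qed

lemma relations_generated_iff:
  "(\<exists>gs. length gs = N \<and> set gs \<subseteq> carrier ambient \<and>
      (relations :: ('b list set, 'k::field) mpoly set) = Idl\<^bsub>ambient\<^esub> (set gs))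
    \<longleftrightarrow> gen_by N (toric_ideal (\<sigma> ` I) :: ('d set, 'k) mpoly set)"
proof
  interpret R: cring "ambient :: ('b list set, 'k) mpoly ring"
    unfolding ambient_eq_I by (rule cring_monoid_algebra)
  have hom: "encode (f + g) = encode f + encode g" "encode (f * g) = encode f * encode g"
      "encode 0 = 0"
    "decode (f' + g') = decode f' + decode g'" "decode (f' * g') = decode f' * decode g'"
        "decode 0 = 0"
    for f g :: "('b list set, 'k) mpoly" and f' g' :: "('d set, 'k) mpoly"
    by (simp_all add: encode_def decode_def const_hom.subst_add const_hom.subst_mult)
  {
    assume "\<exists>gs. length gs = N \<and> set gs \<subseteq> carrier ambient \<and>
      (relations :: ('b list set, 'k) mpoly set) = Idl\<^bsub>ambient\<^esub> (set gs)"
    then obtain gs where gs: "length gs = N" "set gs \<subseteq> carrier ambient"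
      "(relations :: ('b list set, 'k) mpoly set) = Idl\<^bsub>ambient\<^esub> (set gs)" by blast
    \<comment> \<open>\<open>L\<close> is the preimage of an ideal and contains the generators, so
      it contains \<open>relations\<close>.\<close>
    define L where "L = {p :: ('b list set, 'k) mpoly. keys p \<subseteq> {m. keys m \<subseteq> I} \<and> encode p \<in>
        ideal_span (encode ` set gs)}"
    have "ideal L ambient"
      unfolding ambient_eq_I L_def
      by (rule ideal_monoid_algebraI)
        (auto simp: hom ideal.span_zero intro: ideal.span_add ideal.span_scale
          dest: subsetD[OF keys_add_M] subsetD[OF keys_mult_M])
    moreover have "set gs \<subseteq> L"
      using gs(2) by (auto simp: L_def ambient_eq_I ideal.span_base)
    ultimately have "relations \<subseteq> L" unfolding gs(3) by (rule R.genideal_minimal)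
    have "toric_ideal (\<sigma> ` I) = ideal_span (encode ` set gs)"
    proof
      have "b \<in> ideal_span (encode ` set gs)"
          if b: "b \<in> binomials (\<sigma> ` I)" for b :: "('d set, 'k) mpoly"
      proof -
        have "decode b \<in> relations"
          using b by (intro decode_toric_ideal) (simp add: toric_ideal_def ideal.span_base)
        then have "encode (decode b) \<in> ideal_span (encode ` set gs)" using \<open>relations \<subseteq> L\<close>
            by (auto simp: L_def)
        moreover have "keys b \<subseteq> {m. keys m \<subseteq> \<sigma> ` I}"
        proof -
          obtain U V where "b = monomial U - monomial V" "keys U \<subseteq> \<sigma> ` I" "keys V \<subseteq> \<sigma> ` I"
            using b by (rule binomialsE)
          moreover from this have "m = U \<or> m = V" if "m \<in> keys b" for m
            using that by (auto simp: in_keys_iff lookup_minus lookup_single when_def split: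
                if_splits)
          ultimately show ?thesis by blast
        qed
        ultimately show ?thesis by (simp add: encode_decode)
      qed
      then show "toric_ideal (\<sigma> ` I) \<subseteq> ideal_span (encode ` set gs)"
        unfolding toric_ideal_def by (intro ideal.span_minimal) auto
      have "set gs \<subseteq> relations" unfolding gs(3) using gs(2) by (rule R.genideal_self)
      then show "ideal_span (encode ` set gs) \<subseteq> toric_ideal (\<sigma> ` I)"
        using encode_relations by (intro ideal.span_minimal) (auto simp: toric_ideal_def)
    qed
    moreover have "card (encode ` set gs) \<le> N"
      using card_image_le[of "set gs" encode] card_length[of gs] gs(1) by simp
    ultimately show "gen_by N (toric_ideal (\<sigma> ` I) :: ('d set, 'k) mpoly set)"
      unfolding gen_by_def by (intro exI[of _ "encode ` set gs"]) simp
  }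
  assume "gen_by N (toric_ideal (\<sigma> ` I) :: ('d set, 'k) mpoly set)"
  then obtain B where B: "finite B" "card B \<le> N"
      "ideal_span B = (toric_ideal (\<sigma> ` I) :: ('d set, 'k) mpoly set)"
    by (auto simp: gen_by_def)
  obtain ls where ls: "set ls = B" "length ls = card B"
    using finite_distinct_list[OF B(1)] distinct_card by metis
  \<comment> \<open>The definition asks for a list of length exactly \<open>N\<close>, so missing
    generators are replaced by 0.\<close>
  define gs where "gs = map decode ls @ replicate (N - card B) 0"
  have len: "length gs = N" using B(2) ls(2) by (simp add: gs_def)
  have set_gs: "decode ` B \<subseteq> set gs" "set gs \<subseteq> insert 0 (decode ` B)" using ls(1)
      by (auto simp: gs_def)
  have "decode f \<in> relations" if "f \<in> B" for f
    using that B(3) ideal.span_base by (intro decode_toric_ideal) blast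
  moreover have "0 \<in> relations" by (simp add: relations_def cycle_hom_def)
  ultimately have gs_rel: "set gs \<subseteq> relations" using set_gs(2) by blast
  have carrier: "set gs \<subseteq> carrier ambient"
    using gs_rel additive_subgroup.a_subset[OF ideal.axioms(1)[OF ideal_relations]] by blast
  have idl: "ideal (Idl\<^bsub>ambient\<^esub> (set gs)) ambient" using carrier by (rule R.genideal_ideal)
  have in_idl: "decode f \<in> Idl\<^bsub>ambient\<^esub> (set gs)" if "f \<in> ideal_span B" for f
    using that
  proof (induction f rule: ideal.span_induct_alt)
    case base
    show ?case
      using additive_subgroup.zero_closed[OF ideal.axioms(1)[OF idl]] by (simp add: hom ambient_eq_I)
  next
    case (step c x y)
    have "decode x \<in> Idl\<^bsub>ambient\<^esub> (set gs)"
      using R.genideal_self[OF carrier] set_gs(1) step(1) by blast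
    then have "decode c * decode x \<in> Idl\<^bsub>ambient\<^esub> (set gs)"
      using ideal.I_l_closed[OF idl, of "decode x" "decode c"] keys_decode[of c]
          by (simp add: ambient_eq_I)
    then show ?case
      using additive_subgroup.a_closed[OF ideal.axioms(1)[OF idl], of "decode c * decode x"
          "decode y"] step(2)
      by (simp add: hom ambient_eq_I)
  qed
  have "relations = Idl\<^bsub>ambient\<^esub> (set gs)"
  proof
    show "Idl\<^bsub>ambient\<^esub> (set gs) \<subseteq> relations" using ideal_relations gs_rel by (rule R.genideal_minimal)
    show "relations \<subseteq> Idl\<^bsub>ambient\<^esub> (set gs)"
    proof
      fix p :: "('b list set, 'k) mpoly" assume p: "p \<in> relations"
      then have "encode p \<in> ideal_span B" using encode_relations B(3) by simp
      then have "decode (encode p) \<in> Idl\<^bsub>ambient\<^esub> (set gs)" by (rule in_idl)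
      moreover have "decode (encode p) = p"
        using p by (intro decode_encode) (auto simp: relations_def I_def)
      ultimately show "p \<in> Idl\<^bsub>ambient\<^esub> (set gs)" by simp
    qed
  qed
  then show "\<exists>gs. length gs = N \<and> set gs \<subseteq> carrier ambient \<and>
      (relations :: ('b list set, 'k) mpoly set) = Idl\<^bsub>ambient\<^esub> (set gs)"
    using len carrier by blast
qed

lemma complete_intersection_iff:
  "complete_intersection TYPE('k::field) G \<longleftrightarrow>
     (\<exists>N. enat N + krull_dim (iss_ring G :: ('b, 'k) mpoly ring) = enat (card (\<sigma> ` I)) \<and>
        gen_by N (toric_ideal (\<sigma> ` I) :: ('d set, 'k) mpoly set))"
  unfolding complete_intersection_relations relations_generated_iff[symmetric]
  using card_image[OF inj_\<sigma>] unfolding I_def by metis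

end

section \<open>Cycles of the contracted quiver\<close>

context contraction
begin

definition local_cycles :: "'a set set" where
  "local_cycles = {C \<in> Q.cycle_sets. \<not> (v1 \<in> tail Q ` C \<and> v2 \<in> tail Q ` C)}"

lemma E_notin_local: "C \<in> local_cycles \<Longrightarrow> E \<notin> C"
  and F_notin_local: "C \<in> local_cycles \<Longrightarrow> F \<notin> C"
proof -
  assume C: "C \<in> local_cycles"
  have "\<not> (tail Q e \<in> {v1, v2} \<and> head Q e \<in> {v1, v2} \<and> tail Q e \<noteq> head Q e)" if "e \<in> C" for e
  proof -
    have "tail Q e \<in> tail Q ` C" "head Q e \<in> tail Q ` C"
      using Q.head_in_tails_cycle_set[of C e] that C by (auto simp: local_cycles_def)
    then show ?thesis using C
        by (auto simp only: local_cycles_def mem_Collect_eq insert_iff empty_iff)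
  qed
  from this[of E] this[of F] show "E \<notin> C" "F \<notin> C" using E F v12 by auto
qed

lemma E_apath: "Q.apath v1 [E] v2" and F_apath: "Q.apath v2 [F] v1"
  using Q.apath_single[of E] Q.apath_single[of F] E F v12 by auto

lemma E_notin_apath: "Q.apath v1 p v2 \<Longrightarrow> p \<noteq> [E] \<Longrightarrow> E \<notin> set p"
  using Q.apath_arc[of v1 p v2 E] E by blast

lemma E_notin_apath': "Q.apath v2 q v1 \<Longrightarrow> E \<notin> set q"
  using Q.start_notin_apath[of v2 q v1 E] E by blast

lemma F_notin_apath: "Q.apath v1 p v2 \<Longrightarrow> F \<notin> set p"
  using Q.start_notin_apath[of v1 p v2 F] F by blast

lemma F_notin_apath': "Q.apath v2 q v1 \<Longrightarrow> q \<noteq> [F] \<Longrightarrow> F \<notin> set q"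
  using Q.apath_arc[of v2 q v1 F] F by blast

section \<open>Cycle sets before and after the contraction\<close>

lemma cycle_sets_eq:
  "Q.cycle_sets = local_cycles \<union> {set p \<union> set q | p q. Q.apath v1 p v2 \<and> Q.apath v2 q v1 \<and>
     distinct (map (tail Q) (p @ q))}"
proof (intro equalityI subsetI)
  fix C assume C: "C \<in> Q.cycle_sets"
  show "C \<in> local_cycles \<union> {set p \<union> set q | p q. Q.apath v1 p v2 \<and> Q.apath v2 q v1 \<and>
     distinct (map (tail Q) (p @ q))}"
    using Q.cycle_set_through_two[OF C _ _ v12] C by (auto simp: local_cycles_def)
next
  fix C assume "C \<in> local_cycles \<union> {set p \<union> set q | p q. Q.apath v1 p v2 \<and> Q.apath v2 q v1 \<and>
     distinct (map (tail Q) (p @ q))}"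
  then show "C \<in> Q.cycle_sets"
    using Q.cycle_set_of_paths(1)[OF _ _ v12] by (auto simp: local_cycles_def)
qed

lemma cas_contract:
  "set p \<subseteq> arcs Q' \<Longrightarrow> Q.cas a (map \<gamma> p) b \<Longrightarrow> Q'.cas (\<tau> a) p (\<tau> b)"
  by (induction p arbitrary: a) (auto simp: tail' head')

text \<open>Away from the merged vertex \<tau> is injective, so the walk lifts arc by arc. Only its
  end may turn out to be the other one of the two glued vertices, whence \<open>b'\<close>.\<close>

lemma cas_lift:
  assumes "set p \<subseteq> arcs Q'" "Q'.cas (\<tau> u) p (\<tau> b)" "u \<in> verts Q" "b \<in> verts Q"
    "\<And>a. a \<in> set p \<Longrightarrow> tail Q' a \<noteq> \<tau> v1"
  shows "\<exists>b'\<in>verts Q. \<tau> b' = \<tau> b \<and> Q.cas u (map \<gamma> p) b'"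
  using assms
proof (induction p arbitrary: u)
  case Nil
  then show ?case by auto
next
  case (Cons a p)
  have a: "a \<in> arcs Q'" using Cons.prems(1) by simp
  have "\<tau> (tail Q (\<gamma> a)) = \<tau> u" using Cons.prems(2) tail'[OF a] by simp
  moreover have "\<tau> (tail Q (\<gamma> a)) \<noteq> \<tau> v1" using Cons.prems(5)[of a] tail'[OF a] by simp
  ultimately have "tail Q (\<gamma> a) = u"
    using \<tau>_eq_iff[OF Q.tail_in_verts[OF \<gamma>_arcs(1)[OF a]] Cons.prems(3)]
      \<tau>_eq_iff[OF Cons.prems(3) v1_vert] by auto
  moreover have "\<exists>b'\<in>verts Q. \<tau> b' = \<tau> b \<and> Q.cas (head Q (\<gamma> a)) (map \<gamma> p) b'"
  proof (rule Cons.IH)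
    show "Q'.cas (\<tau> (head Q (\<gamma> a))) p (\<tau> b)" using Cons.prems(2) head'[OF a] by simp
    show "head Q (\<gamma> a) \<in> verts Q" using \<gamma>_arcs(1)[OF a] by simp
  qed (use Cons.prems in auto)
  ultimately show ?case by auto
qed

lemma map_tail':
  "set p \<subseteq> arcs Q' \<Longrightarrow> map (tail Q') p = map \<tau> (map (tail Q) (map \<gamma> p))"
  using tail' by auto

text \<open>Serves closed walks with \<open>a = b\<close> and also, with \<open>a\<close> and
  \<open>b\<close> the two glued vertices, paths that gluing closes up.\<close>

lemma contracted_cycle_setI:
  assumes "set p \<subseteq> arcs Q - {E}" "p \<noteq> []" "Q.cas a p b" "\<tau> a = \<tau> b"
    "distinct (map (tail Q) p)" "\<not> (v1 \<in> tail Q ` set p \<and> v2 \<in> tail Q ` set p)"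
  shows "set p \<in> (`) \<gamma> ` Q'.cycle_sets"
proof -
  define p' where "p' = map (the_inv_into (arcs Q') \<gamma>) p"
  have inv: "the_inv_into (arcs Q') \<gamma> e \<in> arcs Q'" "\<gamma> (the_inv_into (arcs Q') \<gamma> e) = e"
    if "e \<in> arcs Q - {E}" for e
    using that \<gamma> the_inv_into_into[of \<gamma> "arcs Q'" e "arcs Q'"] f_the_inv_into_f[of \<gamma> "arcs Q'" e]
    by (auto simp: bij_betw_def)
  have p': "set p' \<subseteq> arcs Q'" using assms(1) inv(1) by (auto simp: p'_def)
  have map_p': "map \<gamma> p' = p" 
  proof -
    have "\<gamma> (the_inv_into (arcs Q') \<gamma> e) = e" if "e \<in> set p" for e
      using inv(2)[of e] assms(1) that by blast
    then show ?thesis by (simp add: p'_def map_idI)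
  qed
  have ne: "p' \<noteq> []" using assms(2) by (simp add: p'_def)
  have cas: "Q'.cas (\<tau> a) p' (\<tau> a)" using cas_contract[OF p', of a b] assms(3,4) map_p' by simp
  then have hd: "tail Q' (hd p') = \<tau> a" using ne by (cases p') auto
  have "inj_on \<tau> (tail Q ` set p)"
  proof (rule inj_onI)
    fix u v assume uv: "u \<in> tail Q ` set p" "v \<in> tail Q ` set p" "\<tau> u = \<tau> v"
    then have "u \<in> verts Q" "v \<in> verts Q" using assms(1) by auto
    then show "u = v" using \<tau>_eq_iff[of u v] uv assms(6) by auto
  qed
  then have "distinct (map \<tau> (map (tail Q) p))" using assms(5) by (subst distinct_map) auto
  then have "distinct (map (tail Q') p')" unfolding map_tail'[OF p'] map_p' .
  then have "Q'.cycle p'" using p' ne cas hd by (simp add: Q'.cycle_iff)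
  moreover have "set p = \<gamma> ` set p'" using arg_cong[OF map_p', of set] by simp
  ultimately show ?thesis unfolding Q'.cycle_sets_def by blast
qed

text \<open>A lifted cycle either closes up, and then it misses a glued vertex, or it leads from one
  glued vertex to the other.\<close>

lemma contracted_cycle_sets:
  "(`) \<gamma> ` Q'.cycle_sets = local_cycles \<union> {set p | p. Q.apath v1 p v2 \<and> p \<noteq> [E]} \<union>
     {set q | q. Q.apath v2 q v1}" (is "?L = ?R")
proof (intro equalityI subsetI)
  fix C assume "C \<in> ?L"
  then obtain p0 where p0: "Q'.cycle p0" "C = \<gamma> ` set p0" by (auto simp: Q'.cycle_sets_def)
  \<comment> \<open>The cycle leaves the merged vertex at most once; rotated to start there, its
    later arcs satisfy the hypothesis of \<open>cas_lift\<close>.\<close>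
  obtain n where n: "\<And>a. a \<in> set (tl (rotate n p0)) \<Longrightarrow> tail Q' a \<noteq> \<tau> v1"
  proof (cases "\<exists>a\<in>set p0. tail Q' a = \<tau> v1")
    case True
    then obtain a where a: "a \<in> set p0" "tail Q' a = \<tau> v1" by blast
    obtain n where n: "hd (rotate n p0) = a" using Q'.rotate_to_arc[OF p0(1) a(1)] .
    have "distinct (map (tail Q') (rotate n p0))" "rotate n p0 \<noteq> []"
      using Q'.cycle_rotate[OF p0(1), of n] by (simp_all add: Q'.cycle_iff)
    then have "tail Q' b \<noteq> \<tau> v1" if "b \<in> set (tl (rotate n p0))" for b
      using that n a(2) by (cases "rotate n p0") (auto, metis image_eqI)
    then show thesis by (rule that)
  next
    case False
    have "set (tl (rotate 0 p0)) \<subseteq> set p0" by (cases p0) auto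
    then show thesis using False by (intro that[of 0]) blast
  qed
  obtain a r where ar: "rotate n p0 = a # r"
    using p0(1) by (cases "rotate n p0") (auto simp: Q'.cycle_iff)
  have cyc: "Q'.cycle (a # r)" using Q'.cycle_rotate[OF p0(1), of n] ar by simp
  have C: "C = set (map \<gamma> (a # r))"
    using p0(2) arg_cong[OF ar, of set] by simp
  define p where "p = map \<gamma> (a # r)"
  have arcs: "set (a # r) \<subseteq> arcs Q'" and dist: "distinct (map (tail Q') (a # r))"
    and cas': "Q'.cas (head Q' a) r (tail Q' a)"
    using cyc by (auto simp: Q'.cycle_iff)
  have a: "a \<in> arcs Q'" using arcs by simp
  define u where "u = tail Q (\<gamma> a)"
  have u: "u \<in> verts Q" using \<gamma>_arcs(1)[OF a] by (simp add: u_def)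
  have "\<exists>b\<in>verts Q. \<tau> b = \<tau> u \<and> Q.cas (head Q (\<gamma> a)) (map \<gamma> r) b"
    using cas' n arcs u \<gamma>_arcs(1)[OF a] head'[OF a] tail'[OF a]
    by (intro cas_lift) (auto simp: ar u_def)
  then obtain b where b: "b \<in> verts Q" "\<tau> b = \<tau> u" "Q.cas u p b"
    by (auto simp: p_def u_def)
  have p_arcs: "set p \<subseteq> arcs Q" "E \<notin> set p" using arcs \<gamma>_arcs by (auto simp: p_def)
  have "distinct (map \<tau> (map (tail Q) p))" using dist unfolding map_tail'[OF arcs] p_def .
  then have p_dist: "distinct (map (tail Q) p)" and inj: "inj_on \<tau> (tail Q ` set p)"
    unfolding distinct_map[of \<tau>] set_map by simp_all
  have not_both: "\<not> (v1 \<in> tail Q ` set p \<and> v2 \<in> tail Q ` set p)"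
    using inj \<tau>_eq_iff[OF v1_vert v2_vert] v12 by (auto dest: inj_onD)
  have u_tail: "u \<in> tail Q ` set p" by (simp add: p_def u_def)
  consider "b = u" | "u = v1" "b = v2" | "u = v2" "b = v1"
    using \<tau>_eq_iff[OF b(1) u] b(2) by auto
  then show "C \<in> ?R"
  proof cases
    case 1
    then have "Q.cycle p" using p_arcs b(3) p_dist by (auto simp: Q.cycle_iff p_def u_def)
    then have "set p \<in> local_cycles" using not_both by (auto simp: local_cycles_def Q.cycle_sets_def)
    then show ?thesis using C by (simp add: p_def)
  next
    case 2
    then have "Q.apath v1 p v2" using p_arcs b(3) p_dist not_both u u_tail by (auto simp: Q.apath_iff)
    moreover have "p \<noteq> [E]" using p_arcs(2) by auto
    ultimately show ?thesis using C unfolding p_def by blast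
  next
    case 3
    then have "Q.apath v2 p v1" using p_arcs b(3) p_dist not_both u u_tail by (auto simp: Q.apath_iff)
    then show ?thesis using C unfolding p_def by blast
  qed
next
  fix C assume "C \<in> ?R"
  then consider "C \<in> local_cycles" | p where "C = set p" "Q.apath v1 p v2" "p \<noteq> [E]"
    | q where "C = set q" "Q.apath v2 q v1" by blast
  then show "C \<in> ?L"
  proof cases
    case 1
    then obtain p where p: "Q.cycle p" "C = set p" by (auto simp: local_cycles_def Q.cycle_sets_def)
    then show ?thesis
      using E_notin_local[OF 1] 1 contracted_cycle_setI[of p "tail Q (hd p)" "tail Q (hd p)"]
      by (auto simp: Q.cycle_iff local_cycles_def)
  next
    case 2
    then have "p \<noteq> []" using v12 by (auto simp: Q.apath_iff)
    moreover have "\<tau> v1 = \<tau> v2" using \<tau>_eq_iff[OF v1_vert v2_vert] by simp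
    moreover have "v2 \<notin> tail Q ` set p" using 2(2) by (auto simp: Q.apath_iff)
    ultimately show ?thesis
      using E_notin_apath[OF 2(2,3)] 2(1,2) contracted_cycle_setI[of p v1 v2]
      by (auto simp: Q.apath_iff)
  next
    case 3
    then have "q \<noteq> []" using v12 by (auto simp: Q.apath_iff)
    moreover have "\<tau> v2 = \<tau> v1" using \<tau>_eq_iff[OF v1_vert v2_vert] by simp
    moreover have "v1 \<notin> tail Q ` set q" using 3(2) by (auto simp: Q.apath_iff)
    ultimately show ?thesis
      using E_notin_apath'[OF 3(2)] 3(1,2) contracted_cycle_setI[of q v2 v1]
      by (auto simp: Q.apath_iff)
  qed
qed

text \<open>Conservation at \<open>v\<^sub>1\<close> recovers the exponent of \<open>E\<close> from the other exponents.\<close>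

lemma cover_remove_E:
  assumes "keys u \<subseteq> primitive_cycles Q"
  shows "cover (push (\<lambda>c. Q.arc_set c - {E}) u) e = (if e = E then 0 else cover (push Q.arc_set u) e)"
    and "int (cover (push Q.arc_set u) E) = - flow (Q.net v1) (push (\<lambda>c. Q.arc_set c - {E}) u)"
proof -
  show "cover (push (\<lambda>c. Q.arc_set c - {E}) u) e = (if e = E then 0 else cover (push Q.arc_set u) e)"
    by (auto simp: cover_push intro!: sum.cong sum.neutral)
  show "int (cover (push Q.arc_set u) E) = - flow (Q.net v1) (push (\<lambda>c. Q.arc_set c - {E}) u)"
    using assms
  proof (induction u rule: exponent_induct)
    case zero
    then show ?case by (simp add: flow_def)
  next
    case (add c u)
    have c: "c \<in> primitive_cycles Q" and u: "keys u \<subseteq> primitive_cycles Q"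
      using add.prems unfolding keys_single_add by simp_all
    have C: "Q.arc_set c \<in> Q.cycle_sets" using c Q.arc_set_primitive_cycles by blast
    have net_E: "Q.net v1 E = 1" using E v12 by (simp add: Q.net_def)
    have "sum (Q.net v1) (Q.arc_set c - {E}) = - (if E \<in> Q.arc_set c then 1 else 0)"
    proof (cases "E \<in> Q.arc_set c")
      case True
      then have "sum (Q.net v1) (Q.arc_set c) = 1 + sum (Q.net v1) (Q.arc_set c - {E})"
        using Q.finite_arc_set[OF c] net_E by (simp add: sum.remove)
      then show ?thesis using Q.sum_net_cycle_set[OF C] True by simp
    qed (simp add: Q.sum_net_cycle_set[OF C])
    then show ?case using add.IH[OF u] by (simp add: push_add)
  qed
qed

section \<open>Both kernels as toric ideals over the arcs other than \<open>E\<close>\<close>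

lemma encoding_Q: "cycle_encoding Q (\<lambda>c. Q.arc_set c - {E})"
proof
  have cov: "cover (push Q.arc_set u) = cover (push Q.arc_set v) \<longleftrightarrow>
      cover (push (\<lambda>c. Q.arc_set c - {E}) u) = cover (push (\<lambda>c. Q.arc_set c - {E}) v)"
    if u: "keys u \<subseteq> primitive_cycles Q" and v: "keys v \<subseteq> primitive_cycles Q" for u v
  proof
    assume "cover (push Q.arc_set u) = cover (push Q.arc_set v)"
    then show "cover (push (\<lambda>c. Q.arc_set c - {E}) u) = cover (push (\<lambda>c. Q.arc_set c - {E}) v)"
      by (simp add: fun_eq_iff cover_remove_E(1)[OF u] cover_remove_E(1)[OF v])
  next
    assume eq: "cover (push (\<lambda>c. Q.arc_set c - {E}) u) = cover (push (\<lambda>c. Q.arc_set c - {E}) v)"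
    have fin: "finite C" if C: "C
        \<in> keys (push (\<lambda>c. Q.arc_set c - {E}) u) \<union> keys (push (\<lambda>c. Q.arc_set c - {E}) v)" for C
    proof -
      have "C \<in> (\<lambda>c. Q.arc_set c - {E}) ` primitive_cycles Q"
        using C subset_trans[OF keys_push image_mono[OF u], of "\<lambda>c. Q.arc_set c - {E}"]
          subset_trans[OF keys_push image_mono[OF v], of "\<lambda>c. Q.arc_set c - {E}"] by auto
      then show ?thesis using Q.finite_arc_set by auto
    qed
    have "cover (push Q.arc_set u) E = cover (push Q.arc_set v) E"
      using flow_cong_cover[OF eq fin, of "Q.net v1"] cover_remove_E(2)[OF u]
          cover_remove_E(2)[OF v] by simp
    moreover have "cover (push Q.arc_set u) e = cover (push Q.arc_set v) e" if "e \<noteq> E" for e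
      using fun_cong[OF eq, of e] that by (simp add: cover_remove_E(1)[OF u] cover_remove_E(1)[OF v])
    ultimately show "cover (push Q.arc_set u) = cover (push Q.arc_set v)" by (metis ext)
  qed
  then show "cover (push Q.arc_set u) = cover (push Q.arc_set v) \<longleftrightarrow>
      cover (push (\<lambda>c. Q.arc_set c - {E}) u) = cover (push (\<lambda>c. Q.arc_set c - {E}) v)"
    if "keys u \<subseteq> primitive_cycles Q" "keys v \<subseteq> primitive_cycles Q" for u v using that by blast
  show "inj_on (\<lambda>c. Q.arc_set c - {E}) (primitive_cycles Q)"
  proof (rule inj_onI)
    fix c d assume c: "c \<in> primitive_cycles Q" and d: "d \<in> primitive_cycles Q"
      and eq: "Q.arc_set c - {E} = Q.arc_set d - {E}"
    \<comment> \<open>Injectivity is the special case of \<open>cov\<close> for monomials that are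
      single variables.\<close>
    have cov_cd: "cover (push Q.arc_set (single c 1)) = cover (push Q.arc_set (single d 1))"
      using cov[of "single c 1" "single d 1"] c d eq by simp
    have "e \<in> Q.arc_set c \<longleftrightarrow> e \<in> Q.arc_set d" for e
      using fun_cong[OF cov_cd, of e] by (simp split: if_splits)
    then have "Q.arc_set c = Q.arc_set d" by blast
    then show "c = d" using Q.inj_on_arc_set c d by (auto dest: inj_onD)
  qed
qed

lemma encoding_Q': "cycle_encoding Q' (\<lambda>c. \<gamma> ` Q'.arc_set c)"
proof
  have inj: "inj_on \<gamma> (arcs Q')" using \<gamma> by (simp add: bij_betw_def)
  have sub: "Q'.arc_set c \<subseteq> arcs Q'" if "c \<in> primitive_cycles Q'" for c
    using that Q'.arc_set_primitive_cycles Q'.finite_nonempty_cycle_set by blast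
  show "inj_on (\<lambda>c. \<gamma> ` Q'.arc_set c) (primitive_cycles Q')"
  proof (rule inj_onI)
    fix c d assume c: "c \<in> primitive_cycles Q'" and d: "d \<in> primitive_cycles Q'"
      and eq: "\<gamma> ` Q'.arc_set c = \<gamma> ` Q'.arc_set d"
    have "Q'.arc_set c = Q'.arc_set d"
        using inj_on_image_eq_iff[OF inj sub[OF c] sub[OF d]] eq by blast
    then show "c = d" using Q'.inj_on_arc_set c d by (auto dest: inj_onD)
  qed
  fix u v :: "'c list set \<Rightarrow>\<^sub>0 nat"
  assume u: "keys u \<subseteq> primitive_cycles Q'" and v: "keys v \<subseteq> primitive_cycles Q'"
  have image: "cover (push (\<lambda>c. \<gamma> ` Q'.arc_set c) w) (\<gamma> a) = cover (push Q'.arc_set w) a"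
    if "keys w \<subseteq> primitive_cycles Q'" "a \<in> arcs Q'" for w a
  proof -
    have "\<gamma> a \<in> \<gamma> ` Q'.arc_set c \<longleftrightarrow> a \<in> Q'.arc_set c" if "c \<in> keys w" for c
      using that \<open>keys w \<subseteq> primitive_cycles Q'\<close> \<open>a \<in> arcs Q'\<close>
      by (intro inj_on_image_mem_iff[OF inj] sub) auto
    then show ?thesis unfolding cover_push by (intro sum.cong refl) simp
  qed
  have outside: "cover (push (\<lambda>c. \<gamma> ` Q'.arc_set c) w) e = 0"
    if "keys w \<subseteq> primitive_cycles Q'" "e \<notin> \<gamma> ` arcs Q'" for w e
    unfolding cover_push using that sub by (intro sum.neutral) auto
  have outside': "cover (push Q'.arc_set w) a = 0"
    if "keys w \<subseteq> primitive_cycles Q'" "a \<notin> arcs Q'" for w a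
    unfolding cover_push using that sub by (intro sum.neutral) auto
  show "cover (push Q'.arc_set u) = cover (push Q'.arc_set v) \<longleftrightarrow>
      cover (push (\<lambda>c. \<gamma> ` Q'.arc_set c) u) = cover (push (\<lambda>c. \<gamma> ` Q'.arc_set c) v)"
  proof
    assume eq: "cover (push Q'.arc_set u) = cover (push Q'.arc_set v)"
    show "cover (push (\<lambda>c. \<gamma> ` Q'.arc_set c) u) = cover (push (\<lambda>c. \<gamma> ` Q'.arc_set c) v)"
    proof
      show "cover (push (\<lambda>c. \<gamma> ` Q'.arc_set c) u) e = cover (push (\<lambda>c. \<gamma> ` Q'.arc_set c) v) e" for e
        using image[OF u] image[OF v] outside[OF u] outside[OF v] eq by (cases "e \<in> \<gamma> ` arcs Q'") auto
    qed
  next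
    assume eq: "cover (push (\<lambda>c. \<gamma> ` Q'.arc_set c) u) = cover (push (\<lambda>c. \<gamma> ` Q'.arc_set c) v)"
    show "cover (push Q'.arc_set u) = cover (push Q'.arc_set v)"
    proof
      show "cover (push Q'.arc_set u) a = cover (push Q'.arc_set v) a" for a
        using image[OF u] image[OF v] outside'[OF u] outside'[OF v] eq by (cases "a \<in> arcs Q'") metis+
    qed
  qed
qed

definition reduced_cycles :: "'a set set" where
  "reduced_cycles = (\<lambda>C. C - {E}) ` Q.cycle_sets"

definition glued_cycles :: "'a set set" where
  "glued_cycles = (`) \<gamma> ` Q'.cycle_sets"

lemma complete_intersection_Q:
  "complete_intersection TYPE('k::field_char_0) Q \<longleftrightarrow>
     (\<exists>N. enat N + krull_dim (iss_ring Q :: ('a, 'k) mpoly ring) = enat (card reduced_cycles) \<and>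
        gen_by N (toric_ideal reduced_cycles :: ('a set, 'k) mpoly set))"
proof -
  interpret cycle_encoding Q "\<lambda>c. Q.arc_set c - {E}" by (rule encoding_Q)
  have "(\<lambda>c. Q.arc_set c - {E}) ` I = reduced_cycles"
    unfolding I_def reduced_cycles_def Q.arc_set_primitive_cycles[symmetric] image_image ..
  then show ?thesis using complete_intersection_iff[where 'k = 'k] by simp
qed

text \<open>The dimension is the one of \<open>Q\<close>, by \<open>krull_dim_contraction\<close>,
  so that only the families of sets remain to be compared.\<close>

lemma complete_intersection_Q':
  "complete_intersection TYPE('k::field_char_0) Q' \<longleftrightarrow>
     (\<exists>N. enat N + krull_dim (iss_ring Q :: ('a, 'k) mpoly ring) = enat (card glued_cycles) \<and>
        gen_by N (toric_ideal glued_cycles :: ('a set, 'k) mpoly set))"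
proof -
  interpret cycle_encoding Q' "\<lambda>c. \<gamma> ` Q'.arc_set c" by (rule encoding_Q')
  have "(\<lambda>c. \<gamma> ` Q'.arc_set c) ` I = glued_cycles"
    unfolding I_def glued_cycles_def Q'.arc_set_primitive_cycles[symmetric] image_image ..
  then show ?thesis
    using complete_intersection_iff[where 'k = 'k] krull_dim_contraction[where 'k = 'k] by simp
qed

section \<open>The cases of one path and of two paths\<close>

lemma reduced_cycles_eq:
  "reduced_cycles = local_cycles \<union> {(set p \<union> set q) - {E} | p q. Q.apath v1 p v2 \<and> Q.apath v2 q v1 \<and>
     distinct (map (tail Q) (p @ q))}"
proof -
  have "(\<lambda>C. C - {E}) ` local_cycles = local_cycles"
    using E_notin_local by (force simp: image_iff)
  then show ?thesis unfolding reduced_cycles_def cycle_sets_eq image_Un by blast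
qed

lemma disjoint_E: "Q.apath v2 q v1 \<Longrightarrow> distinct (map (tail Q) ([E] @ q))"
  using E by (auto simp: Q.apath_iff)

lemma disjoint_F: "Q.apath v1 p v2 \<Longrightarrow> distinct (map (tail Q) (p @ [F]))"
  using F by (auto simp: Q.apath_iff)

text \<open>Every cycle through both vertices consists of \<open>E\<close> and a path back; without
  \<open>E\<close> it is the cycle into which gluing closes that path.\<close>

lemma complete_intersection_iff_single_path:
  assumes "{p. Q.apath v1 p v2} = {[E]}"
  shows "complete_intersection TYPE('k::field_char_0) Q \<longleftrightarrow> complete_intersection TYPE('k) Q'"
proof -
  have path: "Q.apath v1 p v2 \<longleftrightarrow> p = [E]" for p using assms by blast
  have "(set p \<union> set q) - {E} = set q" if "p = [E]" "Q.apath v2 q v1" for p q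
    using that E_notin_apath' by auto
  then have "{(set p \<union> set q) - {E} | p q. Q.apath v1 p v2 \<and> Q.apath v2 q v1 \<and>
      distinct (map (tail Q) (p @ q))} = {set q | q. Q.apath v2 q v1}"
    unfolding path using disjoint_E by (auto simp del: map_append) (metis Un_commute)+
  then have "reduced_cycles = glued_cycles"
    unfolding reduced_cycles_eq glued_cycles_def contracted_cycle_sets path by auto
  then show ?thesis using complete_intersection_Q[where 'k =
      'k] complete_intersection_Q'[where 'k = 'k] by simp
qed


lemma complete_intersection_iff_two_paths:
  assumes U: "{p. Q.apath v1 p v2} = {[E], p}" "p \<noteq> [E]"
    and V: "{q. Q.apath v2 q v1} = {[F], q}" "q \<noteq> [F]"
  shows "complete_intersection TYPE('k::field_char_0) Q \<longleftrightarrow> complete_intersection TYPE('k) Q'"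
proof -
  define P R where "P = set p" and "R = set q"
  have p: "Q.apath v1 p v2" and q: "Q.apath v2 q v1" using U V by blast+
  have path1: "Q.apath v1 s v2 \<longleftrightarrow> s = [E] \<or> s = p" for s using U by blast
  have path2: "Q.apath v2 s v1 \<longleftrightarrow> s = [F] \<or> s = q" for s using V by blast
  have E_P: "E \<notin> P" and F_P: "F \<notin> P" and E_R: "E \<notin> R" and F_R: "F \<notin> R"
    using E_notin_apath[OF p U(2)] F_notin_apath[OF p] E_notin_apath'[OF q] F_notin_apath'[OF q V(2)]
    by (simp_all add: P_def R_def)
  have p': "Q.cas v1 p v2" "set p \<subseteq> arcs Q" "distinct (map (tail Q) p)" "v2 \<notin> tail Q ` set p"
    and q': "Q.cas v2 q v1" "set q \<subseteq> arcs Q" "distinct (map (tail Q) q)" "v1 \<notin> tail Q ` set q"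
    using p q by (auto simp: Q.apath_iff)
  have dist_pq: "distinct p" "distinct q" using p'(3) q'(3) by (auto simp: distinct_map)
  have ne: "P \<noteq> {}" "R \<noteq> {}" using p'(1) q'(1) v12 by (auto simp: P_def R_def)
  \<comment> \<open>\<open>Q.net v1\<close> is -1 at \<open>F\<close>; the correction makes \<delta>
    vanish there and leaves its sums over sets without \<open>F\<close> unchanged.\<close>
  define \<delta> where "\<delta> e = Q.net v1 e + of_bool (e = F)" for e
  have sum_\<delta>: "sum \<delta> C = sum (Q.net v1) C" if "finite C" "F \<notin> C" for C
    using that by (auto simp: \<delta>_def intro!: sum.cong)
  have local: "finite C \<and> C \<noteq> {}" "F \<notin> C" "sum \<delta> C = 0" if C: "C \<in> local_cycles" for C
  proof -
    have "C \<in> Q.cycle_sets" using C by (simp add: local_cycles_def)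
    then show fin: "finite C \<and> C \<noteq> {}" using Q.finite_nonempty_cycle_set by blast
    show F: "F \<notin> C" using F_notin_local[OF C] .
    show "sum \<delta> C = 0" using sum_\<delta>[of C] fin F Q.sum_net_cycle_set[OF \<open>C \<in> Q.cycle_sets\<close>] by simp
  qed
  have \<delta>_P: "sum \<delta> P = 1" and \<delta>_R: "sum \<delta> R = - 1"
    using sum_\<delta>[of P] sum_\<delta>[of R] F_P F_R v12 Q.sum_net_cas[OF p'(1,3)] Q.sum_net_cas[OF q'(1,3)]
    by (simp_all add: P_def R_def)
  have \<delta>_F: "\<delta> F = 0" using F v12 by (simp add: \<delta>_def Q.net_def)
  interpret contracted_paths local_cycles F R P \<delta>
  proof
    show "finite C \<and> C \<noteq> {}" if "C \<in> insert {F} (insert R (insert P local_cycles))" for C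
      using that local(1) ne by (auto simp: P_def R_def)
  qed (fact local F_R F_P \<delta>_F \<delta>_R \<delta>_P)+
  have glued_cycles: "glued_cycles = insert {F} (insert R (insert P local_cycles))"
  proof -
    have "{set s | s. (s = [E] \<or> s = p) \<and> s \<noteq> [E]} = {P}" using U(2) by (auto simp: P_def)
    moreover have "{set t | t. t = [F] \<or> t = q} = {set [F], R}" unfolding R_def by blast
    ultimately show ?thesis unfolding glued_cycles_def contracted_cycle_sets path1 path2 by auto
  qed
  have reduced_cycles: "reduced_cycles = insert {F} (insert R (insert (insert F P) (local_cycles \<union>
      (if distinct (map (tail Q) (p @ q)) then {P \<union> R} else {}))))"
  proof -
    define D where "D s t \<longleftrightarrow> distinct (map (tail Q) (s @ t))" for s t
    have D: "D [E] [F]" "D [E] q" "D p [F]"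
      unfolding D_def by (rule disjoint_E disjoint_F F_apath p q)+
    have "{(set p \<union> set q) - {E} | p q. Q.apath v1 p v2 \<and> Q.apath v2 q v1 \<and> D p q} =
        {(set s \<union> set t) - {E} | s t. (s, t) \<in> {([E], [F]), ([E], q), (p, [F])} \<union> (if D p q then
            {(p, q)} else {})}"
    proof -
      have "Q.apath v1 s v2 \<and> Q.apath v2 t v1 \<and> D s t \<longleftrightarrow>
          (s, t) \<in> {([E], [F]), ([E], q), (p, [F])} \<union> (if D p q then {(p, q)} else {})" for s t
        using D unfolding path1 path2 by auto
      then show ?thesis by simp
    qed
    also have "\<dots> = {{F}, R, insert F P} \<union> (if D p q then {P \<union> R} else {})"
    proof -
      have sets: "(set [E] \<union> set [F]) - {E} = {F}" "(set [E] \<union> set q) - {E} = R"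
        "(set p \<union> set [F]) - {E} = insert F P" "(set p \<union> set q) - {E} = P \<union> R"
        using E_P E_R F_neq_E by (auto simp: P_def R_def)
      have img: "{g s t | s t. (s, t) \<in> A} = (\<lambda>(s, t). g s t) ` A"
        for g :: "'a list \<Rightarrow> 'a list \<Rightarrow> 'a set" and A by force
      show ?thesis
        unfolding img image_Un using sets by (cases "D p q") (simp_all del: list.set)
    qed
    finally show ?thesis unfolding reduced_cycles_eq D_def by auto
  qed
  have fin_local: "finite local_cycles"
  proof (rule finite_subset)
    show "local_cycles \<subseteq> Pow (arcs Q)"
      using Q.finite_nonempty_cycle_set by (auto simp: local_cycles_def)
  qed simp
  have "R \<noteq> P" "R \<notin> local_cycles" "P \<notin> local_cycles" "{F} \<notin> local_cycles" "insert F P \<notin> local_cycles"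
    using \<delta>_R \<delta>_P local(2,3) by auto
  moreover have "{F} \<noteq> R" "{F} \<noteq> P" "insert F P \<noteq> {F}" "insert F P \<noteq> R"
    using F_R F_P ne by auto
  ultimately have card': "card glued_cycles = card local_cycles + 3"
    and card_short: "card (insert {F} (insert R (insert (insert F P) local_cycles))) =
        card local_cycles + 3"
    unfolding glued_cycles using fin_local by auto
  show ?thesis
  proof (cases "distinct (map (tail Q) (p @ q))")
    case True
    have disj: "P \<inter> R = {}" using True by (auto simp: P_def R_def)
    have "v1 \<in> tail Q ` (P \<union> R)" "v2 \<in> tail Q ` (P \<union> R)"
      using Q.cycle_set_of_paths(2,3)[OF p q v12 True] by (simp_all add: P_def R_def)
    then have PR: "P \<union> R \<notin> local_cycles" by (simp add: local_cycles_def)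
    have fam: "reduced_cycles =
        insert {F} (insert R (insert (insert F P) (insert (P \<union> R) local_cycles)))"
      unfolding reduced_cycles if_P[OF True] by simp
    have "P \<union> R \<noteq> R" "P \<union> R \<noteq> {F}" "P \<union> R \<noteq> insert F P" using disj ne F_P F_R by auto
    then have card: "card reduced_cycles = Suc (card glued_cycles)"
      using card_short PR fin_local unfolding card' fam by (simp add: insert_commute[of _ "P \<union> R"])
    have "cover (single P 1 + single R 1) = cover (single (P \<union> R) (1::nat))"
      using disj by (auto simp: fun_eq_iff)
    then have gen: "gen_by N (toric_ideal reduced_cycles :: ('a set, 'k) mpoly set) \<longleftrightarrow>
        N \<ge> 1 \<and> gen_by (N - 1) (toric_ideal glued_cycles :: ('a set, 'k) mpoly set)" for N
      unfolding fam glued_cycles gen_by_contracted_primitive[OF disj PR]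
      by (intro gen_by_uncontracted[of _ "single (P \<union> R) 1"]) (use disj in auto)
    let ?\<kappa> = "krull_dim (iss_ring Q :: ('a, 'k) mpoly ring)"
    \<comment> \<open>The additional cycle \<open>P \<union> R\<close> of \<open>Q\<close> is
      balanced by the one additional generator. For infinite dimension both equations would
      fail.\<close>
    have "enat (Suc N) + ?\<kappa> = enat (card reduced_cycles) \<longleftrightarrow>
        enat N + ?\<kappa> = enat (card glued_cycles)" for N
      unfolding card by (cases ?\<kappa>) simp_all
    then have "(\<exists>N. enat N + ?\<kappa> = enat (card reduced_cycles) \<and>
        gen_by N (toric_ideal reduced_cycles :: ('a set, 'k) mpoly set))
        \<longleftrightarrow> (\<exists>N. enat N + ?\<kappa> = enat (card glued_cycles) \<and>
            gen_by N (toric_ideal glued_cycles :: ('a set, 'k) mpoly set))"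
      unfolding gen by (metis One_nat_def Suc_le_D Suc_eq_plus1 diff_Suc_1 le_add2)
    then show ?thesis
      unfolding complete_intersection_Q[where 'k = 'k] complete_intersection_Q'[where 'k = 'k] .
  next
    case False
    \<comment> \<open>The paths share an inner vertex, where their ends are swapped:
      \<open>p1\<close> continues along \<open>q\<close> back to \<open>v1\<close>, and
      \<open>q1\<close> along \<open>p\<close> back to \<open>v2\<close>. Each of these closed walks
      misses one glued vertex, so it decomposes into local cycles, and together they use the arcs of
      \<open>p\<close> and \<open>q\<close> once each.\<close>
    then obtain e f where ef: "e \<in> set p" "f \<in> set q" "tail Q e = tail Q f"
      using p'(3) q'(3) by (auto simp: distinct_map)
    obtain p1 p2 where p12: "p = p1 @ e # p2" using ef(1) by (metis split_list)
    obtain q1 q2 where q12: "q = q1 @ f # q2" using ef(2) by (metis split_list)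
    define x where "x = tail Q e"
    have cas_p: "Q.cas v1 p1 x" "Q.cas x (e # p2) v2"
      using p'(1) unfolding p12 Q.cas_append x_def by auto
    have cas_q: "Q.cas v2 q1 x" "Q.cas x (f # q2) v1"
      using q'(1) ef(3) unfolding q12 Q.cas_append x_def by auto
    have "x \<in> tail Q ` set p" unfolding x_def using ef(1) by (rule imageI)
    moreover have "x \<in> tail Q ` set q" unfolding x_def ef(3) using ef(2) by (rule imageI)
    ultimately have x: "x \<noteq> v1" "x \<noteq> v2" using p'(4) q'(4) by metis+
    have "p1 \<noteq> []" "q1 \<noteq> []" using cas_p(1) cas_q(1) x by auto
    then have starts: "v1 \<in> tail Q ` set p1" "v2 \<in> tail Q ` set q1"
      using cas_p(1) cas_q(1) by (cases p1; cases q1; auto)+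
    have "tail Q ` set p1 \<inter> tail Q ` set (e # p2) = {}" "tail Q ` set q1 \<inter> tail Q ` set (f # q2) = {}"
      using p'(3) q'(3) unfolding p12 q12 map_append distinct_append set_map by blast+
    then have "v1 \<notin> tail Q ` set (e # p2)" "v2 \<notin> tail Q ` set (f # q2)" using starts by blast+
    moreover have "v1 \<notin> tail Q ` set q1" "v2 \<notin> tail Q ` set p1"
      using p'(4) q'(4) unfolding p12 q12 set_append image_Un by blast+
    ultimately have tails: "v1 \<notin> tail Q ` set (q1 @ e # p2)" "v2 \<notin> tail Q ` set (p1 @ f # q2)"
      unfolding set_append image_Un by blast+
    have "Q.cas v1 (p1 @ f # q2) v1" "Q.cas v2 (q1 @ e # p2) v2"
      using cas_p cas_q unfolding Q.cas_append by blast+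
    moreover have "set (p1 @ f # q2) \<subseteq> arcs Q" "set (q1 @ e # p2) \<subseteq> arcs Q"
      using p'(2) q'(2) by (auto simp: p12 q12)
    ultimately obtain t1 t2 where
      t1: "keys t1 \<subseteq> {C \<in> Q.cycle_sets. C \<subseteq> set (p1 @ f # q2)}" "t1 \<noteq> 0"
          "\<And>g. cover t1 g = count_list (p1 @ f # q2) g"
      and t2: "keys t2 \<subseteq> {C \<in> Q.cycle_sets. C \<subseteq> set (q1 @ e # p2)}" "t2 \<noteq> 0"
          "\<And>g. cover t2 g = count_list (q1 @ e # p2) g"
      using Q.closed_walk_decomposition[of v1 "p1 @ f # q2"] Q.closed_walk_decomposition[of v2
          "q1 @ e # p2"]
      by blast
    have keys: "keys t1 \<subseteq> local_cycles" "keys t2 \<subseteq> local_cycles"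
      using t1(1) t2(1) tails unfolding local_cycles_def by blast+
    have count: "count_list l g = of_bool (g \<in> set l)" if "distinct l" for l and g :: 'a
      using that by (induction l) auto
    have cov: "cover (single P 1 + single R 1) = cover (t1 + t2)"
    proof
      fix g
      have "cover (t1 + t2) g = count_list p g + count_list q g"
        by (simp add: t1(3) t2(3) p12 q12)
      then show "cover (single P 1 + single R 1) g = cover (t1 + t2) g"
        using count[OF dist_pq(1), of g] count[OF dist_pq(2), of g] by (simp add: P_def R_def)
    qed
    have fam: "reduced_cycles = insert {F} (insert R (insert (insert F P) local_cycles))"
      unfolding reduced_cycles if_not_P[OF False] by simp
    have keys12: "keys (t1 + t2) \<subseteq> local_cycles" using keys_add[of t1 t2] keys by blast
    have "gen_by N (toric_ideal reduced_cycles :: ('a set, 'k) mpoly set) \<longleftrightarrow>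
        gen_by N (toric_ideal glued_cycles :: ('a set, 'k) mpoly set)" for N
      unfolding fam glued_cycles gen_by_contracted_composite[OF keys t1(2) t2(2) cov]
      by (intro gen_by_uncontracted[OF _ _ keys12 cov]) auto
    moreover have "card reduced_cycles = card glued_cycles" unfolding fam card' card_short ..
    ultimately show ?thesis
      unfolding complete_intersection_Q[where 'k = 'k] complete_intersection_Q'[where 'k = 'k] by simp
  qed
qed

end


section \<open>Gluing a connected pair\<close>

lemma fin_digraph_glue:
  assumes "fin_digraph Q"
  shows "fin_digraph (glue Q W)"
proof -
  interpret fin_digraph Q by (rule assms)
  have vertex: "glue_vertex W u \<in> verts (glue Q W)" if "u \<in> verts Q" for u
    using that by (simp add: glue_def glue_vertex_def)
  have arc: "a \<in> range Inr \<or> (\<exists>e\<in>arcs Q. a = Inl e)" if "a \<in> arcs (glue Q W)" for a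
    using that by (auto simp: glue_def)
  show ?thesis
  proof
    fix a assume "a \<in> arcs (glue Q W)"
    then consider i where "a = Inr i" | e where "e \<in> arcs Q" "a = Inl e" using arc by blast
    then show "tail (glue Q W) a \<in> verts (glue Q W)" "head (glue Q W) a \<in> verts (glue Q W)"
      using vertex by (cases; simp add: glue_def)+
  qed (simp_all add: glue_def)
qed

text \<open>The new loops number one less than the arcs within the pair, as many as remain after
  \<open>E\<close> is deleted. All of those have both ends in the merged vertex, so any bijection
  will do.\<close>

lemma glue_contraction:
  assumes "fin_digraph Q"
    and E: "E \<in> arcs Q" "tail Q E = v1" "head Q E = v2"
    and F: "F \<in> arcs Q" "tail Q F = v2" "head Q F = v1" and v12: "v1 \<noteq> v2"
  shows "\<exists>\<gamma>. contraction Q (glue Q {v1, v2}) \<gamma> (glue_vertex {v1, v2}) E F v1 v2"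
proof -
  interpret fin_digraph Q by (rule assms)
  let ?A = "arcs (Q \<restriction> {v1, v2})"
  let ?n = "1 + card ?A - card {v1, v2}"
  have A: "?A = {e \<in> arcs Q. tail Q e \<in> {v1, v2} \<and> head Q e \<in> {v1, v2}}"
    by (simp add: induce_subgraph_def)
  have "E \<in> ?A" "finite ?A" using E by (simp_all add: A)
  then have "card {..<?n} = card (?A - {E})" using v12 by simp
  then obtain b where b: "bij_betw b {..<?n} (?A - {E})"
    using finite_same_card_bij[of "{..<?n}" "?A - {E}"] \<open>finite ?A\<close> by auto
  define \<gamma> where "\<gamma> = case_sum (\<lambda>e. e) b"
  have bA: "b i \<in> ?A - {E}" if "i < ?n" for i using b that by (auto simp: bij_betw_def)
  have "contraction Q (glue Q {v1, v2}) \<gamma> (glue_vertex {v1, v2}) E F v1 v2"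
  proof (rule contraction.intro)
    show "bij_betw \<gamma> (arcs (glue Q {v1, v2})) (arcs Q - {E})"
    proof -
      have "bij_betw \<gamma> (Inl ` (arcs Q - ?A)) (arcs Q - ?A)"
        by (rule bij_betwI[where g = Inl]) (auto simp: \<gamma>_def)
      moreover have "bij_betw \<gamma> (Inr ` {..<?n}) (?A - {E})"
        using b by (auto simp: bij_betw_def inj_on_def \<gamma>_def image_image)
      moreover have "(arcs Q - ?A) \<inter> (?A - {E}) = {}" by blast
      ultimately have "bij_betw \<gamma> (Inl ` (arcs Q - ?A) \<union> Inr ` {..<?n}) ((arcs Q - ?A) \<union> (?A - {E}))"
        by (rule bij_betw_combine)
      moreover have "(arcs Q - ?A) \<union> (?A - {E}) = arcs Q - {E}" using \<open>E \<in> ?A\<close> by (auto simp: A)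
      ultimately show ?thesis by (simp add: glue_def)
    qed
    show "tail (glue Q {v1, v2}) a = glue_vertex {v1, v2} (tail Q (\<gamma> a))"
      "head (glue Q {v1, v2}) a = glue_vertex {v1, v2} (head Q (\<gamma> a))"
      if "a \<in> arcs (glue Q {v1, v2})" for a
      using that bA by (cases a; force simp: glue_def \<gamma>_def glue_vertex_def A)+
    show "verts (glue Q {v1, v2}) = glue_vertex {v1, v2} ` verts Q"
      using E F tail_in_verts head_in_verts by (force simp: glue_def glue_vertex_def image_iff)
    show "glue_vertex {v1, v2} u = glue_vertex {v1, v2} v \<longleftrightarrow>
        u = v \<or> u \<in> {v1, v2} \<and> v \<in> {v1, v2}" for u v
      by (auto simp: glue_vertex_def)
  qed (fact assms fin_digraph_glue[OF assms(1)])+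
  then show ?thesis by blast
qed

lemma connected_pair_arcs:
  assumes "connected_pair Q v w"
  obtains E F where "E \<in> arcs Q" "tail Q E = v" "head Q E = w"
    "F \<in> arcs Q" "tail Q F = w" "head Q F = v" "v \<noteq> w"
  using assms by (auto simp: connected_pair_def arcs_ends_conv)

theorem theorem6p2:
  fixes Q :: "('v, 'a) pre_digraph" and v1 v2 :: 'v
  assumes "fin_digraph Q"
    and "connected_pair Q v1 v2"
    and "(card {p. pre_digraph.apath Q v1 p v2} = 2 \<and>
            card {p. pre_digraph.apath Q v2 p v1} = 2) \<or>
         card {p. pre_digraph.apath Q v1 p v2} = 1 \<or>
         card {p. pre_digraph.apath Q v2 p v1} = 1"
  shows "complete_intersection TYPE('k::{alg_closed_field, field_char_0}) Q \<longleftrightarrow>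
         complete_intersection TYPE('k) (glue Q {v1, v2})"
proof -
  obtain E F where EF: "E \<in> arcs Q" "tail Q E = v1" "head Q E = v2"
    "F \<in> arcs Q" "tail Q F = v2" "head Q F = v1" "v1 \<noteq> v2"
    using connected_pair_arcs[OF assms(2)] .
  obtain \<gamma> where "contraction Q (glue Q {v1, v2}) \<gamma> (glue_vertex {v1, v2}) E F v1 v2"
    using glue_contraction[OF assms(1) EF] by blast
  then interpret EF: contraction Q "glue Q {v1, v2}" \<gamma> "glue_vertex {v1, v2}" E F v1 v2 .
  \<comment> \<open>A single path from \<open>v2\<close> to \<open>v1\<close> is the case of a
    single path with the two vertices exchanged, so there \<open>F\<close> is contracted instead of
    \<open>E\<close>.\<close>
  obtain \<gamma>' where "contraction Q (glue Q {v2, v1}) \<gamma>' (glue_vertex {v2, v1}) F E v2 v1"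
    using glue_contraction[OF assms(1) EF(4,5,6) EF(1,2,3) EF(7)[symmetric]] by blast
  then interpret FE: contraction Q "glue Q {v2, v1}" \<gamma>' "glue_vertex {v2, v1}" F E v2 v1 .
  have only: "A = {x}" if "card A = 1" "x \<in> A" for A and x :: "'a list"
    using that by (auto simp: card_1_singleton_iff)
  consider "card {p. pre_digraph.apath Q v1 p v2} = 2" "card {p. pre_digraph.apath Q v2 p v1} = 2"
    | "card {p. pre_digraph.apath Q v1 p v2} = 1" | "card {p. pre_digraph.apath Q v2 p v1} = 1"
    using assms(3) by blast
  then show ?thesis
  proof cases
    case 1
    have other: "\<exists>y. A = {x, y} \<and> y \<noteq> x" if "card A = 2" "x \<in> A" for A and x :: "'a list"
      using that by (auto simp: card_2_iff)
    obtain p where p: "{p. pre_digraph.apath Q v1 p v2} = {[E], p}" "p \<noteq> [E]"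
      using other[OF 1(1), of "[E]"] EF.E_apath by blast
    obtain q where q: "{p. pre_digraph.apath Q v2 p v1} = {[F], q}" "q \<noteq> [F]"
      using other[OF 1(2), of "[F]"] EF.F_apath by blast
    show ?thesis by (rule EF.complete_intersection_iff_two_paths[OF p q])
  next
    case 2
    then have "{p. pre_digraph.apath Q v1 p v2} = {[E]}"
      using EF.E_apath by (intro only) simp_all
    then show ?thesis by (rule EF.complete_intersection_iff_single_path)
  next
    case 3
    then have "{p. pre_digraph.apath Q v2 p v1} = {[F]}"
      using FE.E_apath by (intro only) simp_all
    then show ?thesis
      using FE.complete_intersection_iff_single_path[where 'k = 'k] by (simp add: insert_commute)
  qed
qed

end
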